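(* Let $C$ be a rational monomial curve with a unique singular point. Then the canonical model $C'$ of $C$ lies on a threefold scroll but not on a surface scroll if and only if $\operatorname{gon}(C)=4$.
   Context: Work over an algebraically closed field $k$; a curve is an integral complete one-dimensional $k$-scheme, and $g$ is the arithmetic genus. A rational monomial curve is the image of a morphism $\mathbb{P}^1\to\mathbb{P}^n$, $(s:t)\mapsto(s^{a_n}:t^{a_1}s^{a_n-a_1}:\ldots:t^{a_{n-1}}s^{a_n-a_{n-1}}:t^{a_n})$, with $0<a_1<\ldots<a_n$; it is denoted $(1:t^{a_1}:\ldots:t^{a_n})$. Canonical model. Let $\omega$ be the dualizing sheaf of $C$ and $\pi:\overline{C}\to C$ the normalization. The sections $H^0(\omega)$ generate the invertible sheaf $\pi^*\omega/\mathrm{Torsion}$ on $\overline{C}$ and so define a morphism $\kappa:\overline{C}\to\mathbb{P}^{g-1}$; the canonical model is $C':=\kappa(\overline{C})$. For a rational monomial curve with a unique singular point, $C'$ is again a rational monomial curve $(1:t^{b_1}:\ldots:t^{b_{g-1}})\subset\mathbb{P}^{g-1}$ in suitable coordinates, and these coordinates are used for $C'$. Gonality. For a torsion free rank $1$ sheaf $\mathcal{F}$ on $C$, $\deg\mathcal{F}=\chi(\mathcal{F})-\chi(\mathcal{O}_C)$; $\operatorname{gon}(C)$ is the smallest $d$ for which there is a torsion free rank $1$ sheaf of degree $d$ with $h^0\geq 2$. Scrolls. A $d$-fold rational normal scroll $S_{m_1,\ldots,m_d}\subset\mathbb{P}^N$, with $m_i\geq 0$, $e=m_1+\ldots+m_d\geq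 1$ and $N=e+d-1$, is the locus where the $2\times e$ matrix obtained by juxtaposing $d$ blocks $$\begin{pmatrix} x_{j} & x_{j+1} & \cdots & x_{j+m_i-1} \\ x_{j+1} & x_{j+2} & \cdots & x_{j+m_i} \end{pmatrix},\qquad j=m_1+\ldots+m_{i-1}+(i-1),\quad i=1,\ldots,d$$ (a block being empty if $m_i=0$), has rank less than $2$, after a suitable choice of coordinates. Surface scrolls are the case $d=2$, threefold scrolls the case $d=3$. Convention for monomial curves: the coordinates defining the scroll are the coordinates in which the monomial curve is given, up to reordering them. If $g\leq 3$, then $C'$ lies on a plane, which is regarded as a surface scroll. *)

theory Defs
  imports
    "HOL-Computational_Algebra.Computational_Algebra"
    "HOL-Library.Poly_Mapping"
    "HOL-Library.Function_Algebras"
    "HOL-Combinatorics.Permutations"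
    "Jordan_Normal_Form.DL_Rank"
begin

section \<open>The rational function field and projective space\<close>

type_synonym 'k ratfun = "'k poly fract"

definition const_rf :: "'k::field \<Rightarrow> 'k ratfun" where
  "const_rf c = to_fract [:c:]"

definition scale_rf :: "'k::field \<Rightarrow> 'k ratfun \<Rightarrow> 'k ratfun" where
  "scale_rf c f = const_rf c * f"

interpretation rf: vector_space "scale_rf :: 'k::field \<Rightarrow> 'k ratfun \<Rightarrow> 'k ratfun"
proof unfold_locales
  fix a b :: 'k and x y :: "'k ratfun"
  have "[:a + b:] = [:a:] + [:b:]" "[:a * b:] = [:a:] * [:b:]"
    by simp_all
  then have "const_rf (a + b) = const_rf a + const_rf b" "const_rf (a * b) = const_rf a * const_rf b"
    by (simp_all only: const_rf_def to_fract_add to_fract_mult)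
  then show "scale_rf a (x + y) = scale_rf a x + scale_rf a y"
    and "scale_rf (a + b) x = scale_rf a x + scale_rf b x"
    and "scale_rf a (scale_rf b x) = scale_rf (a * b) x"
    by (simp_all add: scale_rf_def algebra_simps)
  show "scale_rf 1 x = x"
    by (simp add: scale_rf_def const_rf_def flip: one_pCons)
qed

text \<open>
  A closed point of \<open>\<bbbP>\<^sup>n\<close> is the set of all its vectors of homogeneous coordinates,
  that is, the set of nonzero multiples of a nonzero vector of dimension \<open>n + 1\<close>.
\<close>

definition proj_point :: "'k::field vec \<Rightarrow> 'k vec set" where
  "proj_point x = {c \<cdot>\<^sub>v x | c. c \<noteq> 0}"

text \<open>
  Polynomials in the variables \<open>x\<^sub>0, x\<^sub>1, \<dots>\<close> are finitely supported maps from
  monomials (finitely supported exponent maps) to coefficients. The argument \<open>h\<close> of the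
  evaluation embeds the coefficients into the ring in which one evaluates.
\<close>

type_synonym 'k mpoly = "(nat \<Rightarrow>\<^sub>0 nat) \<Rightarrow>\<^sub>0 'k"

definition mpoly_eval :: "('k::field \<Rightarrow> 'r::comm_ring_1) \<Rightarrow> (nat \<Rightarrow> 'r) \<Rightarrow> 'k mpoly \<Rightarrow> 'r" where
  "mpoly_eval h x F =
     (\<Sum>m\<in>Poly_Mapping.keys F. h (Poly_Mapping.lookup F m) *
        (\<Prod>i\<in>Poly_Mapping.keys m. x i ^ Poly_Mapping.lookup m i))"

definition is_form :: "nat \<Rightarrow> nat \<Rightarrow> 'k::field mpoly \<Rightarrow> bool" where
  "is_form n r F \<longleftrightarrow> (\<forall>m\<in>Poly_Mapping.keys F. Poly_Mapping.keys m \<subseteq> {..n} \<and>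
     (\<Sum>i\<in>Poly_Mapping.keys m. Poly_Mapping.lookup m i) = r)"


section \<open>Curves\<close>

text \<open>
  An integral curve together with an embedding of its function field into \<open>k(t)\<close> is
  given by its closed points and their local rings, viewed as subrings of \<open>k(t)\<close>.
\<close>

record (overloaded) ('p, 'k) curve =
  points :: "'p set"
  local_ring :: "'p \<Rightarrow> 'k poly fract set"

definition function_field :: "('p, 'k::field) curve \<Rightarrow> 'k ratfun set" where
  "function_field X =
     {x / y | x y P. P \<in> points X \<and> x \<in> local_ring X P \<and> y \<in> local_ring X P \<and> y \<noteq> 0}"

definition max_ideal :: "('p, 'k::field) curve \<Rightarrow> 'p \<Rightarrow> 'k ratfun set" where
  "max_ideal X P = {x \<in> local_ring X P. \<not> (\<exists>y\<in>local_ring X P. x * y = 1)}"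

text \<open>
  The local rings at closed points have dimension 1, so they are regular if and only if
  their maximal ideals are generated by one element.
\<close>

definition singular :: "('p, 'k::field) curve \<Rightarrow> 'p \<Rightarrow> bool" where
  "singular X P \<longleftrightarrow>
     \<not> (\<exists>z\<in>local_ring X P. max_ideal X P = {x * z | x. x \<in> local_ring X P})"

text \<open>
  Every torsion free sheaf of rank 1 is isomorphic to a coherent subsheaf of the constant
  sheaf given by the function field \<open>K\<close>. Such a subsheaf is determined by its stalks, which
  are nonzero finitely generated submodules of \<open>K\<close> and agree with the local rings at almost
  all points; conversely each such family of stalks comes from a coherent subsheaf.
  The values of \<open>F\<close> outside \<open>points X\<close> are irrelevant.
\<close>

definition tf_sheaf :: "('p, 'k::field) curve \<Rightarrow> ('p \<Rightarrow> 'k ratfun set) \<Rightarrow> bool" where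
  "tf_sheaf X F \<longleftrightarrow>
     (\<forall>P\<in>points X. F P \<noteq> {0} \<and>
        (\<exists>B. finite B \<and> B \<subseteq> function_field X \<and>
           F P = {\<Sum>b\<in>B. c b * b | c. \<forall>b\<in>B. c b \<in> local_ring X P})) \<and>
     finite {P \<in> points X. F P \<noteq> local_ring X P}"

definition H0 :: "('p, 'k::field) curve \<Rightarrow> ('p \<Rightarrow> 'k ratfun set) \<Rightarrow> 'k ratfun set" where
  "H0 X F = {f \<in> function_field X. \<forall>P\<in>points X. f \<in> F P}"

definition h0 :: "('p, 'k::field) curve \<Rightarrow> ('p \<Rightarrow> 'k ratfun set) \<Rightarrow> nat" where
  "h0 X F = rf.dim (H0 X F)"

text \<open>
  The first cohomology is computed with the flasque resolution
  \<open>0 \<rightarrow> F \<rightarrow> K \<rightarrow> \<Oplus>\<^sub>P K/F\<^sub>P \<rightarrow> 0\<close>: if \<open>A\<close> denotes the space of families in \<open>K\<close> that are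
  regular at almost all points, then \<open>\<Oplus>\<^sub>P K/F\<^sub>P = A / \<Prod>\<^sub>P F\<^sub>P\<close> and
  \<open>H\<^sup>1(F) = A / (\<Prod>\<^sub>P F\<^sub>P + K)\<close>, with \<open>K\<close> embedded diagonally. Components outside
  \<open>points X\<close> are unrestricted and disappear in the quotient.
\<close>

definition adeles :: "('p, 'k::field) curve \<Rightarrow> ('p \<Rightarrow> 'k ratfun) set" where
  "adeles X = {\<alpha>. (\<forall>P\<in>points X. \<alpha> P \<in> function_field X) \<and>
                  finite {P \<in> points X. \<alpha> P \<notin> local_ring X P}}"

definition local_adeles ::
  "('p, 'k::field) curve \<Rightarrow> ('p \<Rightarrow> 'k ratfun set) \<Rightarrow> ('p \<Rightarrow> 'k ratfun) set" where
  "local_adeles X F = {\<alpha>. \<forall>P\<in>points X. \<alpha> P \<in> F P}"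

definition principal_adeles :: "('p, 'k::field) curve \<Rightarrow> ('p \<Rightarrow> 'k ratfun) set" where
  "principal_adeles X = {\<lambda>_. f | f. f \<in> function_field X}"

definition scale_ad :: "'k::field \<Rightarrow> ('p \<Rightarrow> 'k ratfun) \<Rightarrow> 'p \<Rightarrow> 'k ratfun" where
  "scale_ad c \<alpha> = (\<lambda>P. scale_rf c (\<alpha> P))"

interpretation ad: vector_space "scale_ad :: 'k::field \<Rightarrow> ('p \<Rightarrow> 'k ratfun) \<Rightarrow> 'p \<Rightarrow> 'k ratfun"
  by unfold_locales
    (simp_all add: scale_ad_def fun_eq_iff rf.scale_right_distrib rf.scale_left_distrib)

text \<open>
  \<open>h1 X F\<close> is the dimension of \<open>A / (\<Prod>\<^sub>P F\<^sub>P + K)\<close>, the least number of elements of \<open>A\<close>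
  whose classes generate the quotient; it is finite on a complete curve.
\<close>

definition h1 :: "('p, 'k::field) curve \<Rightarrow> ('p \<Rightarrow> 'k ratfun set) \<Rightarrow> nat" where
  "h1 X F = (LEAST d. \<exists>B. finite B \<and> card B = d \<and> B \<subseteq> adeles X \<and>
     adeles X \<subseteq> ad.span (B \<union> local_adeles X F \<union> principal_adeles X))"

definition euler_char :: "('p, 'k::field) curve \<Rightarrow> ('p \<Rightarrow> 'k ratfun set) \<Rightarrow> int" where
  "euler_char X F = int (h0 X F) - int (h1 X F)"

definition arith_genus :: "('p, 'k::field) curve \<Rightarrow> nat" where
  "arith_genus X = h1 X (local_ring X)"

definition sheaf_degree :: "('p, 'k::field) curve \<Rightarrow> ('p \<Rightarrow> 'k ratfun set) \<Rightarrow> int" where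
  "sheaf_degree X F = euler_char X F - euler_char X (local_ring X)"

definition gonality :: "('p, 'k::field) curve \<Rightarrow> int" where
  "gonality X = (LEAST d. \<exists>F. tf_sheaf X F \<and> sheaf_degree X F = d \<and> h0 X F \<ge> 2)"


section \<open>The dualizing sheaf and the canonical model\<close>

text \<open>Homomorphisms between subsheaves of \<open>K\<close> of rank 1 are multiplications by elements of \<open>K\<close>.\<close>

definition sheaf_hom :: "('p, 'k::field) curve \<Rightarrow>
    ('p \<Rightarrow> 'k ratfun set) \<Rightarrow> ('p \<Rightarrow> 'k ratfun set) \<Rightarrow> 'k ratfun set" where
  "sheaf_hom X F G = {h \<in> function_field X. \<forall>P\<in>points X. \<forall>x\<in>F P. h * x \<in> G P}"

text \<open>The dual space of \<open>H\<^sup>1(F)\<close>; only the values on \<open>adeles X\<close> are relevant.\<close>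

definition H1_dual :: "('p, 'k::field) curve \<Rightarrow> ('p \<Rightarrow> 'k ratfun set) \<Rightarrow>
    (('p \<Rightarrow> 'k ratfun) \<Rightarrow> 'k) set" where
  "H1_dual X F = {l.
     (\<forall>\<alpha>\<in>adeles X. \<forall>\<beta>\<in>adeles X. l (\<alpha> + \<beta>) = l \<alpha> + l \<beta>) \<and>
     (\<forall>c. \<forall>\<alpha>\<in>adeles X. l (scale_ad c \<alpha>) = c * l \<alpha>) \<and>
     (\<forall>\<alpha>\<in>local_adeles X F \<union> principal_adeles X. l \<alpha> = 0)}"

text \<open>
  The dualizing sheaf is defined by its universal property: there is a trace
  \<open>tr : H\<^sup>1(\<omega>) \<rightarrow> k\<close> such that the pairing \<open>Hom(F,\<omega>) \<times> H\<^sup>1(F) \<rightarrow> H\<^sup>1(\<omega>) \<rightarrow> k\<close> induces an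
  isomorphism \<open>Hom(F,\<omega>) \<cong> H\<^sup>1(F)\<^sup>*\<close>. On an integral curve \<open>\<omega>\<close> is itself torsion free of rank
  1, so the property for all torsion free \<open>F\<close> of rank 1 already determines \<open>(\<omega>, tr)\<close> up to
  unique isomorphism.
\<close>

definition dualizing_sheaf :: "('p, 'k::field) curve \<Rightarrow> ('p \<Rightarrow> 'k ratfun set) \<Rightarrow> bool" where
  "dualizing_sheaf X \<omega> \<longleftrightarrow> tf_sheaf X \<omega> \<and>
     (\<exists>tr\<in>H1_dual X \<omega>. \<forall>F. tf_sheaf X F \<longrightarrow>
        (\<forall>l\<in>H1_dual X F. \<exists>!h. h \<in> sheaf_hom X F \<omega> \<and>
           (\<forall>\<alpha>\<in>adeles X. l \<alpha> = tr (\<lambda>P. h * \<alpha> P))))"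

text \<open>
  \<open>has_value f s t v\<close>: the rational function \<open>f\<close> is regular at the point \<open>(s : t)\<close> of
  \<open>\<bbbP>\<^sup>1\<close> and has the value \<open>v\<close> there. A quotient \<open>p / q\<close> of polynomials of degree at most \<open>D\<close>
  is the quotient of their homogenizations of degree \<open>D\<close>; the affine coordinate is \<open>t / s\<close>.
\<close>

definition hom_eval :: "nat \<Rightarrow> 'k::field poly \<Rightarrow> 'k \<Rightarrow> 'k \<Rightarrow> 'k" where
  "hom_eval D p s t = (\<Sum>i\<le>D. coeff p i * t ^ i * s ^ (D - i))"

definition has_value :: "'k::field ratfun \<Rightarrow> 'k \<Rightarrow> 'k \<Rightarrow> 'k \<Rightarrow> bool" where
  "has_value f s t v \<longleftrightarrow> (\<exists>D p q. degree p \<le> D \<and> degree q \<le> D \<and> hom_eval D q s t \<noteq> 0 \<and>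
     f = Fract p q \<and> v = hom_eval D p s t / hom_eval D q s t)"

text \<open>
  The image of the morphism \<open>\<bbbP>\<^sup>1 \<rightarrow> \<bbbP>\<^sup>N\<close> defined by the rational functions
  \<open>f\<^sub>0, \<dots>, f\<^sub>N\<close>, that is, by the invertible sheaf which they generate: its value at a point is
  obtained by dividing by a local generator \<open>1 / u\<close> of that sheaf. If the \<open>f\<^sub>i\<close> form a basis
  of \<open>H\<^sup>0(\<omega>)\<close>, then this is the image of \<open>\<kappa>\<close>, because the normalization of a curve with
  function field inside \<open>k(t)\<close> is dominated by \<open>\<bbbP>\<^sup>1\<close>.
\<close>

definition morphism_image :: "nat \<Rightarrow> (nat \<Rightarrow> 'k::field ratfun) \<Rightarrow> 'k vec set set" where
  "morphism_image N f = {proj_point x | x s t u. (s, t) \<noteq> (0, 0) \<and> u \<noteq> 0 \<and>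
     x \<in> carrier_vec (N + 1) \<and> x \<noteq> 0\<^sub>v (N + 1) \<and> (\<forall>i\<le>N. has_value (u * f i) s t (x $ i))}"


section \<open>Rational monomial curves\<close>

definition monomial_exponents :: "nat \<Rightarrow> (nat \<Rightarrow> nat) \<Rightarrow> bool" where
  "monomial_exponents n a \<longleftrightarrow> a 0 = 0 \<and> strict_mono_on {..n} a"

definition monomial_points :: "nat \<Rightarrow> (nat \<Rightarrow> nat) \<Rightarrow> 'k::field vec set set" where
  "monomial_points n a =
     {proj_point (vec (n + 1) (\<lambda>i. t ^ a i * s ^ (a n - a i))) | s t. (s, t) \<noteq> (0, 0)}"

text \<open>
  Pulling back along the parametrization embeds the function field into \<open>k(t)\<close> and sends
  \<open>x\<^sub>i / x\<^sub>0\<close> to \<open>t ^ a i\<close>. No condition on the greatest common divisor of the exponents is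
  needed: the function field is \<open>k(t ^ d)\<close> when that divisor is \<open>d\<close>.
\<close>

definition monomial_curve :: "nat \<Rightarrow> (nat \<Rightarrow> nat) \<Rightarrow> ('k::field vec set, 'k) curve" where
  "monomial_curve n a = \<lparr>
     points = monomial_points n a,
     local_ring = (\<lambda>P.
       {mpoly_eval const_rf (\<lambda>i. to_fract (monom 1 (a i))) F /
        mpoly_eval const_rf (\<lambda>i. to_fract (monom 1 (a i))) G | F G r x.
          is_form n r F \<and> is_form n r G \<and> x \<in> P \<and> mpoly_eval id (\<lambda>i. x $ i) G \<noteq> 0}) \<rparr>"

text \<open>
  The basis \<open>f\<^sub>0, \<dots>, f\<^bsub>g-1\<^esub>\<close> of \<open>H\<^sup>0(\<omega>)\<close> gives coordinates of \<open>\<bbbP>\<^bsup>g-1\<^esup>\<close> in which the canonical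
  model is the monomial curve \<open>(1 : t ^ b 1 : \<dots> : t ^ b (g - 1))\<close>, which is a point for \<open>g = 1\<close>.
\<close>

definition monomial_canonical_coordinates :: "('p, 'k::field) curve \<Rightarrow>
    ('p \<Rightarrow> 'k ratfun set) \<Rightarrow> (nat \<Rightarrow> 'k ratfun) \<Rightarrow> (nat \<Rightarrow> nat) \<Rightarrow> bool" where
  "monomial_canonical_coordinates X \<omega> f b \<longleftrightarrow>
     (let g = arith_genus X in
      inj_on f {..<g} \<and> \<not> rf.dependent (f ` {..<g}) \<and> rf.span (f ` {..<g}) = H0 X \<omega> \<and>
      monomial_exponents (g - 1) b \<and> morphism_image (g - 1) f = monomial_points (g - 1) b)"


section \<open>Scrolls\<close>

text \<open>
  \<open>scroll_cols m\<close> lists the indices in the first row of the matrix of the scroll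
  \<open>S\<^bsub>m\<^esub>\<close>; the index below \<open>x\<^sub>j\<close> in the second row is \<open>j + 1\<close>. Blocks are numbered from 0.
\<close>

definition scroll_cols :: "nat list \<Rightarrow> nat list" where
  "scroll_cols m =
     concat (map (\<lambda>i. map (\<lambda>r. sum_list (take i m) + i + r) [0..<m ! i]) [0..<length m])"

definition scroll_matrix :: "nat list \<Rightarrow> (nat \<Rightarrow> 'k) \<Rightarrow> 'k mat" where
  "scroll_matrix m x = mat 2 (sum_list m) (\<lambda>(r, c). x (scroll_cols m ! c + r))"

text \<open>The permutation \<open>\<sigma>\<close> reorders the coordinates of \<open>\<bbbP>\<^sup>N\<close>.\<close>

definition scroll :: "nat \<Rightarrow> nat list \<Rightarrow> (nat \<Rightarrow> nat) \<Rightarrow> 'k::field vec set set" where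
  "scroll N m \<sigma> = {proj_point x | x. x \<in> carrier_vec (N + 1) \<and> x \<noteq> 0\<^sub>v (N + 1) \<and>
     vec_space.rank 2 (scroll_matrix m (\<lambda>j. x $ \<sigma> j)) < 2}"

definition lies_on_scroll :: "nat \<Rightarrow> nat \<Rightarrow> 'k::field vec set set \<Rightarrow> bool" where
  "lies_on_scroll d N Z \<longleftrightarrow> (\<exists>m \<sigma>. length m = d \<and> sum_list m \<ge> 1 \<and> N = sum_list m + d - 1 \<and>
     \<sigma> permutes {..N} \<and> Z \<subseteq> scroll N m \<sigma>)"

text \<open>Curves in \<open>\<bbbP>\<^sup>N\<close> with \<open>N \<le> 2\<close> lie on a plane, which counts as a surface scroll.\<close>

definition lies_on_surface_scroll :: "nat \<Rightarrow> 'k::field vec set set \<Rightarrow> bool" where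
  "lies_on_surface_scroll N Z \<longleftrightarrow> N \<le> 2 \<or> lies_on_scroll 2 N Z"

end

theory Submission
  imports Defs
begin

text \<open>
  Let \<open>S\<close> be the value semigroup at the singular point, \<open>L\<close> the set of its gaps, \<open>m\<close> its
  multiplicity and \<open>T\<close> the parameter \<open>t\<^sup>d\<close> or \<open>t\<^sup>-\<^sup>d\<close> vanishing there; then \<open>g = |L|\<close>. Two sections of a
  torsion free sheaf can be chosen with different valuations at the singular point, so that the least
  degree is attained by a sheaf generated by \<open>1\<close> and \<open>T\<^sup>-\<^sup>\<delta>\<close>, whose degree is \<open>|(S - \<delta>) - S|\<close>.

  By the universal property, \<open>H\<^sup>0(\<omega>)\<close> is spanned by the functions \<open>T\<^sup>-\<^sup>l\<close>, \<open>l \<in> L\<close>, up to a common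
  factor. If \<open>C'\<close> lies on an \<open>e\<close>-fold scroll, then the quotient of the two rows of the matrix is a
  function \<open>x\<close> with \<open>dim ((V + x V) / V) \<le> e\<close>, where \<open>V\<close> is spanned by the coordinates; comparing
  valuations gives \<open>\<delta> > 0\<close> with \<open>|(L + \<delta>) - L| \<le> e\<close>. Conversely, for such a \<open>\<delta>\<close> the gaps decompose
  into \<open>e\<close> chains with step \<open>\<delta>\<close>, which are the blocks of a scroll.

  The two numbers are compared as follows: \<open>|(S - \<delta>) - S| = |(L + \<delta>) - L| + 1\<close> for \<open>\<delta> \<le> m\<close>, while
  \<open>|(L + \<delta>) - L| \<ge> m - 1\<close> for \<open>\<delta> > m\<close>, and \<open>\<delta> = m\<close> already gives degree \<open>m\<close>. Hence some \<open>\<delta>\<close> has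
  \<open>|(L + \<delta>) - L| \<le> e\<close> if and only if the gonality is at most \<open>e + 1\<close>.
\<close>

section \<open>Dimensions of quotients\<close>

text \<open>The definitions provide closed points with stalks, cohomology by adeles, \<omega> by its
  universal property and \<open>C'\<close> as a set of points, and each of these shapes the proof.
  Dimensions are turned into counts of valuations at one point: functions with different valuations
  are independent, also modulo a subspace whose valuations are avoided. Since \<omega> is known only
  up to isomorphism, its sections are found from functionals on H^1(O), where the residues of T^-l
  \<alpha> dT/T are dual to the classes of T^l. The basis \<open>f\<close> is arbitrary, and the
  exponents \<open>b\<close> are tied to the gaps only through an equality of point sets. The link
  is the bound on dim ((V + x V) / V), which does not mention a basis: it is read off from the gap
  monomials at 0 and from the coordinates of \<open>C'\<close> at a point where two of them have
  different orders. Finally the exponents may have a common divisor d and the singular point may lie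
  at 0 or at infinity; hence valuations live on a subfield \<open>K\<close>, and the curve is
  described in two charts, with coordinates t^d and t^-d.\<close>

locale linear_quotients = vector_space
begin

text \<open>Independence of the classes of \<open>C\<close> in the quotient by the span of
  \<open>U\<close>, expressed by an intersection so that no quotient space has to be formed.\<close>

definition indep_mod :: "'b set \<Rightarrow> 'b set \<Rightarrow> bool" where
  "indep_mod U C \<longleftrightarrow> independent C \<and> span C \<inter> span U \<subseteq> {0}"

text \<open>The least number of generators copies the shape of \<open>h1\<close>, which becomes the
  instance for adeles modulo local and principal ones.\<close>

definition codim_in :: "'b set \<Rightarrow> 'b set \<Rightarrow> nat" where
  "codim_in A U = (LEAST d. \<exists>B. finite B \<and> card B = d \<and> B \<subseteq> A \<and> A \<subseteq> span (B \<union> U))"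

lemma indep_mod_mono: "indep_mod U C \<Longrightarrow> U' \<subseteq> span U \<Longrightarrow> indep_mod U' C"
  unfolding indep_mod_def by (metis inf_mono order_refl order_trans span_minimal subspace_span)

text \<open>Exchange in the quotient by \<open>U\<close>: replacing each element of \<open>C\<close>
  by a component in span \<open>B\<close> extends to a linear map \<open>f\<close> that moves every
  vector of span \<open>C\<close> by an element of span \<open>U\<close>. Its kernel on span
  \<open>C\<close> lies in span \<open>U\<close> and is therefore trivial, so the usual bound
  applies to the image of \<open>C\<close>.\<close>

lemma indep_mod_bound:
  assumes C: "indep_mod U C" and B: "finite B" and sub: "C \<subseteq> span (B \<union> U)"
  shows "finite C \<and> card C \<le> card B"
proof -
  interpret vp: vector_space_pair scale scale by unfold_locales
  have "\<forall>c\<in>C. \<exists>b\<in>span B. c - b \<in> span U"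
  proof
    fix c assume "c \<in> C"
    then obtain x y where "c = x + y" "x \<in> span B" "y \<in> span U"
      using sub unfolding span_Un by blast
    then show "\<exists>b\<in>span B. c - b \<in> span U"
      by (intro bexI[of _ x]) auto
  qed
  then obtain b where b: "\<And>c. c \<in> C \<Longrightarrow> b c \<in> span B" "\<And>c. c \<in> C \<Longrightarrow> c - b c \<in> span U"
    by metis
  from C have iC: "independent C" by (simp add: indep_mod_def)
  obtain f where f: "Vector_Spaces.linear scale scale f" "\<And>c. c \<in> C \<Longrightarrow> f c = b c"
    using vp.linear_independent_extend[OF iC, of b] by blast
  interpret f: Vector_Spaces.linear scale scale f by (rule f)
  have fU: "x - f x \<in> span U" if "x \<in> span C" for x
    using that
  proof (induction rule: span_induct_alt)
    case base
    then show ?case by (simp add: span_zero f.zero)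
  next
    case (step c x y)
    have "(c *s x + y) - f (c *s x + y) = c *s (x - f x) + (y - f y)"
      by (simp add: f.add f.scale scale_right_diff_distrib)
    moreover have "c *s (x - f x) + (y - f y) \<in> span U"
      using b(2)[OF step(1)] f(2)[OF step(1)] step(2) by (intro span_add span_scale) simp_all
    ultimately show ?case by (simp only:)
  qed
  have inj: "inj_on f (span C)"
  proof -
    have "x = 0" if "x \<in> span C" "f x = 0" for x
      using fU[OF that(1)] that C by (auto simp: indep_mod_def)
    then show ?thesis
      by (subst f.inj_on_iff_eq_0) auto
  qed
  have ind: "independent (f ` C)"
    using f.independent_injective_image[OF iC inj] .
  have "f ` C \<subseteq> span B"
    using b(1) f(2) by auto
  from independent_span_bound[OF B ind this] have "finite (f ` C)" "card (f ` C) \<le> card B"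
    by auto
  moreover have "inj_on f C"
    using inj span_superset by (meson inj_on_subset)
  ultimately show ?thesis
    by (simp add: card_image finite_image_iff)
qed

lemma independent_Un:
  assumes "independent C" "independent D" "span C \<inter> span D \<subseteq> {0}"
  shows "independent (C \<union> D)" "C \<inter> D = {}"
proof -
  have *: "a \<notin> span ((C \<union> D) - {a})"
    if a: "a \<in> C" "independent C" "independent D" "span C \<inter> span D \<subseteq> {0}" for a C D
  proof
    assume "a \<in> span ((C \<union> D) - {a})"
    moreover have "a \<notin> D"
      using a span_base[of a] dependent_zero by blast
    then have "(C \<union> D) - {a} = (C - {a}) \<union> D" by auto
    ultimately obtain x y where xy: "a = x + y" "x \<in> span (C - {a})" "y \<in> span D"
      by (auto simp: span_Un)
    then have "y = a - x" by simp
    moreover have "x \<in> span C"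
      using xy(2) span_mono[of "C - {a}" C] by auto
    ultimately have "y \<in> span C"
      using a(1) by (simp add: span_diff span_base)
    then have "y = 0" using xy a by blast
    then show False
      using xy a by (auto simp: dependent_def)
  qed
  show "C \<inter> D = {}"
    using assms span_base dependent_zero by blast
  show "independent (C \<union> D)"
    unfolding dependent_def using *[of _ C D] *[of _ D C] assms
    by (metis Int_commute Un_commute Un_iff)
qed

text \<open>Representatives that are independent in two successive quotients are independent in the
  total one; this assembles the pieces of the exact sequence behind the Euler
  characteristic.\<close>

lemma indep_mod_chain:
  assumes C: "indep_mod U C" and D: "indep_mod (U \<union> C) D"
  shows "indep_mod U (C \<union> D)" "C \<inter> D = {}"
proof -
  have CD: "span C \<inter> span D \<subseteq> {0}"
    using D span_mono[of C "U \<union> C"] by (auto simp: indep_mod_def)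
  show "C \<inter> D = {}"
    using independent_Un(2) C D CD by (auto simp: indep_mod_def)
  have ind: "independent (C \<union> D)"
    using independent_Un(1) C D CD by (auto simp: indep_mod_def)
  have "x = 0" if x: "x \<in> span (C \<union> D)" "x \<in> span U" for x
  proof -
    obtain c d where cd: "x = c + d" "c \<in> span C" "d \<in> span D"
      using x by (auto simp: span_Un)
    then have "d = x - c" by simp
    then have "d \<in> span (U \<union> C)"
      using x(2) cd(2) span_mono[of U "U \<union> C"] span_mono[of C "U \<union> C"]
      by (metis Un_upper1 Un_upper2 span_diff subsetD)
    then have "d = 0" using D cd(3) by (auto simp: indep_mod_def)
    then show "x = 0" using cd x C by (auto simp: indep_mod_def)
  qed
  then show "indep_mod U (C \<union> D)"
    using ind by (auto simp: indep_mod_def)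
qed

text \<open>A basis of \<open>U\<close> is extended by elements of \<open>G\<close>, and the added
  ones form \<open>C\<close>. No finiteness is assumed, because spaces of adeles are infinite
  dimensional.\<close>

lemma indep_mod_exists:
  obtains C where "C \<subseteq> G" "indep_mod U C" "G \<subseteq> span (C \<union> U)"
proof -
  obtain BU where BU: "BU \<subseteq> U" "independent BU" "U \<subseteq> span BU"
    using maximal_independent_subset by blast
  obtain B where B: "BU \<subseteq> B" "B \<subseteq> BU \<union> G" "independent B" "BU \<union> G \<subseteq> span B"
    using maximal_independent_subset_extend[of BU "BU \<union> G"] BU(2) by blast
  define C where "C = B - BU"
  have sU: "span U = span BU"
    using BU by (intro span_eq[THEN iffD2]) (auto intro: span_base)
  have "x = 0" if x: "x \<in> span C" "x \<in> span BU" for x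
  proof -
    \<comment> \<open>The coordinates of \<open>x\<close> with respect to \<open>B\<close> are
      supported in \<open>C\<close> and in \<open>BU\<close>, which are disjoint.\<close>
    have "representation B x = representation C x" "representation B x = representation BU x"
      using x B by (auto intro!: representation_extend simp: C_def)
    then have "representation B x b = 0" for b
      using representation_ne_zero[of C x b] representation_ne_zero[of BU x b]
      by (auto simp: C_def)
    moreover have "x \<in> span B"
      using x(2) B(1) span_mono by blast
    ultimately show "x = 0"
      using sum_nonzero_representation_eq[OF B(3), of x] by simp
  qed
  then have "indep_mod U C"
    unfolding indep_mod_def sU using B(3) independent_mono[of B C] by (auto simp: C_def)
  moreover have "C \<subseteq> G" using B by (auto simp: C_def)
  moreover have "G \<subseteq> span (C \<union> U)"
  proof -
    have "span B \<subseteq> span (C \<union> BU)" by (rule span_mono) (auto simp: C_def)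
    also have "\<dots> \<subseteq> span (C \<union> U)" using BU by (intro span_mono) auto
    finally show ?thesis using B by auto
  qed
  ultimately show ?thesis using that by blast
qed

lemma codim_in_eq:
  assumes C: "indep_mod U C" "C \<subseteq> A" "A \<subseteq> span (C \<union> U)" and fin: "finite C"
  shows "codim_in A U = card C"
  unfolding codim_in_def
proof (rule Least_equality)
  show "\<exists>B. finite B \<and> card B = card C \<and> B \<subseteq> A \<and> A \<subseteq> span (B \<union> U)"
    using assms by blast
next
  fix d assume "\<exists>B. finite B \<and> card B = d \<and> B \<subseteq> A \<and> A \<subseteq> span (B \<union> U)"
  then obtain B where "finite B" "card B = d" "A \<subseteq> span (B \<union> U)" by blast
  then show "card C \<le> d" using indep_mod_bound[OF C(1), of B] C(2) by blast
qed

lemma indep_mod_exists_finite: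
  assumes "finite B" "G \<subseteq> span (B \<union> U)"
  obtains C where "C \<subseteq> G" "indep_mod U C" "G \<subseteq> span (C \<union> U)" "finite C"
proof -
  obtain C where C: "C \<subseteq> G" "indep_mod U C" "G \<subseteq> span (C \<union> U)"
    using indep_mod_exists by blast
  moreover have "finite C"
    using indep_mod_bound[OF C(2) assms(1)] C(1) assms(2) by blast
  ultimately show ?thesis using that by blast
qed

lemma span_Un_subset: "X \<subseteq> span Z \<Longrightarrow> Y \<subseteq> span Z \<Longrightarrow> span (X \<union> Y) \<subseteq> span Z"
  by (simp add: span_minimal)

text \<open>The additivity of the Euler characteristic, with
  \<open>0 \<rightarrow> U \<inter> W \<rightarrow> V \<inter> W \<rightarrow> V / U \<rightarrow> A / (U + W) \<rightarrow> A / (V + W) \<rightarrow> 0\<close>.\<close>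

lemma euler_char_difference:
  assumes sub: "subspace U" "subspace V" "subspace W" and UV: "U \<subseteq> V" and VA: "V \<subseteq> A"
    and H: "finite H" "U \<inter> W \<subseteq> span H"
    and A: "finite B" "A \<subseteq> span (B \<union> (U \<union> W))"
    and D: "finite D" "V \<subseteq> span (D \<union> U)"
  obtains C K where "C \<subseteq> V" "indep_mod U C" "finite C" "V \<subseteq> span (C \<union> U)"
    "int (dim (V \<inter> W)) - int (codim_in A (V \<union> W)) =
       int (dim (U \<inter> W)) - int (codim_in A (U \<union> W)) + int (card C)"
    "finite K" "V \<inter> W \<subseteq> span K"
proof -
  have sUW: "subspace (U \<inter> W)" and sVW: "subspace (V \<inter> W)"
    using sub by (simp_all add: subspace_inter)
  \<comment> \<open>\<open>K0\<close>, \<open>C1\<close>, \<open>C2\<close>, \<open>C3\<close>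
    represent bases of U \<inter> W, of V \<inter> W modulo U \<inter> W, of V modulo U + W, and of
    A modulo V + W. Then C1 \<union> C2 represents V / U and C2 \<union> C3 represents A / (U + W),
    so that the cardinality of \<open>C2\<close> cancels.\<close>
  obtain K0 where K0: "K0 \<subseteq> U \<inter> W" "indep_mod {} K0" "U \<inter> W \<subseteq> span (K0 \<union> {})" "finite K0"
    using indep_mod_exists_finite[of H "U \<inter> W" "{}"] H by auto
  obtain C1 where C1: "C1 \<subseteq> V \<inter> W" "indep_mod (U \<inter> W) C1" "V \<inter> W \<subseteq> span (C1 \<union> (U \<inter> W))"
    using indep_mod_exists by blast
  obtain C2 where C2: "C2 \<subseteq> V" "indep_mod (U \<union> W) C2" "V \<subseteq> span (C2 \<union> (U \<union> W))"
    using indep_mod_exists by blast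
  have A': "A \<subseteq> span (B \<union> (V \<union> W))"
    using A(2) span_mono[of "B \<union> (U \<union> W)" "B \<union> (V \<union> W)"] UV by blast
  obtain C3 where C3: "C3 \<subseteq> A" "indep_mod (V \<union> W) C3" "A \<subseteq> span (C3 \<union> (V \<union> W))" "finite C3"
    using indep_mod_exists_finite[OF A(1) A'] by blast
  have k1: "indep_mod {} (K0 \<union> C1)" "K0 \<inter> C1 = {}"
    using indep_mod_chain[OF K0(2), of C1] indep_mod_mono[OF C1(2), of "{} \<union> K0"] K0(1)
    by (auto intro: span_base)
  have "indep_mod U C1"
  proof -
    have "x = 0" if "x \<in> span C1" "x \<in> span U" for x
    proof -
      have "x \<in> W" using that(1) C1(1) sub(3) by (metis le_infE span_minimal subsetD)
      moreover have "x \<in> U" using that(2) sub(1) by (metis span_eq_iff)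
      ultimately have "x \<in> span (U \<inter> W)" by (auto intro: span_base)
      then show "x = 0" using C1(2) that(1) by (auto simp: indep_mod_def)
    qed
    then show ?thesis using C1(2) by (auto simp: indep_mod_def)
  qed
  moreover have "indep_mod (U \<union> C1) C2"
    using indep_mod_mono[OF C2(2), of "U \<union> C1"] C1(1) by (auto intro: span_base)
  ultimately have c: "indep_mod U (C1 \<union> C2)" "C1 \<inter> C2 = {}"
    using indep_mod_chain by blast+
  have k2: "indep_mod (U \<union> W) (C2 \<union> C3)" "C2 \<inter> C3 = {}"
    using indep_mod_chain[OF C2(2), of C3] indep_mod_mono[OF C3(2), of "(U \<union> W) \<union> C2"] UV C2(1)
    by (auto intro: span_base)
  have fin: "finite (C1 \<union> C2)" 
    using indep_mod_bound[OF c(1) D(1)] C1(1) C2(1) D(2) by blast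
  have V: "V \<subseteq> span ((C1 \<union> C2) \<union> U)"
  proof
    fix v assume v: "v \<in> V"
    then obtain x y where xy: "v = x + y" "x \<in> span C2" "y \<in> span (U \<union> W)"
      using C2(3) by (subst (asm) span_Un) blast
    then obtain u w where uw: "y = u + w" "u \<in> U" "w \<in> W"
      using sub by (subst (asm) span_Un) (auto simp: span_eq_iff[THEN iffD2])
    have "x \<in> V" using xy(2) C2(1) sub(2) by (metis span_minimal subsetD)
    moreover have "w = v - x - u" using xy uw by simp
    ultimately have "w \<in> V" using v UV uw sub(2) by (auto intro!: subspace_diff)
    then have "w \<in> span (C1 \<union> (U \<inter> W))" using C1(3) uw by auto
    then have "w \<in> span ((C1 \<union> C2) \<union> U)"
      using span_mono[of "C1 \<union> (U \<inter> W)" "(C1 \<union> C2) \<union> U"] by auto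
    moreover have "x \<in> span ((C1 \<union> C2) \<union> U)"
      using xy(2) span_mono[of C2 "(C1 \<union> C2) \<union> U"] by auto
    moreover have "u \<in> span ((C1 \<union> C2) \<union> U)"
      using uw by (auto intro: span_base)
    ultimately show "v \<in> span ((C1 \<union> C2) \<union> U)"
      unfolding xy uw by (intro span_add)
  qed
  have dU: "dim (U \<inter> W) = card K0"
    using basis_card_eq_dim[of K0 "U \<inter> W"] K0 by (auto simp: indep_mod_def)
  have VK: "V \<inter> W \<subseteq> span (K0 \<union> C1)"
  proof -
    have "span (C1 \<union> (U \<inter> W)) \<subseteq> span (K0 \<union> C1)"
      using K0(3) span_mono[of K0 "K0 \<union> C1"]
      by (intro span_Un_subset) (auto intro: span_base)
    then show ?thesis using C1(3) by auto
  qed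
  have dV: "dim (V \<inter> W) = card K0 + card C1"
  proof -
    have "card (K0 \<union> C1) = dim (V \<inter> W)"
      using k1(1) K0(1) C1(1) VK UV by (intro basis_card_eq_dim) (auto simp: indep_mod_def)
    then show ?thesis using k1(2) K0(4) fin by (simp add: card_Un_disjoint)
  qed
  have cV: "codim_in A (V \<union> W) = card C3"
    using C3 by (intro codim_in_eq) auto
  have cU: "codim_in A (U \<union> W) = card (C2 \<union> C3)"
  proof (rule codim_in_eq)
    show "A \<subseteq> span (C2 \<union> C3 \<union> (U \<union> W))"
    proof -
      have "V \<subseteq> span (C2 \<union> C3 \<union> (U \<union> W))"
        using C2(3) span_mono[of "C2 \<union> (U \<union> W)" "C2 \<union> C3 \<union> (U \<union> W)"] by blast
      then have "span (C3 \<union> (V \<union> W)) \<subseteq> span (C2 \<union> C3 \<union> (U \<union> W))"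
        by (intro span_Un_subset Un_least) (auto intro: span_base)
      then show ?thesis using C3(3) by auto
    qed
  qed (use k2 C2 C3 VA fin in auto)
  show ?thesis
  proof (rule that[of "C1 \<union> C2" "K0 \<union> C1"])
    show "int (dim (V \<inter> W)) - int (codim_in A (V \<union> W)) =
       int (dim (U \<inter> W)) - int (codim_in A (U \<union> W)) + int (card (C1 \<union> C2))"
      using dU dV cV cU c(2) k2(2) fin C3(4) by (simp add: card_Un_disjoint)
  qed (use C1 C2 c fin V K0 VK in auto)
qed

end

interpretation rf: linear_quotients "scale_rf :: 'k::field \<Rightarrow> 'k ratfun \<Rightarrow> 'k ratfun"
  by unfold_locales

interpretation ad: linear_quotients "scale_ad :: 'k::field \<Rightarrow> ('p \<Rightarrow> 'k ratfun) \<Rightarrow> 'p \<Rightarrow> 'k ratfun"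
  by unfold_locales

section \<open>Constant functions and scalars\<close>

lemma const_rf_simps [simp]:
  "const_rf 0 = 0" "const_rf 1 = 1"
  "const_rf (a + b) = const_rf a + const_rf b" "const_rf (a * b) = const_rf a * const_rf b"
  "const_rf (- a) = - const_rf a" "const_rf (a - b) = const_rf a - const_rf b"
  "const_rf a = 0 \<longleftrightarrow> a = 0" "const_rf a = const_rf b \<longleftrightarrow> a = b"
proof -
  have eq: "[:a + b:] = [:a:] + [:b:]" "[:a * b:] = [:a:] * [:b:]" "[:-a:] = -[:a:]" "[:a - b:] = [:a:] - [:b:]"
    by simp_all
  show "const_rf (a + b) = const_rf a + const_rf b" "const_rf (a * b) = const_rf a * const_rf b"
    "const_rf (- a) = - const_rf a" "const_rf (a - b) = const_rf a - const_rf b"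
    by (simp_all only: const_rf_def eq to_fract_add to_fract_mult to_fract_uminus to_fract_diff)
qed (simp_all add: const_rf_def flip: one_pCons)

lemma scale_rf_mult_left: "x * scale_rf c y = scale_rf c (x * y)"
  and scale_rf_mult_right: "scale_rf c y * x = scale_rf c (y * x)"
  by (simp_all add: scale_rf_def ac_simps)

section \<open>Valuations on subfields of \<open>k(t)\<close>\<close>

text \<open>Everything takes place in a subfield \<open>K\<close> of k(t), because the function
  field of a monomial curve is k(t^d) with d the greatest common divisor of the exponents. Since
  \<open>inverse 0 = 0\<close>, closure under inverses has no exception.\<close>

locale const_subfield =
  fixes K :: "'k::field ratfun set"
  assumes const_mem [simp, intro]: "const_rf c \<in> K"
    and add_mem [simp, intro]: "x \<in> K \<Longrightarrow> y \<in> K \<Longrightarrow> x + y \<in> K"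
    and mult_mem [simp, intro]: "x \<in> K \<Longrightarrow> y \<in> K \<Longrightarrow> x * y \<in> K"
    and inverse_mem [simp, intro]: "x \<in> K \<Longrightarrow> inverse x \<in> K"
begin

lemma zero_mem [simp]: "0 \<in> K" and one_mem [simp]: "1 \<in> K"
  using const_mem[of 0] const_mem[of 1] by simp_all

lemma uminus_mem [simp, intro]: "x \<in> K \<Longrightarrow> - x \<in> K"
  using mult_mem[OF const_mem[of "- 1"], of x] by simp

lemma diff_mem [simp, intro]: "x \<in> K \<Longrightarrow> y \<in> K \<Longrightarrow> x - y \<in> K"
  using add_mem[OF _ uminus_mem, of x y] by simp

lemma scale_mem [simp, intro]: "x \<in> K \<Longrightarrow> scale_rf c x \<in> K"
  by (simp add: scale_rf_def)

lemma divide_mem [simp, intro]: "x \<in> K \<Longrightarrow> y \<in> K \<Longrightarrow> x / y \<in> K"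
  by (simp add: divide_inverse)

lemma power_mem [simp, intro]: "x \<in> K \<Longrightarrow> x ^ n \<in> K"
  by (induction n) simp_all

lemma power_int_mem [simp, intro]: "x \<in> K \<Longrightarrow> x powi i \<in> K"
  by (simp add: power_int_def)

lemma sum_mem [intro]: "(\<And>i. i \<in> I \<Longrightarrow> f i \<in> K) \<Longrightarrow> sum f I \<in> K"
  by (induction I rule: infinite_finite_induct) auto

lemma subspace_K: "rf.subspace K"
  by (auto intro!: rf.subspaceI)

lemma span_subset: "B \<subseteq> K \<Longrightarrow> rf.span B \<subseteq> K"
  using rf.span_minimal subspace_K by blast

end

text \<open>\<open>at_least v n x\<close> says that \<open>x\<close> has valuation at least \<open>n\<close>, where 0 has valuation \<open>\<infinity>\<close>;
  the integer \<open>v 0\<close> is meaningless.\<close>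

definition at_least :: "('k::field ratfun \<Rightarrow> int) \<Rightarrow> int \<Rightarrow> 'k ratfun \<Rightarrow> bool" where
  "at_least v n x \<longleftrightarrow> x = 0 \<or> n \<le> v x"

text \<open>\<open>v_residue\<close> says that the residue field is k. This makes every graded piece
  of the filtration by \<open>v\<close> at most one dimensional and allows expansions to any
  order.\<close>

locale rf_valuation = const_subfield K for K :: "'k::field ratfun set" +
  fixes v :: "'k ratfun \<Rightarrow> int"
  assumes v_mult: "x \<in> K \<Longrightarrow> y \<in> K \<Longrightarrow> x \<noteq> 0 \<Longrightarrow> y \<noteq> 0 \<Longrightarrow> v (x * y) = v x + v y"
    and v_add: "x \<in> K \<Longrightarrow> y \<in> K \<Longrightarrow> x \<noteq> 0 \<Longrightarrow> y \<noteq> 0 \<Longrightarrow> x + y \<noteq> 0 \<Longrightarrow> min (v x) (v y) \<le> v (x + y)"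
    and v_const: "c \<noteq> 0 \<Longrightarrow> v (const_rf c) = 0"
    and v_residue: "x \<in> K \<Longrightarrow> at_least v 0 x \<Longrightarrow> \<exists>c. at_least v 1 (x - const_rf c)"
begin

lemma v_one [simp]: "v 1 = 0"
  using v_const[of 1] by simp

lemma v_inverse: "x \<in> K \<Longrightarrow> x \<noteq> 0 \<Longrightarrow> v (inverse x) = - v x"
  using v_mult[of x "inverse x"] by simp

lemma v_scale [simp]: "x \<in> K \<Longrightarrow> x \<noteq> 0 \<Longrightarrow> c \<noteq> 0 \<Longrightarrow> v (scale_rf c x) = v x"
  using v_mult[of "const_rf c" x] by (simp add: scale_rf_def v_const)

lemma v_uminus [simp]: "x \<in> K \<Longrightarrow> v (- x) = v x"
  using v_scale[of x "- 1"] by (cases "x = 0") (simp_all add: scale_rf_def)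

lemma v_divide: "x \<in> K \<Longrightarrow> y \<in> K \<Longrightarrow> x \<noteq> 0 \<Longrightarrow> y \<noteq> 0 \<Longrightarrow> v (x / y) = v x - v y"
  using v_mult[of x "inverse y"] by (simp add: divide_inverse v_inverse)

lemma v_power: "x \<in> K \<Longrightarrow> x \<noteq> 0 \<Longrightarrow> v (x ^ n) = int n * v x"
  by (induction n) (simp_all add: v_mult algebra_simps)

lemma v_power_int: "x \<in> K \<Longrightarrow> x \<noteq> 0 \<Longrightarrow> v (x powi i) = i * v x"
  by (simp add: power_int_def v_power v_inverse)

lemma at_least_0 [simp]: "at_least v n 0"
  by (simp add: at_least_def)

lemma at_least_mono: "at_least v n x \<Longrightarrow> m \<le> n \<Longrightarrow> at_least v m x"
  by (auto simp: at_least_def)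

lemma at_least_add: "x \<in> K \<Longrightarrow> y \<in> K \<Longrightarrow> at_least v n x \<Longrightarrow> at_least v n y \<Longrightarrow> at_least v n (x + y)"
proof (cases "x = 0 \<or> y = 0 \<or> x + y = 0")
  case False
  assume "x \<in> K" "y \<in> K" "at_least v n x" "at_least v n y"
  then show ?thesis using v_add[of x y] False unfolding at_least_def by linarith
next
  case True
  assume "at_least v n x" "at_least v n y"
  then show ?thesis using True by (elim disjE) (simp_all add: at_least_def)
qed

lemma at_least_uminus [simp]: "x \<in> K \<Longrightarrow> at_least v n (- x) \<longleftrightarrow> at_least v n x"
  by (auto simp: at_least_def)

lemma at_least_diff: "x \<in> K \<Longrightarrow> y \<in> K \<Longrightarrow> at_least v n x \<Longrightarrow> at_least v n y \<Longrightarrow> at_least v n (x - y)"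
  using at_least_add[of x "- y" n] by simp

lemma at_least_mult:
  "x \<in> K \<Longrightarrow> y \<in> K \<Longrightarrow> at_least v m x \<Longrightarrow> at_least v n y \<Longrightarrow> at_least v (m + n) (x * y)"
proof (cases "x = 0 \<or> y = 0")
  case False
  assume "x \<in> K" "y \<in> K" "at_least v m x" "at_least v n y"
  then show ?thesis using v_mult[of x y] False unfolding at_least_def by linarith
next
  case True
  then show ?thesis by (elim disjE) simp_all
qed

lemma at_least_const [simp]: "at_least v 0 (const_rf c)"
  using v_const[of c] by (cases "c = 0") (auto simp: at_least_def)

lemma at_least_one [simp]: "at_least v 0 1"
  by (simp add: at_least_def)

lemma at_least_scale [simp]: "x \<in> K \<Longrightarrow> at_least v n x \<Longrightarrow> at_least v n (scale_rf c x)"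
  using at_least_mult[of "const_rf c" x 0 n] by (simp add: scale_rf_def)

lemma at_least_sum:
  "(\<And>i. i \<in> I \<Longrightarrow> f i \<in> K) \<Longrightarrow> (\<And>i. i \<in> I \<Longrightarrow> at_least v n (f i)) \<Longrightarrow> at_least v n (sum f I)"
  by (induction I rule: infinite_finite_induct) (auto intro!: at_least_add)

lemma at_least_power_int:
  "u \<in> K \<Longrightarrow> u \<noteq> 0 \<Longrightarrow> n \<le> i * v u \<Longrightarrow> at_least v n (u powi i)"
  by (simp add: at_least_def v_power_int)

lemma subspace_at_least: "rf.subspace {x \<in> K. at_least v n x}"
  by (auto intro!: rf.subspaceI at_least_add)

lemma v_add_eq:
  assumes "x \<in> K" "y \<in> K" "x \<noteq> 0" "at_least v (v x + 1) y"
  shows "x + y \<noteq> 0 \<and> v (x + y) = v x"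
proof (cases "y = 0")
  case False
  then have y: "v x < v y" using assms(4) by (simp add: at_least_def)
  have nz: "x + y \<noteq> 0"
  proof
    assume "x + y = 0"
    then have "x = - y" by (simp add: eq_neg_iff_add_eq_0)
    then show False using y assms by simp
  qed
  have "min (v (x + y)) (v (- y)) \<le> v ((x + y) + (- y))"
    using assms False nz by (intro v_add) auto
  then have "v (x + y) \<le> v x" using y assms by simp
  moreover have "v x \<le> v (x + y)" using v_add[of x y] assms False nz y by simp
  ultimately show ?thesis using nz by simp
qed (use assms in simp)

lemma residue_step:
  assumes x: "x \<in> K" "at_least v n x" and u: "u \<in> K" "u \<noteq> 0" "v u = n"
  obtains c where "at_least v (n + 1) (x - scale_rf c u)"
proof -
  have "at_least v 0 (x / u)"
    using at_least_mult[OF x(1) inverse_mem[OF u(1)] x(2), of "- n"] u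
    by (simp add: divide_inverse at_least_def v_inverse)
  then obtain c where c: "at_least v 1 (x / u - const_rf c)"
    using v_residue[of "x / u"] x(1) u(1) by auto
  have "at_least v (1 + n) ((x / u - const_rf c) * u)"
    using c x(1) u by (intro at_least_mult) (auto simp: at_least_def)
  also have "(x / u - const_rf c) * u = x - scale_rf c u"
    using u(2) by (simp add: scale_rf_def algebra_simps)
  finally show ?thesis using that by (simp add: add.commute)
qed

text \<open>A truncated Laurent expansion; each step removes the leading term by
  \<open>residue_step\<close>. For \<open>j\<close> \<le> \<open>i\<close> the sum is empty and the
  claim is weaker than the assumption.\<close>

lemma expansion:
  assumes u: "u \<in> K" "u \<noteq> 0" "v u = 1" and x: "x \<in> K" "at_least v i x"
  obtains c where "at_least v j (x - (\<Sum>m\<in>{i..<j}. scale_rf (c m) (u powi m)))"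
proof -
  have "\<exists>c. at_least v (i + int k) (x - (\<Sum>m\<in>{i..<i + int k}. scale_rf (c m) (u powi m)))" for k
  proof (induction k)
    case (Suc k)
    then obtain c where c: "at_least v (i + int k) (x - (\<Sum>m\<in>{i..<i + int k}. scale_rf (c m) (u powi m)))"
      by blast
    let ?y = "x - (\<Sum>m\<in>{i..<i + int k}. scale_rf (c m) (u powi m))"
    have y: "?y \<in> K" using u x by auto
    obtain a where a: "at_least v (i + int k + 1) (?y - scale_rf a (u powi (i + int k)))"
      using residue_step[OF y c, of "u powi (i + int k)"] u by (auto simp: v_power_int)
    have eq: "{i..<i + int (Suc k)} = insert (i + int k) {i..<i + int k}" by auto
    have same: "(\<Sum>m\<in>{i..<i + int k}. scale_rf ((c(i + int k := a)) m) (u powi m)) =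
        (\<Sum>m\<in>{i..<i + int k}. scale_rf (c m) (u powi m))"
      by (intro sum.cong) auto
    have "x - (\<Sum>m\<in>{i..<i + int (Suc k)}. scale_rf ((c(i + int k := a)) m) (u powi m)) =
        ?y - scale_rf a (u powi (i + int k))"
      unfolding eq by (subst sum.insert) (simp_all add: same del: fun_upd_apply, simp)
    moreover have "i + int (Suc k) = i + int k + 1" by simp
    ultimately have "at_least v (i + int (Suc k))
        (x - (\<Sum>m\<in>{i..<i + int (Suc k)}. scale_rf ((c(i + int k := a)) m) (u powi m)))"
      using a by (simp only:)
    then show ?case by blast
  qed (use x in simp)
  from this[of "nat (j - i)"] obtain c where
    "at_least v (i + int (nat (j - i))) (x - (\<Sum>m\<in>{i..<i + int (nat (j - i))}. scale_rf (c m) (u powi m)))"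
    by blast
  then show ?thesis
    using that[of c] at_least_mono[OF x(2), of j] by (cases "i \<le> j") auto
qed

text \<open>Terms with different valuations cannot cancel: the term of least valuation determines
  that of the sum. This gives both the independence of \<open>C\<close> and all valuations occurring
  in its span.\<close>

lemma distinct_values:
  assumes "finite C" "C \<subseteq> K" "0 \<notin> C" "inj_on v C"
  defines "x k \<equiv> (\<Sum>c\<in>C. scale_rf (k c) c)"
  shows "(x k = 0 \<and> (\<forall>c\<in>C. k c = 0)) \<or> (x k \<noteq> 0 \<and> v (x k) \<in> v ` C)"
  using assms(1-4) unfolding x_def
proof (induction C rule: finite_induct)
  case (insert a C)
  let ?y = "\<Sum>c\<in>C. scale_rf (k c) c" and ?z = "scale_rf (k a) a"
  have IH: "(?y = 0 \<and> (\<forall>c\<in>C. k c = 0)) \<or> (?y \<noteq> 0 \<and> v ?y \<in> v ` C)"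
    using insert by auto
  have y: "?y \<in> K" using insert by auto
  have s: "(\<Sum>c\<in>insert a C. scale_rf (k c) c) = ?z + ?y"
    using insert by simp
  show ?case
  proof (cases "k a = 0")
    case True
    then show ?thesis using IH s by auto
  next
    case ka: False
    have a: "a \<in> K" "a \<noteq> 0" using insert by auto
    have z: "?z \<in> K" "?z \<noteq> 0" "v ?z = v a" using a ka by auto
    show ?thesis
    proof (cases "?y = 0")
      case True
      then show ?thesis using s z by auto
    next
      case False
      then have "v ?y \<in> v ` C" using IH by auto
      moreover have "v a \<notin> v ` C"
        using insert.prems(3) insert.hyps by auto
      ultimately have "v ?y < v ?z \<or> v ?z < v ?y" using z(3) by (metis linorder_neqE)
      then have "?z + ?y \<noteq> 0 \<and> (v (?z + ?y) = v ?z \<or> v (?z + ?y) = v ?y)"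
      proof
        assume "v ?y < v ?z"
        then show ?thesis
          using v_add_eq[OF y z(1) False] by (auto simp: at_least_def add.commute)
      next
        assume "v ?z < v ?y"
        then show ?thesis
          using v_add_eq[OF z(1) y z(2)] by (auto simp: at_least_def)
      qed
      then show ?thesis using s z(3) \<open>v ?y \<in> v ` C\<close> by auto
    qed
  qed
qed simp

text \<open>Elements of \<open>M\<close> with pairwise different valuations, none of which occurs in
  \<open>U\<close>, are independent modulo \<open>U\<close>. This is the passage from dimensions to
  counting.\<close>

lemma card_values_le:
  assumes U: "rf.subspace U" and M: "M \<subseteq> K" and B: "finite B" "M \<subseteq> rf.span (B \<union> U)"
  shows "finite (v ` (M - {0}) - v ` (U - {0}))" "card (v ` (M - {0}) - v ` (U - {0})) \<le> card B"
proof -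
  let ?N = "v ` (M - {0}) - v ` (U - {0})"
  have le: "card N \<le> card B" if N: "finite N" "N \<subseteq> ?N" for N
  proof -
    have "\<forall>n\<in>N. \<exists>m\<in>M - {0}. v m = n" using N(2) by auto
    then obtain m where m: "\<And>n. n \<in> N \<Longrightarrow> m n \<in> M - {0} \<and> v (m n) = n" by metis
    define C where "C = m ` N"
    have inj: "inj_on m N" using m by (metis inj_onI)
    have "v ` C = N"
      unfolding C_def image_image using m by simp
    then have C: "finite C" "C \<subseteq> K" "0 \<notin> C" "v ` C = N" "C \<subseteq> M"
      using m M N(1) by (auto simp: C_def)
    have "inj_on v C"
      by (rule inj_onI) (use m in \<open>auto simp: C_def\<close>)
    with C have C: "finite C" "C \<subseteq> K" "0 \<notin> C" "inj_on v C" "v ` C = N" "C \<subseteq> M" by simp_all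
    have "rf.independent C"
    proof (rule rf.independent_if_scalars_zero[OF C(1)])
      fix k c assume "(\<Sum>c\<in>C. scale_rf (k c) c) = 0" "c \<in> C"
      then show "k c = 0" using distinct_values[OF C(1-4), of k] by simp
    qed
    moreover have "x = 0" if "x \<in> rf.span C" "x \<in> U" for x
    proof (rule ccontr)
      assume "x \<noteq> 0"
      obtain k where "x = (\<Sum>c\<in>C. scale_rf (k c) c)"
        using \<open>x \<in> rf.span C\<close> by (auto simp: rf.span_finite[OF C(1)])
      then have "v x \<in> N" using distinct_values[OF C(1-4), of k] \<open>x \<noteq> 0\<close> C(5) by auto
      then show False using N(2) \<open>x \<in> U\<close> \<open>x \<noteq> 0\<close> by auto
    qed
    moreover have span_U: "rf.span U = U" using U by simp
    ultimately have "rf.indep_mod U C" unfolding rf.indep_mod_def span_U by blast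
    from rf.indep_mod_bound[OF this B(1)] C(6) B(2) have "card C \<le> card B" by auto
    then show "card N \<le> card B" using inj by (simp add: C_def card_image)
  qed
  \<comment> \<open>An infinite set has cardinality 0, so the bound is first proved for finite
    subsets; one with \<open>Suc (card B)\<close> elements would violate it.\<close>
  show "finite ?N"
  proof (rule ccontr)
    assume "infinite ?N"
    then obtain N where "N \<subseteq> ?N" "finite N" "card N = Suc (card B)"
      using infinite_arbitrarily_large[of ?N "Suc (card B)"] by auto
    then show False using le[of N] by simp
  qed
  then show "card ?N \<le> card B" using le by simp
qed

end

section \<open>Rational curves with at most one singular point\<close>

definition point_adele :: "'p \<Rightarrow> 'k::field ratfun \<Rightarrow> 'p \<Rightarrow> 'k ratfun" where
  "point_adele P x = (\<lambda>Q. if Q = P then x else 0)"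

lemma point_adele_simps [simp]: "point_adele P x P = x" "Q \<noteq> P \<Longrightarrow> point_adele P x Q = 0"
  by (simp_all add: point_adele_def)

lemma linear_point_adele: "Vector_Spaces.linear scale_rf scale_ad (point_adele P)"
  by (simp add: Vector_Spaces.linear_iff rf.vector_space_axioms ad.vector_space_axioms
      point_adele_def scale_ad_def fun_eq_iff)

lemma linear_diagonal: "Vector_Spaces.linear scale_rf scale_ad (\<lambda>x _. x)"
  by (simp add: Vector_Spaces.linear_iff rf.vector_space_axioms ad.vector_space_axioms
      scale_ad_def fun_eq_iff)

lemma linear_component: "Vector_Spaces.linear scale_ad scale_rf (\<lambda>\<alpha>. \<alpha> P)"
  by (simp add: Vector_Spaces.linear_iff rf.vector_space_axioms ad.vector_space_axioms
      scale_ad_def)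

lemma linear_mult_ad: "Vector_Spaces.linear scale_ad scale_ad (\<lambda>\<alpha> P. h * \<alpha> P)"
  by (simp add: Vector_Spaces.linear_iff ad.vector_space_axioms
      scale_ad_def fun_eq_iff distrib_left scale_rf_mult_left)

lemma linear_mult_rf: "Vector_Spaces.linear scale_rf scale_rf ((*) h)"
  by (simp add: Vector_Spaces.linear_iff rf.vector_space_axioms
      distrib_left scale_rf_mult_left)

lemma linear_span_image:
  assumes "Vector_Spaces.linear s1 s2 f"
  shows "Modules.module.span s2 (f ` B) = f ` Modules.module.span s1 B"
proof -
  interpret Vector_Spaces.linear s1 s2 f by fact
  show ?thesis by (rule span_image)
qed

lemma linear_dim_image:
  assumes f: "Vector_Spaces.linear s1 s2 f" and inj: "inj f"
    and V: "Modules.module.subspace s1 V"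
  shows "vector_space.dim s2 (f ` V) = vector_space.dim s1 V"
proof -
  interpret Vector_Spaces.linear s1 s2 f by fact
  obtain B where B: "B \<subseteq> V" "vs1.independent B" "V \<subseteq> vs1.span B" "card B = vs1.dim V"
    using vs1.basis_exists by blast
  have "card (f ` B) = vs2.dim (f ` V)"
  proof (rule vs2.basis_card_eq_dim)
    show "f ` V \<subseteq> vs2.span (f ` B)"
      using B(3) by (simp add: span_image image_mono)
    show "vs2.independent (f ` B)"
      using B(2) inj by (meson independent_injective_image inj_on_subset subset_UNIV)
  qed (use B in auto)
  moreover have "card (f ` B) = card B"
    using inj by (meson card_image inj_on_subset subset_UNIV)
  ultimately show ?thesis using B(4) by simp
qed

text \<open>A curve whose normalization is the projective line and in which only \<open>P0\<close>
  may be singular. \<open>regular_const\<close> and \<open>principal_part\<close> express that the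
  structure sheaf of the projective line has only constant sections and no first cohomology;
  \<open>T\<close> has the divisor P0 - Pinf. The stalk at \<open>P0\<close> consists of
  combinations of T^s, s in \<open>S\<close>, up to order \<open>c\<close>, where \<open>c\<close>
  is some bound beyond which \<open>S\<close> has no gaps, not necessarily the least one.\<close>

locale unibranch_curve = const_subfield K for K :: "'k::field ratfun set" +
  fixes X :: "('p, 'k) curve" and v :: "'p \<Rightarrow> 'k ratfun \<Rightarrow> int"
    and P0 Pinf :: 'p and T :: "'k ratfun" and S :: "nat set" and c :: nat
  assumes function_field: "function_field X = K"
    and valuation: "P \<in> points X \<Longrightarrow> rf_valuation K (v P)"
    and uniformizer: "P \<in> points X \<Longrightarrow> \<exists>u\<in>K. u \<noteq> 0 \<and> v P u = 1"
    and finite_poles: "x \<in> K \<Longrightarrow> finite {P \<in> points X. \<not> at_least (v P) 0 x}"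
    and regular_const:
      "x \<in> K \<Longrightarrow> (\<And>P. P \<in> points X \<Longrightarrow> at_least (v P) 0 x) \<Longrightarrow> \<exists>a. x = const_rf a"
    and principal_part: "P \<in> points X \<Longrightarrow> x \<in> K \<Longrightarrow>
      \<exists>y\<in>K. at_least (v P) 0 (x - y) \<and> (\<forall>Q\<in>points X - {P}. at_least (v Q) 0 y)"
    and P0: "P0 \<in> points X" and Pinf: "Pinf \<in> points X" and P0_neq_Pinf: "P0 \<noteq> Pinf"
    and T_mem: "T \<in> K" and T_nz: "T \<noteq> 0" and v_T_P0: "v P0 T = 1" and v_T_Pinf: "v Pinf T = - 1"
    and v_T_other: "P \<in> points X \<Longrightarrow> P \<noteq> P0 \<Longrightarrow> P \<noteq> Pinf \<Longrightarrow> v P T = 0"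
    and zero_S: "0 \<in> S" and add_S: "s \<in> S \<Longrightarrow> s' \<in> S \<Longrightarrow> s + s' \<in> S"
    and conductor_S: "c \<le> s \<Longrightarrow> s \<in> S"
    and local_ring_smooth:
      "P \<in> points X \<Longrightarrow> P \<noteq> P0 \<Longrightarrow> local_ring X P = {x \<in> K. at_least (v P) 0 x}"
    and local_ring_P0: "local_ring X P0 =
      {x \<in> K. \<exists>y\<in>rf.span ((\<lambda>s. T ^ s) ` S). at_least (v P0) (int c) (x - y)}"
begin

abbreviation "A \<equiv> adeles X"
abbreviation "W \<equiv> principal_adeles X"
abbreviation "OX \<equiv> local_ring X"
abbreviation "LA \<equiv> local_adeles X"

interpretation v0: rf_valuation K "v P0"
  using valuation P0 .

lemma v0_T_power: "v P0 (T ^ s) = int s" "v P0 (T powi i) = i"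
  by (simp_all add: v0.v_power v0.v_power_int T_mem T_nz v_T_P0)

lemma T_powi_mem [simp]: "T powi i \<in> K" "T ^ s \<in> K"
  using T_mem by auto

lemma local_ring_P0_I: "x \<in> K \<Longrightarrow> y \<in> rf.span ((\<lambda>s. T ^ s) ` S) \<Longrightarrow>
    at_least (v P0) (int c) (x - y) \<Longrightarrow> x \<in> OX P0"
  using local_ring_P0 by auto

lemma span_T_subset: "rf.span ((\<lambda>s. T ^ s) ` S) \<subseteq> K"
  by (intro span_subset) auto

lemma span_T_mult:
  assumes "x \<in> rf.span ((\<lambda>s. T ^ s) ` S)" "y \<in> rf.span ((\<lambda>s. T ^ s) ` S)"
  shows "x * y \<in> rf.span ((\<lambda>s. T ^ s) ` S)"
proof -
  have 1: "T ^ s * y \<in> rf.span ((\<lambda>s. T ^ s) ` S)" if "s \<in> S" for s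
    using assms(2)
  proof (induction rule: rf.span_induct_alt)
    case (step a z z')
    then obtain s' where "s' \<in> S" "z = T ^ s'" by auto
    then have "T ^ s * z \<in> (\<lambda>s. T ^ s) ` S"
      using add_S[OF \<open>s \<in> S\<close>] by (auto simp flip: power_add)
    then have "scale_rf a (T ^ s * z) + T ^ s * z' \<in> rf.span ((\<lambda>s. T ^ s) ` S)"
      using step(2) by (intro rf.span_add[OF rf.span_scale[OF rf.span_base]])
    then show ?case
      by (simp add: distrib_left scale_rf_mult_left)
  qed (simp add: rf.span_zero)
  show ?thesis using assms(1)
  proof (induction rule: rf.span_induct_alt)
    case (step a z z')
    then show ?case
      using 1 by (auto simp: distrib_right scale_rf_mult_right intro!: rf.span_add rf.span_scale)
  qed (simp add: rf.span_zero)
qed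

lemma span_T_regular:
  assumes "x \<in> rf.span ((\<lambda>s. T ^ s) ` S)" shows "at_least (v P0) 0 x"
proof -
  have "rf.span ((\<lambda>s. T ^ s) ` S) \<subseteq> {x \<in> K. at_least (v P0) 0 x}"
    by (intro rf.span_minimal v0.subspace_at_least) (auto simp: at_least_def v0_T_power)
  then show ?thesis using assms by auto
qed

lemma T_power_mem: "s \<in> S \<Longrightarrow> T ^ s \<in> OX P0"
  by (rule local_ring_P0_I[of _ "T ^ s"]) (auto intro: rf.span_base)

lemma local_ring_subset: "P \<in> points X \<Longrightarrow> OX P \<subseteq> {x \<in> K. at_least (v P) 0 x}"
proof (cases "P = P0")
  case True
  have "at_least (v P0) 0 x"
    if "x \<in> K" "y \<in> rf.span ((\<lambda>s. T ^ s) ` S)" "at_least (v P0) (int c) (x - y)" for x y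
  proof -
    have "at_least (v P0) 0 ((x - y) + y)"
      using that span_T_subset span_T_regular
      by (intro v0.at_least_add) (auto elim: v0.at_least_mono)
    then show ?thesis by simp
  qed
  then show ?thesis using True local_ring_P0 by auto
qed (simp add: local_ring_smooth)

lemma conductor_subset: "P \<in> points X \<Longrightarrow> x \<in> K \<Longrightarrow> at_least (v P) (int c) x \<Longrightarrow> x \<in> OX P"
proof (cases "P = P0")
  case True
  assume "x \<in> K" "at_least (v P) (int c) x"
  then show ?thesis using True by (auto intro!: local_ring_P0_I[of x 0] simp: rf.span_zero)
next
  case False
  assume *: "P \<in> points X" "x \<in> K" "at_least (v P) (int c) x"
  then interpret vP: rf_valuation K "v P" by (intro valuation)
  show ?thesis using * False by (auto simp: local_ring_smooth elim: vP.at_least_mono)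
qed

lemma subspace_local_ring: "P \<in> points X \<Longrightarrow> rf.subspace (OX P)"
proof (cases "P = P0")
  case True
  show ?thesis unfolding True
  proof (rule rf.subspaceI)
    show "0 \<in> OX P0" by (auto intro!: local_ring_P0_I[of 0 0] simp: rf.span_zero)
  next
    fix x y assume "x \<in> OX P0" "y \<in> OX P0"
    then obtain x' y' where *: "x \<in> K" "y \<in> K" "x' \<in> rf.span ((\<lambda>s. T ^ s) ` S)" "y' \<in> rf.span ((\<lambda>s. T ^ s) ` S)"
      "at_least (v P0) (int c) (x - x')" "at_least (v P0) (int c) (y - y')"
      using local_ring_P0 by auto
    have "at_least (v P0) (int c) ((x - x') + (y - y'))"
      using * span_T_subset by (intro v0.at_least_add) auto
    then show "x + y \<in> OX P0"
      using * by (intro local_ring_P0_I[of _ "x' + y'"]) (auto intro: rf.span_add simp: algebra_simps)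
  next
    fix a x assume "x \<in> OX P0"
    then obtain x' where *: "x \<in> K" "x' \<in> rf.span ((\<lambda>s. T ^ s) ` S)" "at_least (v P0) (int c) (x - x')"
      using local_ring_P0 by auto
    have "at_least (v P0) (int c) (scale_rf a (x - x'))"
      using * span_T_subset by (intro v0.at_least_scale) auto
    then show "scale_rf a x \<in> OX P0"
      using * by (intro local_ring_P0_I[of _ "scale_rf a x'"])
        (auto intro: rf.span_scale simp: rf.scale_right_diff_distrib)
  qed
next
  case False
  assume P: "P \<in> points X"
  then interpret vP: rf_valuation K "v P" by (intro valuation)
  show ?thesis using P False vP.subspace_at_least by (simp add: local_ring_smooth)
qed

lemma one_mem_local_ring: "P \<in> points X \<Longrightarrow> 1 \<in> OX P"
proof (cases "P = P0")
  case True
  then show ?thesis using T_power_mem[OF zero_S] by simp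
qed (auto simp: local_ring_smooth at_least_def rf_valuation.v_one[OF valuation])

lemma mult_local_ring: "P \<in> points X \<Longrightarrow> x \<in> OX P \<Longrightarrow> y \<in> OX P \<Longrightarrow> x * y \<in> OX P"
proof (cases "P = P0")
  case True
  assume "x \<in> OX P" "y \<in> OX P"
  then obtain x' y' where *: "x \<in> K" "y \<in> K" "x' \<in> rf.span ((\<lambda>s. T ^ s) ` S)" "y' \<in> rf.span ((\<lambda>s. T ^ s) ` S)"
    "at_least (v P0) (int c) (x - x')" "at_least (v P0) (int c) (y - y')"
    using local_ring_P0 True by auto
  have r: "at_least (v P0) 0 y" using \<open>y \<in> OX P\<close> True local_ring_subset[OF P0] by auto
  have mem: "x' \<in> K" "y' \<in> K" using * span_T_subset by auto
  have "at_least (v P0) (int c + 0) ((x - x') * y)" "at_least (v P0) (0 + int c) (x' * (y - y'))"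
    using * mem r span_T_regular by (blast intro!: v0.at_least_mult)+
  then have "at_least (v P0) (int c) ((x - x') * y + x' * (y - y'))"
    using * mem by (intro v0.at_least_add) auto
  then show ?thesis
    using * span_T_mult unfolding True
    by (intro local_ring_P0_I[of _ "x' * y'"]) (auto simp: algebra_simps)
next
  case False
  assume P: "P \<in> points X" and xy: "x \<in> OX P" "y \<in> OX P"
  then interpret vP: rf_valuation K "v P" by (intro valuation)
  show ?thesis using P False vP.at_least_mult[of x y 0 0] xy by (auto simp: local_ring_smooth)
qed

text \<open>Below \<open>c\<close> the valuation of an element is that of the combination
  \<open>y\<close> of powers of \<open>T\<close>, hence one of the exponents in \<open>S\<close>;
  from \<open>c\<close> on all integers lie in \<open>S\<close>.\<close>

lemma values_local_ring_P0: "v P0 ` (OX P0 - {0}) = int ` S"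
proof
  show "int ` S \<subseteq> v P0 ` (OX P0 - {0})"
    using T_power_mem T_nz by (force simp: v0_T_power image_iff intro!: bexI[of _ "T ^ _"])
next
  show "v P0 ` (OX P0 - {0}) \<subseteq> int ` S"
  proof
    fix n assume "n \<in> v P0 ` (OX P0 - {0})"
    then obtain x where x: "x \<in> OX P0" "x \<noteq> 0" and n: "n = v P0 x" by auto
    then obtain y where y: "x \<in> K" "y \<in> rf.span ((\<lambda>s. T ^ s) ` S)" "at_least (v P0) (int c) (x - y)"
      using local_ring_P0 by auto
    have nonneg: "0 \<le> v P0 x" using local_ring_subset[OF P0] x by (auto simp: at_least_def)
    have "v P0 x \<in> int ` S"
    proof (cases "int c \<le> v P0 x")
      case True
      then have "nat (v P0 x) \<in> S" by (intro conductor_S) auto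
      then show ?thesis using nonneg by (intro image_eqI[of _ _ "nat (v P0 x)"]) auto
    next
      case False
      have "at_least (v P0) (int c) (y - x)"
        using y span_T_subset v0.at_least_uminus[of "x - y"] by auto
      then have yv: "x + (y - x) \<noteq> 0 \<and> v P0 (x + (y - x)) = v P0 x"
        using False y x span_T_subset by (intro v0.v_add_eq) (auto elim: v0.at_least_mono)
      obtain C k where C: "finite C" "C \<subseteq> (\<lambda>s. T ^ s) ` S" "y = (\<Sum>a\<in>C. scale_rf (k a) a)"
        using y(2) by (auto simp: rf.span_explicit)
      have "inj_on (v P0) C"
      proof (rule inj_onI)
        fix a b assume "a \<in> C" "b \<in> C" "v P0 a = v P0 b"
        moreover from this obtain s s' where "a = T ^ s" "b = T ^ s'" using C(2) by blast
        ultimately show "a = b" by (simp add: v0_T_power)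
      qed
      moreover have "C \<subseteq> K" "0 \<notin> C" using C(2) T_nz by auto
      ultimately have "y = 0 \<or> v P0 y \<in> v P0 ` C"
        using v0.distinct_values[of C k] C by auto
      then have "v P0 y \<in> v P0 ` C" using yv by simp
      then show ?thesis using C(2) yv by (auto simp: v0_T_power)
    qed
    then show "n \<in> int ` S" using n by simp
  qed
qed

lemma finite_gaps: "finite (- S)" 
  by (rule finite_subset[of _ "{..<c}"]) (use conductor_S leI in blast)+

section \<open>Stalks of torsion free sheaves and their adeles\<close>

lemma tf_sheaf_subset: "tf_sheaf X F \<Longrightarrow> P \<in> points X \<Longrightarrow> F P \<subseteq> K"
  using local_ring_subset by (fastforce simp: tf_sheaf_def function_field)

lemma tf_sheaf_mult:
  assumes F: "tf_sheaf X F" "P \<in> points X" and x: "x \<in> OX P" "y \<in> F P"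
  shows "x * y \<in> F P"
proof -
  obtain B where B: "finite B" "F P = {\<Sum>b\<in>B. f b * b | f. \<forall>b\<in>B. f b \<in> OX P}"
    using F unfolding tf_sheaf_def by blast
  obtain f where f: "y = (\<Sum>b\<in>B. f b * b)" "\<forall>b\<in>B. f b \<in> OX P" using x B by auto
  have "x * y = (\<Sum>b\<in>B. (x * f b) * b)" unfolding f by (simp add: sum_distrib_left mult.assoc)
  moreover have "\<forall>b\<in>B. x * f b \<in> OX P" using f x F mult_local_ring by auto
  ultimately show ?thesis unfolding B by (intro CollectI exI[of _ "\<lambda>b. x * f b"] conjI)
qed

lemma subspace_tf_sheaf:
  assumes F: "tf_sheaf X F" "P \<in> points X"
  shows "rf.subspace (F P)"
proof -
  obtain B where B: "finite B" "F P = {\<Sum>b\<in>B. f b * b | f. \<forall>b\<in>B. f b \<in> OX P}"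
    using F unfolding tf_sheaf_def by blast
  note sub = subspace_local_ring[OF F(2)]
  show ?thesis
  proof (rule rf.subspaceI)
    show "0 \<in> F P" unfolding B using rf.subspace_0[OF sub] by (auto intro!: exI[of _ "\<lambda>_. 0"])
  next
    fix x y assume "x \<in> F P" "y \<in> F P"
    then obtain f g where fg: "x = (\<Sum>b\<in>B. f b * b)" "\<forall>b\<in>B. f b \<in> OX P"
      "y = (\<Sum>b\<in>B. g b * b)" "\<forall>b\<in>B. g b \<in> OX P" using B by auto
    have "x + y = (\<Sum>b\<in>B. (f b + g b) * b)" unfolding fg by (simp add: sum.distrib distrib_right)
    moreover have "\<forall>b\<in>B. f b + g b \<in> OX P" using fg rf.subspace_add[OF sub] by auto
    ultimately show "x + y \<in> F P" unfolding B by (intro CollectI exI[of _ "\<lambda>b. f b + g b"]) auto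
  next
    fix a x assume "x \<in> F P"
    moreover have "const_rf a \<in> OX P"
      using rf.subspace_scale[OF sub one_mem_local_ring[OF F(2)], of a] by (simp add: scale_rf_def)
    ultimately show "scale_rf a x \<in> F P" using tf_sheaf_mult[OF F] by (simp add: scale_rf_def)
  qed
qed

lemma subspace_local_adeles:
  "(\<And>P. P \<in> points X \<Longrightarrow> rf.subspace (F P)) \<Longrightarrow> ad.subspace (LA F)"
  by (rule ad.subspaceI)
    (auto simp: local_adeles_def scale_ad_def intro: rf.subspace_0 rf.subspace_add rf.subspace_scale)

lemma subspace_principal: "ad.subspace W"
proof -
  have "W = (\<lambda>x _. x) ` K" by (auto simp: principal_adeles_def function_field)
  then show ?thesis
    using module_hom.subspace_image[OF _ subspace_K] linear_diagonal
    by (metis module_hom_iff_linear)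
qed

lemma subspace_adeles: "ad.subspace A"
proof (rule ad.subspaceI)
  fix \<alpha> \<beta> assume *: "\<alpha> \<in> A" "\<beta> \<in> A"
  have "{P \<in> points X. (\<alpha> + \<beta>) P \<notin> OX P} \<subseteq> {P \<in> points X. \<alpha> P \<notin> OX P} \<union> {P \<in> points X. \<beta> P \<notin> OX P}"
    using rf.subspace_add[OF subspace_local_ring] by auto
  then have "finite {P \<in> points X. (\<alpha> + \<beta>) P \<notin> OX P}"
    by (rule finite_subset) (use * in \<open>auto simp: adeles_def\<close>)
  then show "\<alpha> + \<beta> \<in> A" using * by (auto simp: adeles_def function_field)
next
  fix a and \<alpha> :: "'p \<Rightarrow> 'k ratfun" assume *: "\<alpha> \<in> A"
  have "{P \<in> points X. scale_ad a \<alpha> P \<notin> OX P} \<subseteq> {P \<in> points X. \<alpha> P \<notin> OX P}"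
    using rf.subspace_scale[OF subspace_local_ring] by (auto simp: scale_ad_def)
  then have "finite {P \<in> points X. scale_ad a \<alpha> P \<notin> OX P}"
    by (rule finite_subset) (use * in \<open>auto simp: adeles_def\<close>)
  then show "scale_ad a \<alpha> \<in> A" using * by (auto simp: adeles_def function_field scale_ad_def)
next
  have "{P \<in> points X. 0 \<notin> OX P} = {}"
    using rf.subspace_0[OF subspace_local_ring] by blast
  then have "finite {P \<in> points X. 0 \<notin> OX P}" by (simp only: finite.emptyI)
  then show "0 \<in> A" by (simp add: adeles_def function_field)
qed

lemma principal_subset: "W \<subseteq> A"
proof -
  have "finite {P \<in> points X. x \<notin> OX P}" if "x \<in> K" for x
  proof (rule finite_subset)
    show "{P \<in> points X. x \<notin> OX P} \<subseteq> insert P0 {P \<in> points X. \<not> at_least (v P) 0 x}"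
      using that by (auto simp: local_ring_smooth)
  qed (use finite_poles that in simp)
  then show ?thesis by (auto simp: principal_adeles_def adeles_def function_field)
qed

lemma local_adeles_subset:
  assumes "tf_sheaf X F" shows "LA F \<subseteq> A"
proof
  fix \<alpha> assume \<alpha>: "\<alpha> \<in> LA F"
  have "{P \<in> points X. \<alpha> P \<notin> OX P} \<subseteq> {P \<in> points X. F P \<noteq> OX P}"
    using \<alpha> by (auto simp: local_adeles_def)
  then have "finite {P \<in> points X. \<alpha> P \<notin> OX P}"
    by (rule finite_subset) (use assms in \<open>auto simp: tf_sheaf_def\<close>)
  then show "\<alpha> \<in> A" using \<alpha> tf_sheaf_subset[OF assms]
    by (auto simp: adeles_def local_adeles_def function_field)
qed

lemma point_adele_mem: "(\<And>Q. Q \<in> points X \<Longrightarrow> rf.subspace (F Q)) \<Longrightarrow> x \<in> F P \<Longrightarrow> point_adele P x \<in> LA F"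
  by (auto simp: local_adeles_def point_adele_def rf.subspace_0)

lemma tf_local_ring: "tf_sheaf X OX"
  unfolding tf_sheaf_def
proof (intro conjI ballI)
  fix P assume P: "P \<in> points X"
  show "OX P \<noteq> {0}" using one_mem_local_ring[OF P] by auto
  show "\<exists>B. finite B \<and> B \<subseteq> function_field X \<and> OX P = {\<Sum>b\<in>B. f b * b |f. \<forall>b\<in>B. f b \<in> OX P}"
    by (rule exI[of _ "{1}"]) (auto simp: function_field intro: exI[of _ "\<lambda>_. _"])
qed simp

section \<open>Cohomology of the structure sheaf and the genus\<close>

lemma h1_eq_codim: "h1 X F = ad.codim_in A (LA F \<union> W)"
  by (simp add: h1_def ad.codim_in_def Un_assoc)

text \<open>Sections are moved to the diagonal of the adeles, so that \<open>h0\<close> and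
  \<open>h1\<close> refer to the same subspaces in \<open>euler_char_difference\<close>.\<close>

lemma h0_eq_dim:
  assumes "\<And>P. P \<in> points X \<Longrightarrow> rf.subspace (F P)"
  shows "h0 X F = ad.dim (LA F \<inter> W)" and "rf.subspace (H0 X F)"
    and "LA F \<inter> W = (\<lambda>x _. x) ` H0 X F"
proof -
  show s: "rf.subspace (H0 X F)"
    using assms subspace_K
    by (intro rf.subspaceI) (auto simp: H0_def function_field rf.subspace_0 rf.subspace_add rf.subspace_scale)
  show eq: "LA F \<inter> W = (\<lambda>x _. x) ` H0 X F"
    by (auto simp: local_adeles_def principal_adeles_def H0_def function_field)
  show "h0 X F = ad.dim (LA F \<inter> W)"
    unfolding eq h0_def by (intro linear_dim_image[symmetric] linear_diagonal s) (simp add: inj_def fun_eq_iff)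
qed

text \<open>The vanishing of H^1 for the structure sheaf of the normalization: a global function
  with the prescribed principal parts at the finitely many bad points is subtracted.\<close>

lemma regular_adeles: "A \<subseteq> {\<beta> + w | \<beta> w. (\<forall>P\<in>points X. \<beta> P \<in> K \<and> at_least (v P) 0 (\<beta> P)) \<and> w \<in> W}"
proof
  fix \<alpha> assume \<alpha>: "\<alpha> \<in> A"
  define Z where "Z = {P \<in> points X. \<alpha> P \<notin> OX P}"
  have Z: "finite Z" using \<alpha> by (simp add: adeles_def Z_def)
  have \<alpha>K: "\<alpha> P \<in> K" if "P \<in> points X" for P using \<alpha> that by (simp add: adeles_def function_field)
  have "\<forall>P\<in>Z. \<exists>y\<in>K. at_least (v P) 0 (\<alpha> P - y) \<and> (\<forall>Q\<in>points X - {P}. at_least (v Q) 0 y)"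
    using principal_part \<alpha>K by (auto simp: Z_def)
  then obtain y where y: "\<And>P. P \<in> Z \<Longrightarrow> y P \<in> K"
    "\<And>P. P \<in> Z \<Longrightarrow> at_least (v P) 0 (\<alpha> P - y P)"
    "\<And>P Q. P \<in> Z \<Longrightarrow> Q \<in> points X - {P} \<Longrightarrow> at_least (v Q) 0 (y P)"
    by metis
  define w where "w = (\<Sum>P\<in>Z. y P)"
  have wK: "w \<in> K" using y by (auto simp: w_def)
  have "at_least (v P) 0 (\<alpha> P - w)" if P: "P \<in> points X" for P
  proof -
    interpret vP: rf_valuation K "v P" using valuation P .
    show ?thesis
    proof (cases "P \<in> Z")
      case True
      \<comment> \<open>The principal parts chosen at the other points are regular at
        \<open>P\<close> and do not disturb it.\<close>
      have "at_least (v P) 0 (\<Sum>Q\<in>Z - {P}. y Q)"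
        using y P by (intro vP.at_least_sum) auto
      then have "at_least (v P) 0 ((\<alpha> P - y P) - (\<Sum>Q\<in>Z - {P}. y Q))"
        using y(1)[OF True] y(2)[OF True] \<alpha>K[OF P] y(1)
        by (intro vP.at_least_diff[OF diff_mem sum_mem]) auto
      then show ?thesis
        using sum.remove[OF Z True, of y] by (simp add: w_def algebra_simps)
    next
      case False
      have "at_least (v P) 0 w"
        unfolding w_def using y P False by (intro vP.at_least_sum) auto
      then show ?thesis
        using False P \<alpha>K wK local_ring_subset[OF P] by (intro vP.at_least_diff) (auto simp: Z_def)
    qed
  qed
  then have "(\<forall>P\<in>points X. (\<lambda>P. \<alpha> P - w) P \<in> K \<and> at_least (v P) 0 ((\<lambda>P. \<alpha> P - w) P)) \<and> (\<lambda>_. w) \<in> W"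
    using \<alpha>K wK by (auto simp: principal_adeles_def function_field)
  moreover have "\<alpha> = (\<lambda>P. \<alpha> P - w) + (\<lambda>_. w)" by (simp add: fun_eq_iff)
  ultimately show "\<alpha> \<in> {\<beta> + w | \<beta> w. (\<forall>P\<in>points X. \<beta> P \<in> K \<and> at_least (v P) 0 (\<beta> P)) \<and> w \<in> W}"
    by blast
qed

text \<open>Representatives of a basis of H^1 of the structure sheaf, one for each gap.\<close>

definition gap_adeles :: "('p \<Rightarrow> 'k ratfun) set" where
  "gap_adeles = point_adele P0 ` (\<lambda>l. T ^ l) ` (- S)"

text \<open>After a principal adele is removed, the component at \<open>P0\<close> is regular. In
  its expansion up to order \<open>c\<close> the terms with exponent in \<open>S\<close> belong to
  the stalk, and only gaps remain.\<close>

lemma adeles_span: "A \<subseteq> ad.span (gap_adeles \<union> (LA OX \<union> W))"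
proof
  fix \<alpha> assume "\<alpha> \<in> A"
  then obtain \<beta> w where *: "\<alpha> = \<beta> + w" "w \<in> W"
    "\<And>P. P \<in> points X \<Longrightarrow> \<beta> P \<in> K \<and> at_least (v P) 0 (\<beta> P)"
    using regular_adeles by blast
  obtain a where a: "at_least (v P0) (int c) (\<beta> P0 - (\<Sum>m\<in>{0..<int c}. scale_rf (a m) (T powi m)))"
    using v0.expansion[OF T_mem T_nz v_T_P0, of "\<beta> P0" 0] *(3)[OF P0] by blast
  have sum_eq: "(\<Sum>m\<in>{0..<int c}. scale_rf (a m) (T powi m)) = (\<Sum>m<c. scale_rf (a (int m)) (T ^ m))"
    by (rule sum.reindex_bij_witness[of _ int nat]) (auto simp: power_int_def)
  define z where "z = (\<Sum>m\<in>{..<c} - S. scale_rf (a (int m)) (T ^ m))"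
  have "(\<Sum>m<c. scale_rf (a (int m)) (T ^ m)) = z + (\<Sum>m\<in>{..<c} \<inter> S. scale_rf (a (int m)) (T ^ m))"
    unfolding z_def by (subst sum.Int_Diff[of _ _ S]) (auto simp: add.commute)
  then have "at_least (v P0) (int c) ((\<beta> P0 - z) - (\<Sum>m\<in>{..<c} \<inter> S. scale_rf (a (int m)) (T ^ m)))"
    using a unfolding sum_eq by (simp add: algebra_simps)
  moreover have "z \<in> K" unfolding z_def by auto
  ultimately have mem: "\<beta> P0 - z \<in> OX P0"
    using *(3)[OF P0]
    by (intro local_ring_P0_I[of _ "\<Sum>m\<in>{..<c} \<inter> S. scale_rf (a (int m)) (T ^ m)"])
      (auto intro!: rf.span_sum rf.span_scale[OF rf.span_base])
  have "z \<in> rf.span ((\<lambda>l. T ^ l) ` (- S))"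
    unfolding z_def by (auto intro!: rf.span_sum rf.span_scale[OF rf.span_base])
  then have 1: "point_adele P0 z \<in> ad.span gap_adeles"
    unfolding gap_adeles_def linear_span_image[OF linear_point_adele] by auto
  have 2: "\<beta> - point_adele P0 z \<in> LA OX"
    using mem *(3) by (auto simp: local_adeles_def point_adele_def local_ring_smooth)
  have "\<alpha> = point_adele P0 z + ((\<beta> - point_adele P0 z) + w)" using * by simp
  moreover have "point_adele P0 z \<in> ad.span (gap_adeles \<union> (LA OX \<union> W))"
    using 1 ad.span_mono[of gap_adeles "gap_adeles \<union> (LA OX \<union> W)"] by auto
  ultimately show "\<alpha> \<in> ad.span (gap_adeles \<union> (LA OX \<union> W))"
    using 2 *(2) by (metis UnI1 UnI2 ad.span_add ad.span_base)
qed

lemma local_principal: "LA OX \<inter> W \<subseteq> ad.span {\<lambda>_. 1}"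
proof
  fix \<alpha> assume "\<alpha> \<in> LA OX \<inter> W"
  then obtain x where x: "\<alpha> = (\<lambda>_. x)" "x \<in> K" "\<And>P. P \<in> points X \<Longrightarrow> x \<in> OX P"
    by (auto simp: local_adeles_def principal_adeles_def function_field)
  then obtain a where "x = const_rf a" using regular_const local_ring_subset by blast
  then have "\<alpha> = scale_ad a (\<lambda>_. 1)" unfolding x by (simp add: scale_ad_def scale_rf_def)
  then show "\<alpha> \<in> ad.span {\<lambda>_. 1}" by (simp add: ad.span_scale ad.span_base)
qed

text \<open>A nonzero combination has a gap as its valuation, whereas the valuations in the stalk
  lie in \<open>S\<close>.\<close>

lemma gap_combination_mem:
  assumes "(\<Sum>l\<in>- S. scale_rf (a l) (T ^ l)) \<in> OX P0" "l \<in> - S"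
  shows "a l = 0"
proof -
  let ?C = "(\<lambda>l. T ^ l) ` (- S)"
  \<comment> \<open>\<open>distinct_values\<close> indexes coefficients by elements; the exponent of
    a power of \<open>T\<close> is recovered as its valuation.\<close>
  let ?k = "\<lambda>x. a (nat (v P0 x))"
  have inj: "inj_on (\<lambda>l. T ^ l) (- S)" by (rule inj_onI) (metis v0_T_power(1) of_nat_eq_iff)
  have "(\<Sum>x\<in>?C. scale_rf (?k x) x) = (\<Sum>l\<in>- S. scale_rf (a l) (T ^ l))"
    by (subst sum.reindex[OF inj]) (simp add: v0_T_power)
  moreover have "inj_on (v P0) ?C" by (rule inj_onI) (auto simp: v0_T_power)
  moreover have "finite ?C" "?C \<subseteq> K" "0 \<notin> ?C" using finite_gaps T_nz by auto
  ultimately have "(\<forall>x\<in>?C. ?k x = 0) \<or> v P0 (\<Sum>l\<in>- S. scale_rf (a l) (T ^ l)) \<in> v P0 ` ?C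
      \<and> (\<Sum>l\<in>- S. scale_rf (a l) (T ^ l)) \<noteq> 0"
    using v0.distinct_values[of ?C ?k] by auto
  moreover have "v P0 (\<Sum>l\<in>- S. scale_rf (a l) (T ^ l)) \<in> int ` S"
    if "(\<Sum>l\<in>- S. scale_rf (a l) (T ^ l)) \<noteq> 0"
    using assms(1) that values_local_ring_P0 by blast
  ultimately show ?thesis using assms(2) by (auto simp: v0_T_power)
qed

text \<open>If an adele concentrated at \<open>P0\<close>, with regular component there, is the sum
  of a local adele and a function \<open>f\<close>, then \<open>f\<close> is regular everywhere,
  hence constant, and the component at \<open>P0\<close> lies in the stalk. There
  \<open>gap_combination_mem\<close> applies.\<close>

lemma gap_adeles_indep: "ad.indep_mod (LA OX \<union> W) gap_adeles" and card_gap_adeles: "card gap_adeles = card (- S)"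
proof -
  have inj': "inj_on (\<lambda>l. T ^ l) (- S)" by (rule inj_onI) (metis v0_T_power(1) of_nat_eq_iff)
  have inj: "inj_on (\<lambda>l. point_adele P0 (T ^ l)) (- S)"
    by (rule inj_onI) (metis inj' inj_onD point_adele_simps(1))
  have ga: "gap_adeles = (\<lambda>l. point_adele P0 (T ^ l)) ` (- S)" by (simp add: gap_adeles_def image_image)
  have fin: "finite gap_adeles" using finite_gaps by (simp add: ga)
  show "card gap_adeles = card (- S)" unfolding ga using inj by (rule card_image)
  have key: "\<forall>l\<in>- S. a l = 0"
    if "point_adele P0 (\<Sum>l\<in>- S. scale_rf (a l) (T ^ l)) \<in> ad.span (LA OX \<union> W)" for a
  proof -
    let ?z = "\<Sum>l\<in>- S. scale_rf (a l) (T ^ l)"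
    have zK: "?z \<in> K" by auto
    have zr: "at_least (v P0) 0 ?z"
      by (intro v0.at_least_sum v0.at_least_scale) (auto simp: at_least_def v0_T_power)
    have "ad.span (LA OX) = LA OX" "ad.span W = W"
      using subspace_local_adeles[OF subspace_local_ring] subspace_principal by simp_all
    with that obtain \<beta> w where bw: "point_adele P0 ?z = \<beta> + w" "\<beta> \<in> LA OX" "w \<in> W"
      unfolding ad.span_Un by auto
    then obtain f where f: "w = (\<lambda>_. f)" "f \<in> K" by (auto simp: principal_adeles_def function_field)
    have comp: "point_adele P0 ?z P = \<beta> P + f" for P using bw f by (simp add: fun_eq_iff)
    have "at_least (v P) 0 f" if P: "P \<in> points X" for P
    proof -
      interpret vP: rf_valuation K "v P" using valuation P .
      have "\<beta> P \<in> OX P" using bw(2) P by (simp add: local_adeles_def)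
      then have "\<beta> P \<in> K" "at_least (v P) 0 (\<beta> P)" using local_ring_subset[OF P] by auto
      moreover have "f = point_adele P0 ?z P - \<beta> P" using comp[of P] by simp
      moreover have "at_least (v P) 0 (point_adele P0 ?z P)" "point_adele P0 ?z P \<in> K"
        using zr zK by (auto simp: point_adele_def)
      ultimately show ?thesis using vP.at_least_diff by simp
    qed
    then obtain b where b: "f = const_rf b" using regular_const[OF f(2)] by blast
    have "f \<in> OX P0"
      unfolding b using rf.subspace_scale[OF subspace_local_ring[OF P0] one_mem_local_ring[OF P0], of b]
      by (simp add: scale_rf_def)
    moreover have "\<beta> P0 \<in> OX P0" using bw(2) P0 by (simp add: local_adeles_def)
    ultimately have "?z \<in> OX P0"
      using comp[of P0] rf.subspace_add[OF subspace_local_ring[OF P0]] by simp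
    then show ?thesis using gap_combination_mem by blast
  qed
  interpret pa: Vector_Spaces.linear scale_rf scale_ad "point_adele P0" by (rule linear_point_adele)
  have sum_eq: "(\<Sum>x\<in>gap_adeles. scale_ad (k x) x) =
      point_adele P0 (\<Sum>l\<in>- S. scale_rf (k (point_adele P0 (T ^ l))) (T ^ l))" for k
    unfolding ga by (subst sum.reindex[OF inj]) (simp add: pa.sum pa.scale)
  have "ad.independent gap_adeles"
  proof (rule ad.independent_if_scalars_zero[OF fin])
    fix k x assume "(\<Sum>x\<in>gap_adeles. scale_ad (k x) x) = 0" "x \<in> gap_adeles"
    then have "point_adele P0 (\<Sum>l\<in>- S. scale_rf (k (point_adele P0 (T ^ l))) (T ^ l)) \<in> ad.span (LA OX \<union> W)"
      by (simp only: sum_eq ad.span_zero)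
    from key[OF this] \<open>x \<in> gap_adeles\<close> show "k x = 0" unfolding ga by blast
  qed
  moreover have "x = 0" if x: "x \<in> ad.span gap_adeles" "x \<in> ad.span (LA OX \<union> W)" for x
  proof -
    obtain k where k: "x = (\<Sum>x\<in>gap_adeles. scale_ad (k x) x)"
      using x(1) by (auto simp: ad.span_finite[OF fin])
    have "\<forall>l\<in>- S. k (point_adele P0 (T ^ l)) = 0" using key x(2) by (simp add: k sum_eq)
    then show "x = 0" unfolding k ga by (intro sum.neutral) auto
  qed
  ultimately show "ad.indep_mod (LA OX \<union> W) gap_adeles" by (auto simp: ad.indep_mod_def)
qed

lemma gap_adeles_subset: "gap_adeles \<subseteq> A" and finite_gap_adeles: "finite gap_adeles"
proof -
  have "finite {P \<in> points X. point_adele P0 x P \<notin> OX P}" for x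
    by (rule finite_subset[of _ "{P0}"])
      (auto simp: point_adele_def rf.subspace_0[OF subspace_local_ring])
  then show "gap_adeles \<subseteq> A" 
    by (auto simp: gap_adeles_def adeles_def function_field point_adele_def)
  show "finite gap_adeles" using finite_gaps by (simp add: gap_adeles_def)
qed

theorem arith_genus_eq: "arith_genus X = card (- S)"
  unfolding arith_genus_def h1_eq_codim
  using ad.codim_in_eq[OF gap_adeles_indep gap_adeles_subset adeles_span finite_gap_adeles]
  by (simp add: card_gap_adeles)

end

section \<open>Gonality\<close>

context unibranch_curve
begin

interpretation v0: rf_valuation K "v P0"
  using valuation P0 .

section \<open>Invariance of cohomology under multiplication by a function\<close>

lemma mult_adeles: "\<alpha> \<in> A \<Longrightarrow> y \<in> K \<Longrightarrow> (\<lambda>P. y * \<alpha> P) \<in> A"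
proof -
  assume \<alpha>: "\<alpha> \<in> A" and y: "y \<in> K"
  have "(\<lambda>_. y) \<in> A" using y principal_subset by (auto simp: principal_adeles_def function_field)
  then have "finite ({P \<in> points X. \<alpha> P \<notin> OX P} \<union> {P \<in> points X. y \<notin> OX P})"
    using \<alpha> by (simp add: adeles_def)
  moreover have "{P \<in> points X. y * \<alpha> P \<notin> OX P} \<subseteq> {P \<in> points X. \<alpha> P \<notin> OX P} \<union> {P \<in> points X. y \<notin> OX P}"
    using mult_local_ring by auto
  ultimately have "finite {P \<in> points X. y * \<alpha> P \<notin> OX P}" by (rule finite_subset[rotated])
  then show ?thesis using \<alpha> y by (auto simp: adeles_def function_field)
qed

lemma mult_principal: "\<alpha> \<in> W \<Longrightarrow> y \<in> K \<Longrightarrow> (\<lambda>P. y * \<alpha> P) \<in> W"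
  by (auto simp: principal_adeles_def function_field)

text \<open>Multiplication by \<open>y\<close> is an isomorphism onto another subsheaf of the
  function field. It serves to arrange that a sheaf contains the structure sheaf, where the degree
  is the dimension of a quotient.\<close>

lemma tf_sheaf_scale:
  assumes F: "tf_sheaf X F" and y: "y \<in> K" "y \<noteq> 0"
  shows "tf_sheaf X (\<lambda>P. (*) y ` F P)"
  unfolding tf_sheaf_def
proof (intro conjI ballI)
  fix P assume P: "P \<in> points X"
  have "F P \<noteq> {0}" using F P by (simp add: tf_sheaf_def)
  moreover have "0 \<in> F P" using rf.subspace_0[OF subspace_tf_sheaf[OF F P]] .
  ultimately obtain x where "x \<in> F P" "x \<noteq> 0" by blast
  then show "(*) y ` F P \<noteq> {0}" using y(2) by (metis image_eqI mult_eq_0_iff singletonD)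
  obtain B where B: "finite B" "B \<subseteq> K" "F P = {\<Sum>b\<in>B. f b * b | f. \<forall>b\<in>B. f b \<in> OX P}"
    using F P unfolding tf_sheaf_def function_field by blast
  have inj: "inj_on ((*) y) B" using y(2) by (auto intro!: inj_onI)
  have sum_eq: "(\<Sum>b\<in>(*) y ` B. f b * b) = y * (\<Sum>b\<in>B. f (y * b) * b)" for f
    by (subst sum.reindex[OF inj]) (simp add: sum_distrib_left ac_simps)
  have "(*) y ` F P = {\<Sum>b\<in>(*) y ` B. f b * b | f. \<forall>b\<in>(*) y ` B. f b \<in> OX P}"
  proof (intro Set.set_eqI iffI)
    fix x assume "x \<in> (*) y ` F P"
    then obtain f where f: "x = y * (\<Sum>b\<in>B. f b * b)" "\<forall>b\<in>B. f b \<in> OX P" using B by auto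
    then show "x \<in> {\<Sum>b\<in>(*) y ` B. f b * b | f. \<forall>b\<in>(*) y ` B. f b \<in> OX P}"
      using y(2) by (intro CollectI exI[of _ "\<lambda>b. f (b / y)"]) (auto simp: sum_eq)
  next
    fix x assume "x \<in> {\<Sum>b\<in>(*) y ` B. f b * b | f. \<forall>b\<in>(*) y ` B. f b \<in> OX P}"
    then obtain f where f: "x = (\<Sum>b\<in>(*) y ` B. f b * b)" "\<forall>b\<in>(*) y ` B. f b \<in> OX P" by blast
    have "(\<Sum>b\<in>B. f (y * b) * b) \<in> F P"
      unfolding B(3) using f(2) by (intro CollectI exI[of _ "\<lambda>b. f (y * b)"]) auto
    then show "x \<in> (*) y ` F P" using f(1) sum_eq by auto
  qed
  moreover have "finite ((*) y ` B)" "(*) y ` B \<subseteq> K" using B y by auto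
  ultimately show "\<exists>B. finite B \<and> B \<subseteq> function_field X \<and>
      (*) y ` F P = {\<Sum>b\<in>B. f b * b | f. \<forall>b\<in>B. f b \<in> OX P}"
    unfolding function_field by blast
next
  \<comment> \<open>At almost all points both \<open>y\<close> and its inverse lie in the local
    ring, so that multiplication by \<open>y\<close> preserves the stalk.\<close>
  have "(\<lambda>_. y) \<in> A" "(\<lambda>_. inverse y) \<in> A"
    using y principal_subset by (auto simp: principal_adeles_def function_field)
  then have "finite ({P \<in> points X. F P \<noteq> OX P} \<union> {P \<in> points X. y \<notin> OX P} \<union> {P \<in> points X. inverse y \<notin> OX P})"
    using F by (simp add: adeles_def tf_sheaf_def)
  moreover have "(*) y ` F P = OX P" if "P \<in> points X" "F P = OX P" "y \<in> OX P" "inverse y \<in> OX P" for P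
  proof
    show "(*) y ` F P \<subseteq> OX P" using that mult_local_ring by auto
    show "OX P \<subseteq> (*) y ` F P"
    proof
      fix x assume "x \<in> OX P"
      then have "inverse y * x \<in> OX P" using that mult_local_ring by auto
      then show "x \<in> (*) y ` F P" using y that by (intro image_eqI[of _ _ "inverse y * x"]) auto
    qed
  qed
  then have "{P \<in> points X. (*) y ` F P \<noteq> OX P} \<subseteq>
      {P \<in> points X. F P \<noteq> OX P} \<union> {P \<in> points X. y \<notin> OX P} \<union> {P \<in> points X. inverse y \<notin> OX P}"
    by blast
  ultimately show "finite {P \<in> points X. (*) y ` F P \<noteq> OX P}" by (rule finite_subset[rotated])
qed

lemma H0_scale: "y \<in> K \<Longrightarrow> y \<noteq> 0 \<Longrightarrow> H0 X (\<lambda>P. (*) y ` F P) = (*) y ` H0 X F"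
proof (intro Set.set_eqI iffI)
  fix x assume y: "y \<in> K" "y \<noteq> 0" and x: "x \<in> H0 X (\<lambda>P. (*) y ` F P)"
  have "inverse y * x \<in> F P" if P: "P \<in> points X" for P
  proof -
    obtain z where "z \<in> F P" "x = y * z" using x P by (auto simp: H0_def)
    then show ?thesis using y by (simp flip: mult.assoc)
  qed
  then have "inverse y * x \<in> H0 X F" using x y by (auto simp: H0_def function_field)
  then show "x \<in> (*) y ` H0 X F" using y by (intro image_eqI[of _ _ "inverse y * x"]) auto
qed (auto simp: H0_def function_field)

lemma h0_scale:
  assumes "\<And>P. P \<in> points X \<Longrightarrow> rf.subspace (F P)" "y \<in> K" "y \<noteq> 0"
  shows "h0 X (\<lambda>P. (*) y ` F P) = h0 X F"
  unfolding h0_def H0_scale[OF assms(2,3)]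
  by (intro linear_dim_image linear_mult_rf h0_eq_dim(2) assms) (use assms(3) in \<open>simp_all add: inj_def\<close>)

lemma generators_scale:
  assumes y: "y \<in> K" "y \<noteq> 0"
    and B: "finite B" "B \<subseteq> A" "A \<subseteq> ad.span (B \<union> (LA F \<union> W))"
  shows "\<exists>B'. finite B' \<and> card B' = card B \<and> B' \<subseteq> A \<and>
    A \<subseteq> ad.span (B' \<union> (LA (\<lambda>P. (*) y ` F P) \<union> W))"
proof (intro exI conjI)
  let ?m = "\<lambda>y (\<alpha> :: 'p \<Rightarrow> 'k ratfun) P. y * \<alpha> P"
  have "inj_on (?m y) B" using y(2) by (auto intro!: inj_onI simp: fun_eq_iff)
  then show "card (?m y ` B) = card B" by (rule card_image)
  show "finite (?m y ` B)" using B by simp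
  show "?m y ` B \<subseteq> A" using B(2) mult_adeles y by auto
  show "A \<subseteq> ad.span (?m y ` B \<union> (LA (\<lambda>P. (*) y ` F P) \<union> W))"
  proof
    fix \<alpha> assume "\<alpha> \<in> A"
    then have "?m (inverse y) \<alpha> \<in> ad.span (B \<union> (LA F \<union> W))"
      using mult_adeles[of \<alpha> "inverse y"] B(3) y by auto
    then have "?m y (?m (inverse y) \<alpha>) \<in> ?m y ` ad.span (B \<union> (LA F \<union> W))" by (rule imageI)
    moreover have "?m y (?m (inverse y) \<alpha>) = \<alpha>" using y by (simp add: fun_eq_iff)
    ultimately have "\<alpha> \<in> ad.span (?m y ` (B \<union> (LA F \<union> W)))"
      by (simp only: linear_span_image[OF linear_mult_ad])
    moreover have "?m y ` LA F \<subseteq> LA (\<lambda>P. (*) y ` F P)" by (auto simp: local_adeles_def)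
    moreover have "?m y ` W \<subseteq> W" using mult_principal y by auto
    ultimately show "\<alpha> \<in> ad.span (?m y ` B \<union> (LA (\<lambda>P. (*) y ` F P) \<union> W))"
      using ad.span_mono[of "?m y ` (B \<union> (LA F \<union> W))" "?m y ` B \<union> (LA (\<lambda>P. (*) y ` F P) \<union> W)"]
      by blast
  qed
qed

lemma h1_scale:
  assumes y: "y \<in> K" "y \<noteq> 0"
  shows "h1 X (\<lambda>P. (*) y ` F P) = h1 X F"
proof -
  have "(\<lambda>P. (*) (inverse y) ` (*) y ` F P) = F"
    using y by (simp add: image_image fun_eq_iff flip: mult.assoc)
  then have "(\<exists>B. finite B \<and> card B = d \<and> B \<subseteq> A \<and> A \<subseteq> ad.span (B \<union> (LA (\<lambda>P. (*) y ` F P) \<union> W)))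
    \<longleftrightarrow> (\<exists>B. finite B \<and> card B = d \<and> B \<subseteq> A \<and> A \<subseteq> ad.span (B \<union> (LA F \<union> W)))" for d
    using generators_scale[OF y, of _ F] 
      generators_scale[of "inverse y" _ "\<lambda>P. (*) y ` F P"] y
    by (metis inverse_mem inverse_nonzero_iff_nonzero)
  then show ?thesis by (simp add: h1_eq_codim ad.codim_in_def)
qed

lemma sheaf_degree_scale:
  assumes F: "tf_sheaf X F" and y: "y \<in> K" "y \<noteq> 0"
  shows "sheaf_degree X (\<lambda>P. (*) y ` F P) = sheaf_degree X F"
  using h0_scale[of F y] h1_scale[of y F] subspace_tf_sheaf[OF F] y
  by (simp add: sheaf_degree_def euler_char_def)

text \<open>Finitely many generators bound the valuation from below by \<open>N\<close>, and
  everything of valuation at least \<open>c\<close> lies in the local ring; finitely many powers of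
  a uniformizer bridge the two.\<close>

lemma tf_stalk_quotient:
  assumes F: "tf_sheaf X F" and P: "P \<in> points X"
  shows "\<exists>D. finite D \<and> F P \<subseteq> rf.span (D \<union> OX P)"
proof -
  interpret vP: rf_valuation K "v P" using valuation P .
  obtain B where B: "finite B" "B \<subseteq> K" "F P = {\<Sum>b\<in>B. f b * b | f. \<forall>b\<in>B. f b \<in> OX P}"
    using F P unfolding tf_sheaf_def function_field by blast
  obtain u where u: "u \<in> K" "u \<noteq> 0" "v P u = 1" using uniformizer[OF P] by blast
  \<comment> \<open>The inserted 0 keeps the set nonempty.\<close>
  define N where "N = Min (insert 0 (v P ` B))"
  have N: "at_least (v P) N b" if "b \<in> B" for b
    using that B(1) by (auto simp: at_least_def N_def intro!: Min_le)
  define D where "D = (\<lambda>m. u powi m) ` {N..<int c}"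
  have "F P \<subseteq> rf.span (D \<union> OX P)"
  proof
    fix x assume "x \<in> F P"
    then obtain f where f: "x = (\<Sum>b\<in>B. f b * b)" "\<forall>b\<in>B. f b \<in> OX P" using B by auto
    have fK: "f b \<in> K" "at_least (v P) 0 (f b)" if "b \<in> B" for b
      using f that local_ring_subset[OF P] by auto
    have "at_least (v P) (0 + N) (f b * b)" if "b \<in> B" for b
      using fK[OF that] N[OF that] B(2) that by (intro vP.at_least_mult) auto
    then have x: "x \<in> K" "at_least (v P) N x"
      using fK B(2) unfolding f(1) by (auto intro!: vP.at_least_sum sum_mem)
    obtain a where a: "at_least (v P) (int c) (x - (\<Sum>m\<in>{N..<int c}. scale_rf (a m) (u powi m)))"
      using vP.expansion[OF u x] by blast
    let ?z = "\<Sum>m\<in>{N..<int c}. scale_rf (a m) (u powi m)"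
    have "?z \<in> K" using u by auto
    then have "x - ?z \<in> OX P" using x a by (intro conductor_subset P) auto
    moreover have "?z \<in> rf.span D"
      unfolding D_def by (auto intro!: rf.span_sum rf.span_scale[OF rf.span_base])
    ultimately have "?z + (x - ?z) \<in> rf.span (D \<union> OX P)"
      using rf.span_mono[of D "D \<union> OX P"] by (intro rf.span_add) (auto intro: rf.span_base)
    then show "x \<in> rf.span (D \<union> OX P)" by simp
  qed
  moreover have "finite D" by (simp add: D_def)
  ultimately show ?thesis by blast
qed

lemma point_adele_span:
  assumes "x \<in> rf.span (D \<union> OX P)"
  shows "point_adele P x \<in> ad.span (point_adele P ` D \<union> LA OX)"
proof -
  have "point_adele P x \<in> ad.span (point_adele P ` (D \<union> OX P))"
    using assms unfolding linear_span_image[OF linear_point_adele] by blast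
  moreover have "point_adele P ` (D \<union> OX P) \<subseteq> point_adele P ` D \<union> LA OX"
    using point_adele_mem[of OX] subspace_local_ring by blast
  ultimately show ?thesis using ad.span_mono by blast
qed

lemma tf_quotient:
  assumes F: "tf_sheaf X F"
  shows "\<exists>D. finite D \<and> LA F \<subseteq> ad.span (D \<union> LA OX)"
proof -
  define Z where "Z = {P \<in> points X. F P \<noteq> OX P}"
  have Z: "finite Z" using F by (simp add: tf_sheaf_def Z_def)
  obtain D where D: "\<And>P. P \<in> points X \<Longrightarrow> finite (D P) \<and> F P \<subseteq> rf.span (D P \<union> OX P)"
    using tf_stalk_quotient[OF F] by metis
  define E where "E = (\<Union>P\<in>Z. point_adele P ` D P)"
  have "LA F \<subseteq> ad.span (E \<union> LA OX)"
  proof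
    fix \<alpha> assume \<alpha>: "\<alpha> \<in> LA F"
    define \<beta> where "\<beta> = (\<lambda>P. if P \<in> Z then 0 else \<alpha> P)"
    have "\<beta> P + (\<Sum>Q\<in>Z. point_adele Q (\<alpha> Q)) P = \<alpha> P" for P
    proof -
      have "(\<Sum>Q\<in>Z. point_adele Q (\<alpha> Q)) P = (\<Sum>Q\<in>Z. point_adele Q (\<alpha> Q) P)"
        by (induction Z rule: infinite_finite_induct) auto
      also have "\<dots> = (\<Sum>Q\<in>Z. if P = Q then \<alpha> Q else 0)"
        by (simp add: point_adele_def)
      finally show ?thesis using Z by (simp add: \<beta>_def)
    qed
    then have eq: "\<alpha> = \<beta> + (\<Sum>Q\<in>Z. point_adele Q (\<alpha> Q))" by (simp add: fun_eq_iff)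
    have "\<beta> \<in> LA OX"
      using \<alpha> rf.subspace_0[OF subspace_local_ring] by (auto simp: \<beta>_def local_adeles_def Z_def)
    moreover have "point_adele Q (\<alpha> Q) \<in> ad.span (E \<union> LA OX)" if Q: "Q \<in> Z" for Q
    proof -
      have "\<alpha> Q \<in> rf.span (D Q \<union> OX Q)" using \<alpha> Q D by (auto simp: Z_def local_adeles_def)
      then have "point_adele Q (\<alpha> Q) \<in> ad.span (point_adele Q ` D Q \<union> LA OX)"
        by (rule point_adele_span)
      moreover have "point_adele Q ` D Q \<union> LA OX \<subseteq> E \<union> LA OX" using Q by (auto simp: E_def)
      ultimately show ?thesis using ad.span_mono by blast
    qed
    ultimately show "\<alpha> \<in> ad.span (E \<union> LA OX)"
      by (subst eq) (intro ad.span_add ad.span_sum, auto intro: ad.span_base)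
  qed
  moreover have "finite E" using Z D by (auto simp: E_def Z_def)
  ultimately show ?thesis by blast
qed

text \<open>For a sheaf containing the structure sheaf the degree is the dimension of the quotient,
  with basis \<open>C\<close>. The finite set \<open>D\<close> records that the space of sections is
  finite dimensional; otherwise its \<open>dim\<close> would be 0.\<close>

lemma sheaf_degree_eq:
  assumes F: "tf_sheaf X F" and sub: "\<And>P. P \<in> points X \<Longrightarrow> OX P \<subseteq> F P"
  obtains C D where "C \<subseteq> LA F" "ad.indep_mod (LA OX) C" "finite C" "LA F \<subseteq> ad.span (C \<union> LA OX)"
    "sheaf_degree X F = int (card C)" "finite D" "LA F \<inter> W \<subseteq> ad.span D"
proof -
  obtain E where E: "finite E" "LA F \<subseteq> ad.span (E \<union> LA OX)" using tf_quotient[OF F] by blast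
  have s: "ad.subspace (LA OX)" "ad.subspace (LA F)"
    using subspace_local_adeles subspace_local_ring subspace_tf_sheaf[OF F] by blast+
  have "LA OX \<subseteq> LA F" using sub by (fastforce simp: local_adeles_def)
  from ad.euler_char_difference[OF s subspace_principal this local_adeles_subset[OF F]
      _ local_principal finite_gap_adeles adeles_span E]
  obtain C D where *: "C \<subseteq> LA F" "ad.indep_mod (LA OX) C" "finite C" "LA F \<subseteq> ad.span (C \<union> LA OX)"
    "int (ad.dim (LA F \<inter> W)) - int (ad.codim_in A (LA F \<union> W)) =
       int (ad.dim (LA OX \<inter> W)) - int (ad.codim_in A (LA OX \<union> W)) + int (card C)"
    "finite D" "LA F \<inter> W \<subseteq> ad.span D"
    by (metis finite.emptyI finite.insertI)
  have "h0 X F = ad.dim (LA F \<inter> W)" "h0 X OX = ad.dim (LA OX \<inter> W)"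
    using h0_eq_dim(1) subspace_local_ring subspace_tf_sheaf[OF F] by blast+
  then have "sheaf_degree X F = int (card C)"
    using *(5) by (simp add: sheaf_degree_def euler_char_def h1_eq_codim)
  then show ?thesis using that * by blast
qed

text \<open>The degree of the sheaf generated by \<open>1\<close> and \<open>T\<^sup>-\<^sup>\<delta>\<close>.\<close>

definition pencil_degree :: "nat \<Rightarrow> nat" where
  "pencil_degree \<delta> = card ((\<lambda>s. int s - int \<delta>) ` S - int ` S)"

lemma finite_pencil: "finite ((\<lambda>s. int s - int \<delta>) ` S - int ` S)"
proof (rule finite_subset)
  show "(\<lambda>s. int s - int \<delta>) ` S - int ` S \<subseteq> {- int \<delta>..int c}"
  proof
    fix i assume i: "i \<in> (\<lambda>s. int s - int \<delta>) ` S - int ` S"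
    then have "- int \<delta> \<le> i" by auto
    moreover have "i < int c"
    proof (rule ccontr)
      assume "\<not> i < int c"
      then have "nat i \<in> S" "i = int (nat i)" by (auto intro!: conductor_S)
      then show False using i by blast
    qed
    ultimately show "i \<in> {- int \<delta>..int c}" by simp
  qed
qed simp

text \<open>Dividing by the section of larger valuation puts 1 and a function \<open>x\<close> of
  valuation -\<delta> into the stalk at \<open>P0\<close>. Products of \<open>x\<close> with the
  powers T^s realise all of S - \<delta> as valuations. Only the component at \<open>P0\<close> is
  counted, which suffices for a lower bound.\<close>

lemma pencil_degree_le:
  assumes F: "tf_sheaf X F" and h: "h0 X F \<ge> 2"
  shows "\<exists>\<delta>>0. int (pencil_degree \<delta>) \<le> sheaf_degree X F"
proof -
  note subF = subspace_tf_sheaf[OF F]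
  have sH: "rf.subspace (H0 X F)" using h0_eq_dim(2) subF by blast
  obtain B where B: "B \<subseteq> H0 X F" "rf.independent B" "card B = rf.dim (H0 X F)"
    using rf.basis_exists[of "H0 X F"] by metis
  have "\<not> card B \<le> 1" using h B(3) by (simp add: h0_def)
  then obtain b1 b2 where b: "b1 \<in> B" "b2 \<in> B" "b1 \<noteq> b2"
    by (metis One_nat_def card.empty card.infinite card_le_Suc0_iff_eq le_SucI le_zero_eq nat_le_linear)
  have HK: "H0 X F \<subseteq> K" by (auto simp: H0_def function_field)
  have nz: "b1 \<noteq> 0" "b2 \<noteq> 0" using b B(2) rf.dependent_zero by blast+
  have bK: "b1 \<in> K" "b2 \<in> K" using b B HK by auto
  obtain w y where wy: "w \<in> H0 X F" "y \<in> H0 X F" "w \<noteq> 0" "y \<noteq> 0" "v P0 w < v P0 y"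
  proof -
    consider "v P0 b1 < v P0 b2" | "v P0 b2 < v P0 b1" | "v P0 b1 = v P0 b2" by linarith
    then show ?thesis
    proof cases
      \<comment> \<open>Two independent sections of equal valuation: a combination cancels the
        leading term and is not 0.\<close>
      case 3
      obtain a where a: "at_least (v P0) (v P0 b2 + 1) (b1 - scale_rf a b2)"
        using v0.residue_step[of b1 "v P0 b2" b2] bK nz 3 by (auto simp: at_least_def)
      have "b1 - scale_rf a b2 \<noteq> 0"
      proof
        assume "b1 - scale_rf a b2 = 0"
        then have "b1 = scale_rf a b2" by simp
        moreover have "b2 \<in> B - {b1}" using b by auto
        ultimately have "b1 \<in> rf.span (B - {b1})" by (metis rf.span_base rf.span_scale)
        then show False using B(2) b(1) by (auto simp: rf.dependent_def)
      qed
      moreover have "b1 - scale_rf a b2 \<in> H0 X F"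
        using b B sH by (intro rf.subspace_diff rf.subspace_scale) auto
      ultimately show ?thesis
        using a that[of b2 "b1 - scale_rf a b2"] b B nz by (auto simp: at_least_def)
    qed (use that b B nz in blast)+
  qed
  have wyK: "w \<in> K" "y \<in> K" using wy HK by auto
  define \<delta> where "\<delta> = nat (v P0 y - v P0 w)"
  define G where "G = (\<lambda>P. (*) (inverse y) ` F P)"
  have G: "tf_sheaf X G" and deg: "sheaf_degree X G = sheaf_degree X F"
    using tf_sheaf_scale[OF F, of "inverse y"] sheaf_degree_scale[OF F, of "inverse y"] wyK wy
    by (auto simp: G_def)
  note subG = subspace_tf_sheaf[OF G]
  have wyF: "w \<in> F P" "y \<in> F P" if "P \<in> points X" for P using wy that by (auto simp: H0_def)
  have G1: "1 \<in> G P" if "P \<in> points X" for P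
    using wyF[OF that] wy by (auto simp: G_def intro!: image_eqI[of _ _ y])
  define x where "x = inverse y * w"
  have x: "x \<in> K" "x \<noteq> 0" "v P0 x = - int \<delta>" "x \<in> G P0"
    using wyK wy wyF[OF P0] by (auto simp: x_def v0.v_mult v0.v_inverse \<delta>_def G_def)
  have "OX P \<subseteq> G P" if P: "P \<in> points X" for P
    using tf_sheaf_mult[OF G P _ G1[OF P]] by auto
  from sheaf_degree_eq[OF G this] obtain C where C: "finite C" "LA G \<subseteq> ad.span (C \<union> LA OX)"
    "sheaf_degree X G = int (card C)" by metis
  \<comment> \<open>The components of \<open>C\<close> at \<open>P0\<close> generate the stalk
    modulo the local ring, and there are at most \<open>card C\<close> of them.\<close>
  have "G P0 \<subseteq> rf.span ((\<lambda>\<alpha>. \<alpha> P0) ` C \<union> OX P0)"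
  proof
    fix z assume "z \<in> G P0"
    then have "point_adele P0 z \<in> LA G" using point_adele_mem subG by blast
    then have "point_adele P0 z P0 \<in> (\<lambda>\<alpha>. \<alpha> P0) ` ad.span (C \<union> LA OX)" using C(2) by blast
    then have "z \<in> rf.span ((\<lambda>\<alpha>. \<alpha> P0) ` (C \<union> LA OX))"
      unfolding linear_span_image[OF linear_component] by simp
    moreover have "(\<lambda>\<alpha>. \<alpha> P0) ` LA OX \<subseteq> OX P0" using P0 by (auto simp: local_adeles_def)
    then have "(\<lambda>\<alpha>. \<alpha> P0) ` (C \<union> LA OX) \<subseteq> (\<lambda>\<alpha>. \<alpha> P0) ` C \<union> OX P0" by blast
    ultimately show "z \<in> rf.span ((\<lambda>\<alpha>. \<alpha> P0) ` C \<union> OX P0)" using rf.span_mono by blast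
  qed
  from v0.card_values_le[OF subspace_local_ring[OF P0] tf_sheaf_subset[OF G P0] _ this]
  have *: "finite (v P0 ` (G P0 - {0}) - int ` S)"
    "card (v P0 ` (G P0 - {0}) - int ` S) \<le> card ((\<lambda>\<alpha>. \<alpha> P0) ` C)"
    using C(1) by (simp_all add: values_local_ring_P0)
  have "(\<lambda>s. int s - int \<delta>) ` S \<subseteq> v P0 ` (G P0 - {0})"
  proof clarify
    fix s assume "s \<in> S"
    then have "T ^ s * x \<in> G P0" using tf_sheaf_mult[OF G P0] T_power_mem x by blast
    moreover have "T ^ s * x \<noteq> 0" using T_nz x by simp
    moreover have "v P0 (T ^ s * x) = int s - int \<delta>"
      using x T_nz by (simp add: v0.v_mult v0_T_power)
    ultimately show "int s - int \<delta> \<in> v P0 ` (G P0 - {0})" by (metis DiffI image_eqI singletonD)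
  qed
  then have "pencil_degree \<delta> \<le> card (v P0 ` (G P0 - {0}) - int ` S)"
    unfolding pencil_degree_def using *(1) by (intro card_mono) auto
  also have "\<dots> \<le> card C" using *(2) card_image_le[OF C(1)] le_trans by blast
  finally have "int (pencil_degree \<delta>) \<le> sheaf_degree X F" using C(3) deg by simp
  moreover have "\<delta> > 0" using wy by (simp add: \<delta>_def)
  ultimately show ?thesis by blast
qed

lemma v_T_power_Pinf: "v Pinf (T powi i) = - i"
proof -
  interpret vi: rf_valuation K "v Pinf" using valuation Pinf .
  show ?thesis using vi.v_power_int[OF T_mem T_nz] v_T_Pinf by simp
qed

lemma v_T_power_other: "P \<in> points X \<Longrightarrow> P \<noteq> P0 \<Longrightarrow> P \<noteq> Pinf \<Longrightarrow> v P (T powi i) = 0"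
proof -
  assume P: "P \<in> points X" "P \<noteq> P0" "P \<noteq> Pinf"
  then interpret vP: rf_valuation K "v P" by (intro valuation)
  show ?thesis using vP.v_power_int[OF T_mem T_nz] v_T_other P by simp
qed

lemma negative_power_regular:
  "P \<in> points X \<Longrightarrow> P \<noteq> P0 \<Longrightarrow> i \<le> 0 \<Longrightarrow> at_least (v P) 0 (T powi i)"
  by (cases "P = Pinf") (simp_all add: at_least_def v_T_power_Pinf v_T_power_other)

text \<open>T^-\<delta> is regular away from \<open>P0\<close>, so the sheaf generated by 1 and
  T^-\<delta> agrees there with the structure sheaf.\<close>

definition pencil :: "nat \<Rightarrow> 'p \<Rightarrow> 'k ratfun set" where
  "pencil \<delta> P = (if P = P0 then {x + z * T powi (- int \<delta>) | x z. x \<in> OX P0 \<and> z \<in> OX P0} else OX P)"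

lemma pencil_I: "x \<in> OX P0 \<Longrightarrow> z \<in> OX P0 \<Longrightarrow> x + z * T powi (- int \<delta>) \<in> pencil \<delta> P0"
  by (auto simp: pencil_def)

lemma tf_pencil: "tf_sheaf X (pencil \<delta>)"
  unfolding tf_sheaf_def
proof (rule conjI, rule ballI)
  fix P assume P: "P \<in> points X"
  show "pencil \<delta> P \<noteq> {0} \<and> (\<exists>B. finite B \<and> B \<subseteq> function_field X \<and>
      pencil \<delta> P = {\<Sum>b\<in>B. f b * b | f. \<forall>b\<in>B. f b \<in> OX P})"
  \<comment> \<open>For \<delta> = 0 the generators 1 and T^0 coincide, and the sum over the set of
    generators would have one term only.\<close>
  proof (cases "P = P0 \<and> \<delta> > 0")
    case False
    have "pencil \<delta> P = OX P"
    proof (cases "P = P0")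
      case True
      then have "\<delta> = 0" using False by simp
      then show ?thesis using True rf.subspace_add[OF subspace_local_ring[OF P0]] rf.subspace_0[OF subspace_local_ring[OF P0]]
        by (auto simp: pencil_def) (metis add.right_neutral)
    qed (simp add: pencil_def)
    then show ?thesis using tf_local_ring P unfolding tf_sheaf_def by presburger
  next
    case True
    have "v P0 (T powi (- int \<delta>)) \<noteq> v P0 1" using True by (simp add: v0_T_power)
    then have ne: "T powi (- int \<delta>) \<noteq> 1" by metis
    have "pencil \<delta> P = {\<Sum>b\<in>{1, T powi (- int \<delta>)}. f b * b | f. \<forall>b\<in>{1, T powi (- int \<delta>)}. f b \<in> OX P}"
    proof (intro Set.set_eqI iffI)
      fix y assume "y \<in> pencil \<delta> P"
      then obtain x z where "y = x + z * T powi (- int \<delta>)" "x \<in> OX P" "z \<in> OX P"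
        using True by (auto simp: pencil_def)
      then show "y \<in> {\<Sum>b\<in>{1, T powi (- int \<delta>)}. f b * b | f. \<forall>b\<in>{1, T powi (- int \<delta>)}. f b \<in> OX P}"
        using ne by (intro CollectI exI[of _ "\<lambda>b. if b = 1 then x else z"]) auto
    next
      fix y assume "y \<in> {\<Sum>b\<in>{1, T powi (- int \<delta>)}. f b * b | f. \<forall>b\<in>{1, T powi (- int \<delta>)}. f b \<in> OX P}"
      then obtain f where "y = f 1 * 1 + f (T powi (- int \<delta>)) * T powi (- int \<delta>)"
        "f 1 \<in> OX P" "f (T powi (- int \<delta>)) \<in> OX P"
        using ne by auto
      then show "y \<in> pencil \<delta> P" using True by (auto simp: pencil_def)
    qed
    moreover have "1 \<in> pencil \<delta> P"
      using one_mem_local_ring[OF P0] rf.subspace_0[OF subspace_local_ring[OF P0]] True pencil_I[of 1 0 \<delta>]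
      by simp
    then have "pencil \<delta> P \<noteq> {0}" by auto
    moreover have "finite {1, T powi (- int \<delta>)}" "{1, T powi (- int \<delta>)} \<subseteq> function_field X"
      by (simp_all add: function_field)
    ultimately show ?thesis by blast
  qed
next
  show "finite {P \<in> points X. pencil \<delta> P \<noteq> OX P}"
    by (rule finite_subset[of _ "{P0}"]) (auto simp: pencil_def)
qed

lemma local_ring_subset_pencil: "P \<in> points X \<Longrightarrow> OX P \<subseteq> pencil \<delta> P"
proof
  fix x assume "P \<in> points X" "x \<in> OX P"
  then show "x \<in> pencil \<delta> P"
    using rf.subspace_0[OF subspace_local_ring[OF P0]] pencil_I[of x 0 \<delta>]
    by (cases "P = P0") (simp_all add: pencil_def)
qed

text \<open>Multiplying combinations of T^s, s in \<open>S\<close>, by T^-\<delta> gives the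
  exponents s - \<delta>, and those in \<open>S\<close> vanish modulo the local ring. What remains
  has valuation at least c - \<delta> and is expanded up to order \<open>c\<close>.\<close>

lemma pencil_span:
  "pencil \<delta> P0 \<subseteq> rf.span ((\<lambda>j. T powi j) ` ((\<lambda>s. int s - int \<delta>) ` S - int ` S) \<union> OX P0)"
    (is "_ \<subseteq> ?Q")
proof
  have power: "T powi j \<in> ?Q" if "j \<in> (\<lambda>s. int s - int \<delta>) ` S" for j
  proof (cases "j \<in> int ` S")
    case True
    then have "T powi j \<in> OX P0" using T_power_mem by auto
    then show ?thesis by (intro rf.span_base) auto
  next
    case False
    then show ?thesis using that by (intro rf.span_base) auto
  qed
  fix x assume "x \<in> pencil \<delta> P0"
  then obtain y z where yz: "x = y + z * T powi (- int \<delta>)" "y \<in> OX P0" "z \<in> OX P0"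
    by (auto simp: pencil_def)
  obtain z' where z': "z \<in> K" "z' \<in> rf.span ((\<lambda>s. T ^ s) ` S)" "at_least (v P0) (int c) (z - z')"
    using yz(3) local_ring_P0 by auto
  have 1: "z' * T powi (- int \<delta>) \<in> ?Q" using z'(2)
  proof (induction rule: rf.span_induct_alt)
    case (step a t t')
    then obtain s where s: "s \<in> S" "t = T ^ s" by auto
    have "t * T powi (- int \<delta>) = T powi (int s - int \<delta>)"
      using T_nz by (simp add: s power_int_diff power_int_minus divide_inverse)
    then have "t * T powi (- int \<delta>) \<in> ?Q" using power s by auto
    then have "scale_rf a (t * T powi (- int \<delta>)) + t' * T powi (- int \<delta>) \<in> ?Q"
      using step(2) by (intro rf.span_add rf.span_scale)
    then show ?case by (simp add: distrib_right scale_rf_mult_right)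
  qed (simp add: rf.span_zero)
  let ?r = "(z - z') * T powi (- int \<delta>)"
  have rK: "?r \<in> K" using z' span_T_subset by auto
  have "at_least (v P0) (int c + - int \<delta>) ?r"
    using z' span_T_subset by (intro v0.at_least_mult) (auto simp: at_least_def v0_T_power)
  then obtain a where a: "at_least (v P0) (int c) (?r - (\<Sum>m\<in>{int c + - int \<delta>..<int c}. scale_rf (a m) (T powi m)))"
    using v0.expansion[OF T_mem T_nz v_T_P0 rK] by blast
  let ?s = "\<Sum>m\<in>{int c + - int \<delta>..<int c}. scale_rf (a m) (T powi m)"
  have "?s \<in> K" by auto
  then have 2: "?r - ?s \<in> ?Q" using a rK by (intro rf.span_base) (auto intro!: conductor_subset P0)
  \<comment> \<open>An exponent m \<ge> c - \<delta> satisfies m + \<delta> \<ge> c, so it lies in S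
    - \<delta> as well.\<close>
  have 3: "?s \<in> ?Q"
  proof (intro rf.span_sum rf.span_scale power)
    fix m assume m: "m \<in> {int c + - int \<delta>..<int c}"
    then have "nat (m + int \<delta>) \<in> S" "m = int (nat (m + int \<delta>)) - int \<delta>"
      by (auto intro!: conductor_S)
    then show "m \<in> (\<lambda>s. int s - int \<delta>) ` S" by blast
  qed
  have "y \<in> ?Q" using yz by (intro rf.span_base) auto
  then have "y + (z' * T powi (- int \<delta>) + ((?r - ?s) + ?s)) \<in> ?Q"
    by (intro rf.span_add 1 2 3)
  also have "y + (z' * T powi (- int \<delta>) + ((?r - ?s) + ?s)) = x"
    unfolding yz(1) by (simp only: diff_add_cancel) (simp add: left_diff_distrib)
  finally show "x \<in> ?Q" .
qed

text \<open>The degree is bounded from above only; for the minimising \<delta>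
  \<open>pencil_degree_le\<close> gives equality. For \<open>h0\<close> two independent sections are
  not enough: the space must also be finite dimensional, as the dimension of an infinite one is 0 by
  convention.\<close>

lemma pencil_degree_attained:
  assumes "\<delta> > 0"
  shows "sheaf_degree X (pencil \<delta>) \<le> int (pencil_degree \<delta>)" "h0 X (pencil \<delta>) \<ge> 2"
proof -
  note tf = tf_pencil[of \<delta>]
  obtain C D where C: "C \<subseteq> LA (pencil \<delta>)" "ad.indep_mod (LA OX) C" "finite C"
    "sheaf_degree X (pencil \<delta>) = int (card C)" "finite D" "LA (pencil \<delta>) \<inter> W \<subseteq> ad.span D"
    using sheaf_degree_eq[OF tf local_ring_subset_pencil] by metis
  define E where "E = point_adele P0 ` (\<lambda>j. T powi j) ` ((\<lambda>s. int s - int \<delta>) ` S - int ` S)"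
  have E: "finite E" "card E \<le> pencil_degree \<delta>"
    using finite_pencil[of \<delta>] card_image_le le_trans unfolding E_def pencil_degree_def
    by (blast, metis card_image_le finite_imageI le_trans)
  have "LA (pencil \<delta>) \<subseteq> ad.span (E \<union> LA OX)"
  proof
    fix \<alpha> assume \<alpha>: "\<alpha> \<in> LA (pencil \<delta>)"
    then have "\<alpha> P0 \<in> pencil \<delta> P0" using P0 by (auto simp: local_adeles_def)
    then have 1: "point_adele P0 (\<alpha> P0) \<in> ad.span (E \<union> LA OX)"
      unfolding E_def using pencil_span by (intro point_adele_span) blast
    have 2: "\<alpha> - point_adele P0 (\<alpha> P0) \<in> LA OX"
      using \<alpha> rf.subspace_0[OF subspace_local_ring]
      by (auto simp: local_adeles_def point_adele_def pencil_def)
    have "point_adele P0 (\<alpha> P0) + (\<alpha> - point_adele P0 (\<alpha> P0)) \<in> ad.span (E \<union> LA OX)"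
      using 1 2 by (intro ad.span_add) (auto intro: ad.span_base)
    then show "\<alpha> \<in> ad.span (E \<union> LA OX)" by simp
  qed
  then have "card C \<le> card E" using ad.indep_mod_bound[OF C(2) E(1)] C(1) by blast
  then show "sheaf_degree X (pencil \<delta>) \<le> int (pencil_degree \<delta>)" using C(4) E(2) by simp
  note sub = subspace_tf_sheaf[OF tf]
  let ?t = "T powi (- int \<delta>)"
  have mem: "1 \<in> H0 X (pencil \<delta>)" "?t \<in> H0 X (pencil \<delta>)"
  proof -
    show "1 \<in> H0 X (pencil \<delta>)"
      using one_mem_local_ring local_ring_subset_pencil by (auto simp: H0_def function_field)
    have "?t \<in> pencil \<delta> P" if P: "P \<in> points X" for P
    proof (cases "P = P0")
      case True
      then show ?thesis
        using one_mem_local_ring[OF P0] rf.subspace_0[OF subspace_local_ring[OF P0]] pencil_I[of 0 1 \<delta>]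
        by simp
    next
      case False
      then have "?t \<in> OX P" using negative_power_regular[OF P False] P by (simp add: local_ring_smooth)
      then show ?thesis using local_ring_subset_pencil[OF P] by blast
    qed
    then show "?t \<in> H0 X (pencil \<delta>)" by (auto simp: H0_def function_field)
  qed
  have v: "v P0 ?t \<noteq> v P0 1" using assms by (simp add: v0_T_power)
  have ind: "rf.independent {1, ?t}"
  proof (rule rf.independent_if_scalars_zero)
    fix k x assume "(\<Sum>x\<in>{1, ?t}. scale_rf (k x) x) = 0" "x \<in> {1, ?t}"
    moreover have "inj_on (v P0) {1, ?t}" using v by (auto simp: inj_on_def)
    ultimately show "k x = 0"
      using v0.distinct_values[of "{1, ?t}" k] T_nz by auto
  qed simp
  obtain B where B: "B \<subseteq> H0 X (pencil \<delta>)" "rf.independent B" "H0 X (pencil \<delta>) \<subseteq> rf.span B"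
      "card B = rf.dim (H0 X (pencil \<delta>))"
    using rf.basis_exists[of "H0 X (pencil \<delta>)"] by metis
  interpret dg: Vector_Spaces.linear scale_rf scale_ad "\<lambda>x _. x" by (rule linear_diagonal)
  have inj: "inj_on (\<lambda>x _. x :: 'k ratfun) Y" for Y by (simp add: inj_on_def fun_eq_iff)
  have "ad.independent ((\<lambda>x _. x) ` B)"
    using dg.independent_injective_image[OF B(2) inj] .
  moreover have "(\<lambda>x _. x) ` B \<subseteq> ad.span D"
    using C(6) B(1) h0_eq_dim(3)[of "pencil \<delta>"] sub by blast
  ultimately have "finite ((\<lambda>x (_ :: 'p). x) ` B)"
    using ad.independent_span_bound[OF C(5)] by blast
  then have "finite B" using finite_imageD[OF _ inj] by blast
  then have "card {1, ?t} \<le> card B"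
    using rf.independent_span_bound[OF _ ind] mem B(3) by blast
  moreover have "1 \<noteq> ?t" using v by metis
  ultimately show "h0 X (pencil \<delta>) \<ge> 2" using B(4) by (simp add: h0_def)
qed

text \<open>The least degree is taken in the integers, which are not well ordered. Its existence
  comes from \<open>pencil_degree_le\<close>, whose bounds are natural numbers and attain a
  minimum.\<close>

theorem gonality_eq:
  obtains \<delta> where "\<delta> > 0" "gonality X = int (pencil_degree \<delta>)"
    "\<And>\<epsilon>. \<epsilon> > 0 \<Longrightarrow> pencil_degree \<delta> \<le> pencil_degree \<epsilon>"
proof -
  obtain \<delta> where \<delta>: "\<delta> > 0" "\<And>\<epsilon>. \<epsilon> > 0 \<Longrightarrow> pencil_degree \<delta> \<le> pencil_degree \<epsilon>"
    using that[of "arg_min pencil_degree (\<lambda>\<delta>. \<delta> > 0)"]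
      arg_min_natI[of "\<lambda>\<delta>. \<delta> > 0" 1 pencil_degree] arg_min_nat_le[of "\<lambda>\<delta>. \<delta> > 0" _ pencil_degree]
    by simp
  have ge: "int (pencil_degree \<delta>) \<le> sheaf_degree X F" if F: "tf_sheaf X F" "h0 X F \<ge> 2" for F
  proof -
    obtain \<epsilon> where "\<epsilon> > 0" "int (pencil_degree \<epsilon>) \<le> sheaf_degree X F"
      using pencil_degree_le[OF F] by blast
    then show ?thesis using \<delta>(2)[of \<epsilon>] by linarith
  qed
  have "gonality X = int (pencil_degree \<delta>)"
    unfolding gonality_def
  proof (rule Least_equality)
    show "\<exists>F. tf_sheaf X F \<and> sheaf_degree X F = int (pencil_degree \<delta>) \<and> h0 X F \<ge> 2"
      using pencil_degree_attained[OF \<delta>(1)] tf_pencil[of \<delta>] ge[of "pencil \<delta>"]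
      by (intro exI[of _ "pencil \<delta>"]) simp
  qed (use ge in blast)
  then show ?thesis using that \<delta> by blast
qed

end

section \<open>The dualizing sheaf\<close>

context unibranch_curve
begin

interpretation v0: rf_valuation K "v P0"
  using valuation P0 .

text \<open>The sheaf O(-i P0 - j Pinf) of the normalization, regarded on \<open>X\<close>. For i =
  j = 1 it is the canonical sheaf of the projective line, trivialised by dT/T; for i = c and j = 0
  it lies inside the structure sheaf of \<open>X\<close>.\<close>

definition twist :: "int \<Rightarrow> int \<Rightarrow> 'p \<Rightarrow> 'k ratfun set" where
  "twist i j P = {x \<in> K. at_least (v P) (if P = P0 then i else if P = Pinf then j else 0) x}"

lemma subspace_twist: "P \<in> points X \<Longrightarrow> rf.subspace (twist i j P)"
  unfolding twist_def by (intro rf_valuation.subspace_at_least valuation)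

lemma tf_twist: "tf_sheaf X (twist i j)"
  unfolding tf_sheaf_def
proof (intro conjI ballI)
  fix P assume P: "P \<in> points X"
  interpret vP: rf_valuation K "v P" using valuation P .
  define n where "n = (if P = P0 then i else if P = Pinf then j else 0)"
  have tw: "twist i j P = {x \<in> K. at_least (v P) n x}" by (simp add: twist_def n_def)
  obtain u where u: "u \<in> K" "u \<noteq> 0" "v P u = 1" using uniformizer[OF P] by blast
  have vu: "v P (u powi m) = m" for m using u by (simp add: vP.v_power_int)
  have "u powi n \<in> twist i j P" "u powi n \<noteq> 0" using u by (auto simp: tw at_least_def vu)
  then show "twist i j P \<noteq> {0}" by blast
  \<comment> \<open>One exponent more than the conductor requires keeps the interval nonempty for c
    = 0. The remainder of the expansion is absorbed into the coefficient of u^n.\<close>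
  let ?I = "{n..<n + int c + 1}"
  define B where "B = (\<lambda>m. u powi m) ` ?I"
  have inj: "inj_on (\<lambda>m. u powi m) ?I" by (rule inj_onI) (metis vu)
  have "twist i j P = {\<Sum>b\<in>B. f b * b | f. \<forall>b\<in>B. f b \<in> OX P}"
  proof (intro Set.set_eqI iffI)
    fix x assume "x \<in> twist i j P"
    then have x: "x \<in> K" "at_least (v P) n x" by (auto simp: tw)
    obtain a where a: "at_least (v P) (n + int c + 1) (x - (\<Sum>m\<in>?I. scale_rf (a m) (u powi m)))"
      using vP.expansion[OF u x] by blast
    define r where "r = x - (\<Sum>m\<in>?I. scale_rf (a m) (u powi m))"
    have rK: "r \<in> K" using x u by (auto simp: r_def)
    have "at_least (v P) ((n + int c + 1) + - n) (r * u powi (- n))"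
      using a rK u by (intro vP.at_least_mult) (auto simp: r_def at_least_def vu)
    then have r': "r * u powi (- n) \<in> OX P"
      using rK u by (intro conductor_subset P) (auto elim: vP.at_least_mono)
    have const: "const_rf y \<in> OX P" for y
      using rf.subspace_scale[OF subspace_local_ring one_mem_local_ring, OF P P, of y]
      by (simp add: scale_rf_def)
    let ?f = "\<lambda>b. const_rf (a (v P b)) + (if b = u powi n then r * u powi (- n) else 0)"
    have "(\<Sum>b\<in>B. ?f b * b) = (\<Sum>m\<in>?I. scale_rf (a m) (u powi m) +
        (if m = n then r else 0))"
      unfolding B_def
    proof (subst sum.reindex[OF inj], intro sum.cong refl)
      fix m assume "m \<in> ?I"
      have "u powi m = u powi n \<longleftrightarrow> m = n" by (metis vu)
      then show "((\<lambda>b. ?f b * b) \<circ> (\<lambda>m. u powi m)) m = scale_rf (a m) (u powi m) + (if m = n then r else 0)"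
        using u by (simp add: vu scale_rf_def distrib_right power_int_minus)
    qed
    also have "\<dots> = (\<Sum>m\<in>?I. scale_rf (a m) (u powi m)) + r"
      by (simp add: sum.distrib)
    also have "\<dots> = x" by (simp add: r_def)
    finally have "x = (\<Sum>b\<in>B. ?f b * b)" ..
    moreover have "\<forall>b\<in>B. ?f b \<in> OX P"
      using const r' rf.subspace_add[OF subspace_local_ring[OF P]] by auto
    ultimately show "x \<in> {\<Sum>b\<in>B. f b * b | f. \<forall>b\<in>B. f b \<in> OX P}"
      by (intro CollectI exI[of _ ?f] conjI)
  next
    fix x assume "x \<in> {\<Sum>b\<in>B. f b * b | f. \<forall>b\<in>B. f b \<in> OX P}"
    then obtain f where f: "x = (\<Sum>b\<in>B. f b * b)" "\<forall>b\<in>B. f b \<in> OX P" by blast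
    have fK: "f b \<in> K" "at_least (v P) 0 (f b)" if "b \<in> B" for b
      using f that local_ring_subset[OF P] by auto
    have B: "b \<in> K" "at_least (v P) n b" if "b \<in> B" for b
      using that u by (auto simp: B_def at_least_def vu)
    have "at_least (v P) (0 + n) (f b * b)" if "b \<in> B" for b
      using fK[OF that] B[OF that] by (intro vP.at_least_mult) auto
    then show "x \<in> twist i j P"
      unfolding tw f(1) using fK B by (auto intro!: vP.at_least_sum)
  qed
  moreover have "finite B" "B \<subseteq> K" using u by (auto simp: B_def)
  ultimately show "\<exists>B. finite B \<and> B \<subseteq> function_field X \<and>
      twist i j P = {\<Sum>b\<in>B. f b * b | f. \<forall>b\<in>B. f b \<in> OX P}"
    unfolding function_field by blast
next
  show "finite {P \<in> points X. twist i j P \<noteq> OX P}"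
    by (rule finite_subset[of _ "{P0, Pinf}"]) (auto simp: twist_def local_ring_smooth)
qed

section \<open>Functionals on the first cohomology\<close>

lemma H1_dualD:
  assumes "l \<in> H1_dual X F"
  shows "\<alpha> \<in> A \<Longrightarrow> \<beta> \<in> A \<Longrightarrow> l (\<alpha> + \<beta>) = l \<alpha> + l \<beta>"
    and "\<alpha> \<in> A \<Longrightarrow> l (scale_ad a \<alpha>) = a * l \<alpha>"
    and "\<alpha> \<in> LA F \<union> W \<Longrightarrow> l \<alpha> = 0"
  using assms unfolding H1_dual_def by blast+

lemma H1_dual_sum:
  assumes l: "l \<in> H1_dual X F" and I: "finite I" "\<And>i. i \<in> I \<Longrightarrow> \<alpha> i \<in> A"
  shows "l (\<Sum>i\<in>I. scale_ad (a i) (\<alpha> i)) = (\<Sum>i\<in>I. a i * l (\<alpha> i))"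
  using I
proof (induction I rule: finite_induct)
  case empty
  have "l (scale_ad 0 0) = 0 * l 0"
    using l ad.subspace_0[OF subspace_adeles] unfolding H1_dual_def by blast
  then show ?case by (simp only: sum.empty ad.scale_zero_left mult_zero_left)
next
  case (insert i I)
  have IH: "l (\<Sum>i\<in>I. scale_ad (a i) (\<alpha> i)) = (\<Sum>i\<in>I. a i * l (\<alpha> i))"
    using insert by auto
  have "(\<Sum>i\<in>I. scale_ad (a i) (\<alpha> i)) \<in> A"
    using insert by (intro ad.subspace_sum ad.subspace_scale subspace_adeles) auto
  moreover have "scale_ad (a i) (\<alpha> i) \<in> A"
    using insert by (intro ad.subspace_scale subspace_adeles) auto
  ultimately have "l (scale_ad (a i) (\<alpha> i) + (\<Sum>i\<in>I. scale_ad (a i) (\<alpha> i))) =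
      l (scale_ad (a i) (\<alpha> i)) + l (\<Sum>i\<in>I. scale_ad (a i) (\<alpha> i))"
    using l unfolding H1_dual_def by blast
  moreover have "l (scale_ad (a i) (\<alpha> i)) = a i * l (\<alpha> i)"
    using l insert.prems unfolding H1_dual_def by blast
  ultimately show ?case by (simp only: sum.insert[OF insert(1,2)] IH)
qed

lemma H1_dual_mult:
  assumes l: "l \<in> H1_dual X G" and h: "h \<in> sheaf_hom X F G"
  shows "(\<lambda>\<alpha>. l (\<lambda>P. h * \<alpha> P)) \<in> H1_dual X F"
proof -
  have hK: "h \<in> K" using h by (auto simp: sheaf_hom_def function_field)
  have eq: "(\<lambda>P. h * (\<alpha> + \<beta>) P) = (\<lambda>P. h * \<alpha> P) + (\<lambda>P. h * \<beta> P)"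
    "(\<lambda>P. h * scale_ad a \<alpha> P) = scale_ad a (\<lambda>P. h * \<alpha> P)" for a and \<alpha> \<beta> :: "'p \<Rightarrow> 'k ratfun"
    by (simp_all add: fun_eq_iff distrib_left scale_ad_def scale_rf_mult_left)
  have "(\<lambda>P. h * \<alpha> P) \<in> LA G \<union> W" if "\<alpha> \<in> LA F \<union> W" for \<alpha>
    using that h mult_principal[OF _ hK] by (auto simp: local_adeles_def sheaf_hom_def)
  then show ?thesis
    using l mult_adeles[OF _ hK] unfolding H1_dual_def eq mem_Collect_eq by blast
qed

text \<open>T^j dT/T has residue 0 at \<open>P0\<close> for j \<noteq> 0. For j < 0 the diagonal
  function T^j differs from the given adele by one that is 0 at \<open>P0\<close> and vanishes at
  \<open>Pinf\<close>, where T^j has valuation -j > 0.\<close>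

lemma T_adele_trivial:
  assumes "j \<noteq> 0"
  shows "point_adele P0 (T powi j) \<in> ad.span (LA (twist 1 1) \<union> W)"
proof (cases "j > 0")
  case True
  then have "point_adele P0 (T powi j) \<in> LA (twist 1 1)"
    by (intro point_adele_mem subspace_twist) (auto simp: twist_def at_least_def v0_T_power)
  then show ?thesis by (intro ad.span_base) auto
next
  case False
  define \<beta> where "\<beta> = (\<lambda>P. if P = P0 then 0 else T powi j)"
  have "\<beta> \<in> LA (twist 1 1)"
    using False assms
    by (auto simp: \<beta>_def local_adeles_def twist_def at_least_def v_T_power_Pinf v_T_power_other)
  moreover have "(\<lambda>_. T powi j) \<in> W" by (auto simp: principal_adeles_def function_field)
  ultimately have "(\<lambda>_. T powi j) - \<beta> \<in> ad.span (LA (twist 1 1) \<union> W)"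
    by (intro ad.span_diff ad.span_base) auto
  moreover have "(\<lambda>_. T powi j) - \<beta> = point_adele P0 (T powi j)"
    by (simp add: \<beta>_def point_adele_def fun_eq_iff)
  ultimately show ?thesis by simp
qed

text \<open>The residue of \<open>\<alpha> dT / T\<close>, characterised as a generator of the dual of the first cohomology of
  the canonical sheaf of the projective line.\<close>

lemma residue_functional:
  obtains m where "m \<in> H1_dual X (twist 1 1)" "m (point_adele P0 1) = 1"
    "\<And>\<alpha>. \<alpha> \<in> ad.span (LA (twist 1 1) \<union> W) \<Longrightarrow> m \<alpha> = 0"
proof -
  let ?Q = "LA (twist 1 1) \<union> W"
  interpret vp: vector_space_pair "scale_ad :: 'k \<Rightarrow> ('p \<Rightarrow> 'k ratfun) \<Rightarrow> 'p \<Rightarrow> 'k ratfun" "(*) :: 'k \<Rightarrow> 'k \<Rightarrow> 'k"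
    by unfold_locales (simp_all add: algebra_simps)
  \<comment> \<open>Otherwise the function \<open>f\<close> would be a constant vanishing at
    \<open>Pinf\<close>, hence 0, and the local component 1 would have to vanish at
    \<open>P0\<close>.\<close>
  have nmem: "point_adele P0 1 \<notin> ad.span ?Q"
  proof
    assume "point_adele P0 1 \<in> ad.span ?Q"
    moreover have "ad.span (LA (twist 1 1)) = LA (twist 1 1)" "ad.span W = W"
      using subspace_local_adeles[OF subspace_twist] subspace_principal by simp_all
    ultimately obtain \<beta> w where bw: "point_adele P0 1 = \<beta> + w" "\<beta> \<in> LA (twist 1 1)" "w \<in> W"
      unfolding ad.span_Un by auto
    then obtain f where f: "w = (\<lambda>_. f)" "f \<in> K" by (auto simp: principal_adeles_def function_field)
    have comp: "f = point_adele P0 1 P - \<beta> P" for P using bw f by (simp add: fun_eq_iff)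
    have b: "\<beta> P \<in> K" "at_least (v P) (if P = P0 \<or> P = Pinf then 1 else 0) (\<beta> P)" if "P \<in> points X" for P
    proof -
      have "\<beta> P \<in> twist 1 1 P" using bw(2) that by (auto simp: local_adeles_def)
      then show "\<beta> P \<in> K" "at_least (v P) (if P = P0 \<or> P = Pinf then 1 else 0) (\<beta> P)"
        using P0_neq_Pinf by (auto simp: twist_def split: if_splits)
    qed
    have "at_least (v P) 0 f" if P: "P \<in> points X" for P
    proof -
      interpret vP: rf_valuation K "v P" using valuation P .
      have "at_least (v P) 0 (\<beta> P)" using b(2)[OF P] by (rule vP.at_least_mono) simp
      then show ?thesis using b(1)[OF P] vP.at_least_diff[of "point_adele P0 1 P" "\<beta> P"] comp[of P]
        by (cases "P = P0") auto
    qed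
    then obtain a where a: "f = const_rf a" using regular_const[OF f(2)] by blast
    interpret vi: rf_valuation K "v Pinf" using valuation Pinf .
    have "at_least (v Pinf) 1 f" using comp[of Pinf] b[OF Pinf] P0_neq_Pinf by simp
    then have "a = 0" using vi.v_const[of a] by (cases "a = 0") (auto simp: a at_least_def)
    then have "\<beta> P0 = 1" using comp[of P0] a by simp
    then show False using b(2)[OF P0] by (simp add: at_least_def)
  qed
  obtain B where B: "B \<subseteq> ?Q" "ad.independent B" "?Q \<subseteq> ad.span B"
    using ad.maximal_independent_subset by blast
  have nB: "point_adele P0 1 \<notin> ad.span B" using nmem ad.span_mono[OF B(1)] by blast
  then have "ad.independent (insert (point_adele P0 1) B)"
    using B(2) by (intro ad.independent_insertI) auto
  then obtain m where m: "Vector_Spaces.linear scale_ad (*) m"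
    "\<And>x. x \<in> insert (point_adele P0 1) B \<Longrightarrow> m x = (if x = point_adele P0 1 then 1 else 0)"
    using vp.linear_independent_extend[of _ "\<lambda>x. if x = point_adele P0 1 then 1 else 0"] by blast
  interpret m: Vector_Spaces.linear "scale_ad :: 'k \<Rightarrow> ('p \<Rightarrow> 'k ratfun) \<Rightarrow> 'p \<Rightarrow> 'k ratfun" "(*)" m by (rule m(1))
  have "point_adele P0 1 \<notin> B" using nB ad.span_base by blast
  then have "m x = 0" if "x \<in> B" for x using m(2)[of x] that by auto
  moreover have "ad.span ?Q \<subseteq> ad.span B" using B(3) by (intro ad.span_minimal ad.subspace_span)
  ultimately have z: "m x = 0" if "x \<in> ad.span ?Q" for x
    using that m.eq_0_on_span[of B x] by blast
  have "m \<in> H1_dual X (twist 1 1)"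
    unfolding H1_dual_def by (auto simp: m.add m.scale intro!: z ad.span_base)
  then show ?thesis using that z m(2)[of "point_adele P0 1"] by auto
qed

text \<open>The factor \<open>h\<close> represents the residue functional on
  \<open>twist 1 1\<close>; it accounts for \<omega> being determined only up to isomorphism. The
  functionals \<open>L l\<close> are dual to the gap adeles and are represented by h T^-l. An
  arbitrary section is the combination of these whose functional has the same values on the gap
  adeles.\<close>

theorem H0_dualizing:
  assumes \<omega>: "dualizing_sheaf X \<omega>"
  obtains h where "h \<in> K" "- S \<noteq> {} \<Longrightarrow> h \<noteq> 0"
    "H0 X \<omega> = (*) h ` rf.span ((\<lambda>l. T powi (- int l)) ` (- S))"
proof -
  obtain tr where tf: "tf_sheaf X \<omega>" and tr: "tr \<in> H1_dual X \<omega>"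
    and dual: "\<And>F l. tf_sheaf X F \<Longrightarrow> l \<in> H1_dual X F \<Longrightarrow>
      \<exists>!h. h \<in> sheaf_hom X F \<omega> \<and> (\<forall>\<alpha>\<in>A. l \<alpha> = tr (\<lambda>P. h * \<alpha> P))"
    using \<omega> unfolding dualizing_sheaf_def by blast
  obtain m where m: "m \<in> H1_dual X (twist 1 1)" "m (point_adele P0 1) = 1"
    "\<And>\<alpha>. \<alpha> \<in> ad.span (LA (twist 1 1) \<union> W) \<Longrightarrow> m \<alpha> = 0"
    using residue_functional by blast
  obtain h where h: "h \<in> sheaf_hom X (twist 1 1) \<omega>" "\<And>\<alpha>. \<alpha> \<in> A \<Longrightarrow> m \<alpha> = tr (\<lambda>P. h * \<alpha> P)"
    using dual[OF tf_twist m(1)] by blast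
  have hK: "h \<in> K" using h by (simp add: sheaf_hom_def function_field)
  have hom_O: "H0 X \<omega> = sheaf_hom X OX \<omega>"
  proof (intro Set.set_eqI iffI)
    fix x assume "x \<in> H0 X \<omega>"
    then show "x \<in> sheaf_hom X OX \<omega>"
      using tf_sheaf_mult[OF tf] by (auto simp: H0_def sheaf_hom_def mult.commute)
  next
    fix x assume "x \<in> sheaf_hom X OX \<omega>"
    then show "x \<in> H0 X \<omega>"
      using one_mem_local_ring by (fastforce simp: H0_def sheaf_hom_def)
  qed
  define t where "t l = T powi (- int l)" for l
  have tK: "t l \<in> K" for l by (simp add: t_def)
  \<comment> \<open>The residue of T^-l \<alpha> dT/T; on an adele concentrated at \<open>P0\<close>
    with a power of \<open>T\<close> as component it picks out the coefficient of T^l.\<close>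
  define L where "L l \<alpha> = m (\<lambda>P. t l * \<alpha> P)" for l and \<alpha> :: "'p \<Rightarrow> 'k ratfun"
  have T_eq: "t l * T ^ l' = T powi (int l' - int l)" for l l'
    using T_nz by (simp add: t_def power_int_diff power_int_minus divide_inverse mult.commute)
  have L_gap: "L l (point_adele P0 (T ^ l')) = (if l' = l then 1 else 0)" for l l'
  proof -
    have eq: "(\<lambda>P. t l * point_adele P0 (T ^ l') P) = point_adele P0 (T powi (int l' - int l))"
      by (simp add: point_adele_def fun_eq_iff T_eq)
    show ?thesis
      unfolding L_def eq using m(2) m(3)[OF T_adele_trivial[of "int l' - int l"]] by simp
  qed
  \<comment> \<open>A gap l is not among the exponents of the stalk at \<open>P0\<close>, terms of
    order at least c > l leave no residue, and T^-l vanishes at \<open>Pinf\<close> because l \<ge>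
    1. So local adeles are killed.\<close>
  have L_dual: "L l \<in> H1_dual X OX" if l: "l \<notin> S" for l
  proof -
    have "l \<noteq> 0" "\<not> c \<le> l" using l zero_S conductor_S by metis+
    then have l1: "l \<ge> 1" "l < c" by simp_all
    have van: "(\<lambda>P. t l * \<alpha> P) \<in> ad.span (LA (twist 1 1) \<union> W)" (is "_ \<in> ?Q") if \<alpha>: "\<alpha> \<in> LA OX" for \<alpha>
    proof -
      have aP: "\<alpha> P \<in> OX P" if "P \<in> points X" for P using \<alpha> that by (auto simp: local_adeles_def)
      obtain y where y: "\<alpha> P0 \<in> K" "y \<in> rf.span ((\<lambda>s. T ^ s) ` S)" "at_least (v P0) (int c) (\<alpha> P0 - y)"
        using aP[OF P0] local_ring_P0 by auto
      have 1: "point_adele P0 (t l * y) \<in> ?Q" using y(2)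
      proof (induction rule: rf.span_induct_alt)
        case base
        have "point_adele P0 (t l * 0) = 0" by (simp add: point_adele_def fun_eq_iff)
        then show ?case by (simp only: ad.span_zero)
      next
        case (step a z z')
        then obtain s where s: "s \<in> S" "z = T ^ s" by auto
        then have "int s - int l \<noteq> 0" using l by auto
        then have "point_adele P0 (t l * z) \<in> ?Q" unfolding s(2) T_eq by (rule T_adele_trivial)
        then have "scale_ad a (point_adele P0 (t l * z)) + point_adele P0 (t l * z') \<in> ?Q"
          using step(2) by (intro ad.span_add ad.span_scale)
        moreover have "scale_ad a (point_adele P0 (t l * z)) + point_adele P0 (t l * z') =
            point_adele P0 (t l * (scale_rf a z + z'))"
          by (simp add: point_adele_def fun_eq_iff scale_ad_def distrib_left scale_rf_mult_left)
        ultimately show ?case by simp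
      qed
      define \<beta> where "\<beta> = (\<lambda>P. if P = P0 then t l * (\<alpha> P0 - y) else t l * \<alpha> P)"
      have yK: "y \<in> K" using y span_T_subset by auto
      have "\<beta> \<in> LA (twist 1 1)"
        unfolding local_adeles_def mem_Collect_eq
      proof
        fix P assume P: "P \<in> points X"
        interpret vP: rf_valuation K "v P" using valuation P .
        have a: "\<alpha> P \<in> K" "at_least (v P) 0 (\<alpha> P)" using aP[OF P] local_ring_subset[OF P] by auto
        consider "P = P0" | "P = Pinf" | "P \<noteq> P0" "P \<noteq> Pinf" by blast
        then show "\<beta> P \<in> twist 1 1 P"
        proof cases
          case 1
          have "at_least (v P0) (- int l + int c) (t l * (\<alpha> P0 - y))"
            using y yK by (intro v0.at_least_mult) (auto simp: t_def at_least_def v0_T_power)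
          then have "at_least (v P0) 1 (t l * (\<alpha> P0 - y))"
            by (rule v0.at_least_mono) (use l1 in simp)
          then show ?thesis using 1 y yK tK by (auto simp: twist_def \<beta>_def)
        next
          case 2
          have "at_least (v P) (int l + 0) (t l * \<alpha> P)"
            using a by (intro vP.at_least_mult) (auto simp: t_def at_least_def v_T_power_Pinf 2)
          then have "at_least (v P) 1 (t l * \<alpha> P)"
            by (rule vP.at_least_mono) (use l1 in simp)
          then show ?thesis using 2 a tK P0_neq_Pinf by (auto simp: twist_def \<beta>_def)
        next
          case 3
          have "at_least (v P) (0 + 0) (t l * \<alpha> P)"
            using a 3 P by (intro vP.at_least_mult) (auto simp: t_def at_least_def v_T_power_other)
          then show ?thesis using 3 a tK by (auto simp: twist_def \<beta>_def)
        qed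
      qed
      then have "point_adele P0 (t l * y) + \<beta> \<in> ?Q"
        using 1 by (intro ad.span_add) (auto intro: ad.span_base)
      moreover have "point_adele P0 (t l * y) + \<beta> = (\<lambda>P. t l * \<alpha> P)"
        by (auto simp: point_adele_def \<beta>_def fun_eq_iff algebra_simps)
      ultimately show ?thesis by simp
    qed
    have "L l \<alpha> = 0" if "\<alpha> \<in> LA OX \<union> W" for \<alpha>
      unfolding L_def using that van mult_principal[OF _ tK] by (auto intro!: m(3) intro: ad.span_base)
    moreover have "L l (\<alpha> + \<beta>) = L l \<alpha> + L l \<beta>" "L l (scale_ad a \<alpha>) = a * L l \<alpha>"
      if "\<alpha> \<in> A" "\<beta> \<in> A" for \<alpha> \<beta> a
    proof -
      have "(\<lambda>P. t l * (\<alpha> + \<beta>) P) = (\<lambda>P. t l * \<alpha> P) + (\<lambda>P. t l * \<beta> P)"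
        "(\<lambda>P. t l * scale_ad a \<alpha> P) = scale_ad a (\<lambda>P. t l * \<alpha> P)"
        by (simp_all add: fun_eq_iff distrib_left scale_ad_def scale_rf_mult_left)
      then show "L l (\<alpha> + \<beta>) = L l \<alpha> + L l \<beta>" "L l (scale_ad a \<alpha>) = a * L l \<alpha>"
        using m(1) mult_adeles[OF that(1) tK] mult_adeles[OF that(2) tK]
        unfolding L_def H1_dual_def by auto
    qed
    ultimately show ?thesis unfolding H1_dual_def by auto
  qed
  have L_tr: "L l \<alpha> = tr (\<lambda>P. (h * t l) * \<alpha> P)" if "\<alpha> \<in> A" for l \<alpha>
    unfolding L_def using h(2)[OF mult_adeles[OF that tK, of l]] by (simp add: mult.assoc)
  have sub: "twist (int c) 0 P \<subseteq> OX P" if "P \<in> points X" for P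
    using that conductor_subset[OF P0] by (auto simp: twist_def local_ring_smooth)
  \<comment> \<open>\<open>L l\<close> is represented by some \<open>h'\<close> on the structure
    sheaf. It is not yet known that h T^-l maps that sheaf to \<omega>, so uniqueness is invoked on
    the smaller sheaf \<open>twist (int c) 0\<close>, where both are homomorphisms.\<close>
  have mem: "h * t l \<in> H0 X \<omega>" if l: "l \<notin> S" for l
  proof -
    obtain h' where h': "h' \<in> sheaf_hom X OX \<omega>" "\<And>\<alpha>. \<alpha> \<in> A \<Longrightarrow> L l \<alpha> = tr (\<lambda>P. h' * \<alpha> P)"
      using dual[OF tf_local_ring L_dual[OF l]] by blast
    have "l \<noteq> 0" "\<not> c \<le> l" using l zero_S conductor_S by metis+
    then have l1: "l \<ge> 1" "l < c" by simp_all
    have "LA (twist (int c) 0) \<subseteq> LA OX" using sub by (auto simp: local_adeles_def)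
    then have "L l \<in> H1_dual X (twist (int c) 0)"
      using L_dual[OF l] unfolding H1_dual_def by blast
    moreover have "h' \<in> sheaf_hom X (twist (int c) 0) \<omega>"
      using h'(1) sub by (fastforce simp: sheaf_hom_def)
    moreover have "h * t l \<in> sheaf_hom X (twist (int c) 0) \<omega>"
    proof -
      have "t l * x \<in> twist 1 1 P" if P: "P \<in> points X" and x: "x \<in> twist (int c) 0 P" for P x
      proof -
        interpret vP: rf_valuation K "v P" using valuation P .
        consider "P = P0" | "P = Pinf" | "P \<noteq> P0" "P \<noteq> Pinf" by blast
        then show ?thesis
        proof cases
          case 1
          have "at_least (v P) (- int l + int c) (t l * x)"
            using x 1 by (intro vP.at_least_mult) (auto simp: twist_def t_def at_least_def v0_T_power)
          then have "at_least (v P) 1 (t l * x)" by (rule vP.at_least_mono) (use l1 in simp)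
          then show ?thesis using 1 x tK by (auto simp: twist_def)
        next
          case 2
          have "at_least (v P) (int l + 0) (t l * x)"
            using x 2 P0_neq_Pinf by (intro vP.at_least_mult) (auto simp: twist_def t_def at_least_def v_T_power_Pinf)
          then have "at_least (v P) 1 (t l * x)" by (rule vP.at_least_mono) (use l1 in simp)
          then show ?thesis using 2 x tK P0_neq_Pinf by (auto simp: twist_def)
        next
          case 3
          have "at_least (v P) (0 + 0) (t l * x)"
            using x 3 P by (intro vP.at_least_mult) (auto simp: twist_def t_def at_least_def v_T_power_other)
          then show ?thesis using 3 x tK by (auto simp: twist_def)
        qed
      qed
      then show ?thesis using h(1) hK tK by (auto simp: sheaf_hom_def function_field mult.assoc)
    qed
    ultimately have "h * t l = h'"
      using dual[OF tf_twist, of "L l" "int c" 0] h'(2) L_tr by metis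
    then show ?thesis using h'(1) hom_O by simp
  qed
  have sH: "rf.subspace (H0 X \<omega>)" using h0_eq_dim(2) subspace_tf_sheaf[OF tf] by blast
  have "H0 X \<omega> = (*) h ` rf.span (t ` (- S))"
  proof
    show "(*) h ` rf.span (t ` (- S)) \<subseteq> H0 X \<omega>"
      unfolding linear_span_image[OF linear_mult_rf, symmetric]
      using mem by (intro rf.span_minimal sH) auto
  next
    show "H0 X \<omega> \<subseteq> (*) h ` rf.span (t ` (- S))"
    proof
      fix g assume g: "g \<in> H0 X \<omega>"
      define l where "l = (\<lambda>\<alpha>. tr (\<lambda>P. g * \<alpha> P))"
      have l: "l \<in> H1_dual X OX" unfolding l_def using g hom_O by (intro H1_dual_mult[OF tr]) simp
      \<comment> \<open>By duality with the \<open>L i\<close>, the functional of this combination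
        agrees with that of \<open>g\<close> on the gap adeles.\<close>
      define g' where "g' = (\<Sum>i\<in>- S. scale_rf (l (point_adele P0 (T ^ i))) (h * t i))"
      have g': "g' \<in> H0 X \<omega>"
        unfolding g'_def using mem by (intro rf.subspace_sum rf.subspace_scale sH) auto
      define l' where "l' = (\<lambda>\<alpha>. tr (\<lambda>P. g' * \<alpha> P))"
      have l': "l' \<in> H1_dual X OX" unfolding l'_def using g' hom_O by (intro H1_dual_mult[OF tr]) simp
      have l'_eq: "l' \<alpha> = (\<Sum>i\<in>- S. l (point_adele P0 (T ^ i)) * L i \<alpha>)" if \<alpha>: "\<alpha> \<in> A" for \<alpha>
      proof -
        have "(\<lambda>P. g' * \<alpha> P) = (\<Sum>i\<in>- S. scale_ad (l (point_adele P0 (T ^ i))) (\<lambda>P. h * t i * \<alpha> P))"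
        proof
          fix P
          have "(\<Sum>i\<in>I. scale_ad (f i) (\<lambda>P. h * t i * \<alpha> P)) P = (\<Sum>i\<in>I. scale_rf (f i) (h * t i * \<alpha> P))" for I f
            by (induction I rule: infinite_finite_induct) (auto simp: scale_ad_def)
          then show "g' * \<alpha> P = (\<Sum>i\<in>- S. scale_ad (l (point_adele P0 (T ^ i))) (\<lambda>P. h * t i * \<alpha> P)) P"
            by (simp add: g'_def sum_distrib_right scale_rf_mult_right)
        qed
        moreover have "(\<lambda>P. h * t i * \<alpha> P) \<in> A" for i
          using mult_adeles[OF \<alpha>, of "h * t i"] hK tK by auto
        ultimately have "l' \<alpha> = (\<Sum>i\<in>- S. l (point_adele P0 (T ^ i)) * tr (\<lambda>P. h * t i * \<alpha> P))"
          unfolding l'_def using H1_dual_sum[OF tr finite_gaps] by simp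
        then show ?thesis using L_tr[OF \<alpha>] by simp
      qed
      have gap: "l' \<alpha> = l \<alpha>" if \<alpha>: "\<alpha> \<in> gap_adeles" for \<alpha>
      proof -
        obtain i where i: "i \<in> - S" "\<alpha> = point_adele P0 (T ^ i)" using \<alpha> by (auto simp: gap_adeles_def)
        have "l' \<alpha> = (\<Sum>k\<in>- S. l (point_adele P0 (T ^ k)) * (if i = k then 1 else 0))"
          using l'_eq[of \<alpha>] \<alpha> gap_adeles_subset unfolding i(2) L_gap by blast
        also have "\<dots> = l \<alpha>" using finite_gaps i by (simp add: if_distrib cong: if_cong)
        finally show ?thesis .
      qed
      \<comment> \<open>Both functionals kill local and principal adeles, and the gap adeles
        generate the rest.\<close>
      have "l \<alpha> = l' \<alpha>" if \<alpha>: "\<alpha> \<in> A" for \<alpha>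
      proof -
        have "\<alpha> \<in> ad.span (gap_adeles \<union> (LA OX \<union> W))" using adeles_span \<alpha> by blast
        then have "\<alpha> \<in> A \<and> l \<alpha> = l' \<alpha>"
        proof (induction rule: ad.span_induct_alt)
          case base
          have "0 \<in> LA OX" using ad.subspace_0[OF subspace_local_adeles[OF subspace_local_ring]] .
          then have "0 \<in> LA OX \<union> W" by (rule UnI1)
          from H1_dualD(3)[OF l this] H1_dualD(3)[OF l' this] ad.subspace_0[OF subspace_adeles]
          show ?case by (simp only:)
        next
          case (step a x y)
          have x: "x \<in> A"
            using step(1) gap_adeles_subset local_adeles_subset[OF tf_local_ring] principal_subset by blast
          have lx: "l x = l' x"
          proof (cases "x \<in> gap_adeles")
            case False
            then have "x \<in> LA OX \<union> W" using step(1) by blast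
            then show ?thesis using H1_dualD(3)[OF l] H1_dualD(3)[OF l'] by metis
          qed (simp add: gap)
          have ax: "scale_ad a x \<in> A" using x ad.subspace_scale[OF subspace_adeles] by blast
          then have "scale_ad a x + y \<in> A" using step(2) ad.subspace_add[OF subspace_adeles] by blast
          moreover have "l (scale_ad a x + y) = l' (scale_ad a x + y)"
            using H1_dualD(1)[OF l ax, of y] H1_dualD(1)[OF l' ax, of y] H1_dualD(2)[OF l x, of a]
              H1_dualD(2)[OF l' x, of a] lx step(2) by metis
          ultimately show ?case ..
        qed
        then show ?thesis by blast
      qed
      then have "g = g'"
        using dual[OF tf_local_ring l] g g' hom_O l_def l'_def by metis
      also have "g' = h * (\<Sum>i\<in>- S. scale_rf (l (point_adele P0 (T ^ i))) (t i))"
        unfolding g'_def by (simp add: sum_distrib_left scale_rf_mult_left)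
      also have "\<dots> \<in> (*) h ` rf.span (t ` (- S))"
        by (intro imageI rf.span_sum rf.span_scale rf.span_base) auto
      finally show "g \<in> (*) h ` rf.span (t ` (- S))" .
    qed
  qed
  \<comment> \<open>For h = 0 the functional \<open>L i\<close> would vanish, but it is 1 on the gap
    adele of i.\<close>
  moreover have "h \<noteq> 0" if gaps: "- S \<noteq> {}"
  proof
    assume "h = 0"
    obtain i where "i \<in> - S" using gaps by blast
    then have "point_adele P0 (T ^ i) \<in> A" using gap_adeles_subset by (auto simp: gap_adeles_def)
    moreover have "0 \<in> LA \<omega>"
      using ad.subspace_0[OF subspace_local_adeles[OF subspace_tf_sheaf[OF tf]]] .
    then have "tr (\<lambda>_. 0) = 0" using tr unfolding H1_dual_def by (auto simp: zero_fun_def)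
    ultimately show False
      using L_tr[of "point_adele P0 (T ^ i)" i] L_gap[of i i] \<open>h = 0\<close> by simp
  qed
  ultimately show ?thesis using that[OF hK] unfolding t_def by blast
qed

end

section \<open>The valuations of \<open>k(t)\<close>\<close>

interpretation UNIV_rf: const_subfield UNIV
  by unfold_locales auto

lemma Fract_nonzero_cases:
  fixes x :: "'k::field ratfun"
  obtains "x = 0" | p q where "x = Fract p q" "p \<noteq> 0" "q \<noteq> 0"
  by (metis Fract_cases_nonzero)

lemma const_rf_Fract: "const_rf c = Fract [:c:] 1"
  by (simp add: const_rf_def to_fract_def)

lemma Fract_eq_0_iff: "q \<noteq> 0 \<Longrightarrow> Fract p q = 0 \<longleftrightarrow> p = 0"
  by (simp add: Zero_fract_def eq_fract)

definition ord_at :: "'k::field \<Rightarrow> 'k ratfun \<Rightarrow> int" where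
  "ord_at a x = (THE n. \<exists>p q. p \<noteq> 0 \<and> q \<noteq> 0 \<and> x = Fract p q \<and> n = int (Polynomial.order a p) - int (Polynomial.order a q))"

definition ord_inf :: "'k::field ratfun \<Rightarrow> int" where
  "ord_inf x = (THE n. \<exists>p q. p \<noteq> 0 \<and> q \<noteq> 0 \<and> x = Fract p q \<and> n = int (degree q) - int (degree p))"

lemma ord_at_Fract:
  assumes "p \<noteq> 0" "q \<noteq> 0"
  shows "ord_at a (Fract p q) = int (Polynomial.order a p) - int (Polynomial.order a q)"
  unfolding ord_at_def
proof (rule the_equality)
  fix n assume "\<exists>p' q'. p' \<noteq> 0 \<and> q' \<noteq> 0 \<and> Fract p q = Fract p' q' \<and> n = int (Polynomial.order a p') - int (Polynomial.order a q')"
  then obtain p' q' where *: "p' \<noteq> 0" "q' \<noteq> 0" "Fract p q = Fract p' q'"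
    "n = int (Polynomial.order a p') - int (Polynomial.order a q')" by blast
  then have "p * q' = p' * q" using assms by (simp add: eq_fract)
  then have "Polynomial.order a (p * q') = Polynomial.order a (p' * q)" by simp
  then show "n = int (Polynomial.order a p) - int (Polynomial.order a q)"
    using * assms by (simp add: order_mult)
qed (use assms in blast)

lemma ord_inf_Fract:
  assumes "p \<noteq> 0" "q \<noteq> 0"
  shows "ord_inf (Fract p q) = int (degree q) - int (degree p)"
  unfolding ord_inf_def
proof (rule the_equality)
  fix n assume "\<exists>p' q'. p' \<noteq> 0 \<and> q' \<noteq> 0 \<and> Fract p q = Fract p' q' \<and> n = int (degree q') - int (degree p')"
  then obtain p' q' where *: "p' \<noteq> 0" "q' \<noteq> 0" "Fract p q = Fract p' q'"
    "n = int (degree q') - int (degree p')" by blast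
  then have "p * q' = p' * q" using assms by (simp add: eq_fract)
  then have "degree (p * q') = degree (p' * q)" by simp
  then show "n = int (degree q) - int (degree p)"
    using * assms by (simp add: degree_mult_eq)
qed (use assms in blast)

text \<open>The full power of t - a in the denominator is cancelled, since the numerator vanishes to
  at least the same order.\<close>

lemma regular_Fract:
  assumes "at_least (ord_at a) 0 x"
  obtains p q where "x = Fract p q" "poly q a \<noteq> 0"
proof (cases x rule: Fract_nonzero_cases)
  case 1
  then have "x = Fract 0 1" by (simp add: Zero_fract_def)
  then show ?thesis using that[of 0 1] by simp
next
  case (2 p q)
  then have le: "Polynomial.order a q \<le> Polynomial.order a p" using assms by (auto simp: at_least_def ord_at_Fract Zero_fract_def eq_fract)
  obtain p' where p': "p = [:- a, 1:] ^ Polynomial.order a p * p'"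
    using order_decomp[OF 2(2)] by blast
  obtain q' where q': "q = [:- a, 1:] ^ Polynomial.order a q * q'" "\<not> [:- a, 1:] dvd q'"
    using order_decomp[OF 2(3)] by blast
  let ?u = "[:- a, 1:] ^ Polynomial.order a q"
  have "p = ?u * ([:- a, 1:] ^ (Polynomial.order a p - Polynomial.order a q) * p')"
    by (subst p') (simp add: le flip: mult.assoc power_add)
  then have "x = Fract (?u * ([:- a, 1:] ^ (Polynomial.order a p - Polynomial.order a q) * p')) (?u * q')"
    using 2(1) q'(1) by metis
  also have "\<dots> = Fract ([:- a, 1:] ^ (Polynomial.order a p - Polynomial.order a q) * p') q'"
    by (rule mult_fract_cancel) simp
  finally show ?thesis using that q'(2) by (simp add: poly_eq_0_iff_dvd)
qed

interpretation ord_at: rf_valuation UNIV "ord_at a" for a :: "'k::field"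
proof unfold_locales
  fix x y :: "'k ratfun"
  {
    assume "x \<noteq> 0" "y \<noteq> 0"
    then obtain p q p' q' where *: "x = Fract p q" "y = Fract p' q'" "p \<noteq> 0" "q \<noteq> 0" "p' \<noteq> 0" "q' \<noteq> 0"
      by (metis Fract_nonzero_cases)
    then show "ord_at a (x * y) = ord_at a x + ord_at a y"
      by (simp add: ord_at_Fract order_mult)
    assume nz: "x + y \<noteq> 0"
    let ?s = "p * q' + p' * q"
    have s: "x + y = Fract ?s (q * q')" using * by simp
    have s0: "?s \<noteq> 0" using nz * by (auto simp: s Zero_fract_def eq_fract)
    let ?n = "min (Polynomial.order a (p * q')) (Polynomial.order a (p' * q))"
    have "[:- a, 1:] ^ ?n dvd p * q'" "[:- a, 1:] ^ ?n dvd p' * q"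
      by (simp_all add: order_divides)
    then have "[:- a, 1:] ^ ?n dvd ?s" by (rule dvd_add)
    then have "?n \<le> Polynomial.order a ?s" using s0 by (simp add: order_divides)
    then show "min (ord_at a x) (ord_at a y) \<le> ord_at a (x + y)"
      unfolding s using * s0 by (simp add: ord_at_Fract order_mult)
  }
next
  fix c :: 'k assume "c \<noteq> 0"
  then show "ord_at a (const_rf c) = 0"
    by (simp add: const_rf_Fract ord_at_Fract order_0I)
next
  fix x :: "'k ratfun" assume "at_least (ord_at a) 0 x"
  then obtain p q where pq: "x = Fract p q" "poly q a \<noteq> 0" by (rule regular_Fract)
  have q: "q \<noteq> 0" using pq(2) by auto
  define c where "c = poly p a / poly q a"
  let ?r = "p - Polynomial.smult c q"
  have eq: "x - const_rf c = Fract ?r q" using q by (simp add: pq(1) const_rf_Fract)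
  have "poly ?r a = 0" using pq(2) by (simp add: c_def)
  then have "?r = 0 \<or> Polynomial.order a ?r \<ge> 1" using order_root[of ?r a] by auto
  then have "at_least (ord_at a) 1 (x - const_rf c)"
  proof
    assume "?r = 0"
    then show ?thesis using q by (simp add: eq at_least_def Zero_fract_def eq_fract)
  next
    assume "1 \<le> Polynomial.order a ?r"
    then show ?thesis using q pq(2)
      by (cases "?r = 0") (simp_all add: eq at_least_def ord_at_Fract Zero_fract_def eq_fract order_0I)
  qed
  then show "\<exists>c. at_least (ord_at a) 1 (x - const_rf c)" ..
qed

interpretation ord_inf: rf_valuation UNIV "ord_inf :: 'k::field ratfun \<Rightarrow> int"
proof unfold_locales
  fix x y :: "'k ratfun"
  {
    assume "x \<noteq> 0" "y \<noteq> 0"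
    then obtain p q p' q' where *: "x = Fract p q" "y = Fract p' q'" "p \<noteq> 0" "q \<noteq> 0" "p' \<noteq> 0" "q' \<noteq> 0"
      by (metis Fract_nonzero_cases)
    then show "ord_inf (x * y) = ord_inf x + ord_inf y"
      by (simp add: ord_inf_Fract degree_mult_eq)
    assume nz: "x + y \<noteq> 0"
    let ?s = "p * q' + p' * q"
    have s: "x + y = Fract ?s (q * q')" using * by simp
    have s0: "?s \<noteq> 0" using nz * by (auto simp: s Zero_fract_def eq_fract)
    have "degree ?s \<le> max (degree (p * q')) (degree (p' * q))"
      by (rule degree_add_le_max)
    then show "min (ord_inf x) (ord_inf y) \<le> ord_inf (x + y)"
      unfolding s using * s0 by (simp add: ord_inf_Fract degree_mult_eq)
  }
next
  fix c :: 'k assume "c \<noteq> 0"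
  then show "ord_inf (const_rf c) = 0"
    by (simp add: const_rf_Fract ord_inf_Fract)
next
  fix x :: "'k ratfun" assume r: "at_least ord_inf 0 x"
  show "\<exists>c. at_least ord_inf 1 (x - const_rf c)"
  proof (cases x rule: Fract_nonzero_cases)
    case 1
    then have "at_least ord_inf 1 (x - const_rf 0)" by (simp add: at_least_def)
    then show ?thesis ..
  next
    case (2 p q)
    then have le: "degree p \<le> degree q" using r by (auto simp: at_least_def ord_inf_Fract Zero_fract_def eq_fract)
    define c where "c = coeff p (degree q) / lead_coeff q"
    let ?r = "p - Polynomial.smult c q"
    have eq: "x - const_rf c = Fract ?r q" using 2 by (simp add: const_rf_Fract)
    have "coeff ?r (degree q) = 0" using 2 by (simp add: c_def)
    moreover have "degree ?r \<le> degree q"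
      using le Polynomial.degree_smult_le[of c q] by (intro degree_diff_le) auto
    ultimately have "?r = 0 \<or> degree ?r < degree q"
      by (metis le_neq_implies_less leading_coeff_0_iff)
    then have "at_least ord_inf 1 (x - const_rf c)"
      unfolding at_least_def eq using 2(3)
      by (cases "?r = 0") (auto simp: ord_inf_Fract Fract_eq_0_iff)
    then show ?thesis ..
  qed
qed

abbreviation var_rf :: "'k::field ratfun" where
  "var_rf \<equiv> to_fract [:0, 1:]"

lemma to_fract_power: "to_fract (p ^ n) = to_fract p ^ n"
  by (induction n) simp_all

lemma ord_at_poly: "p \<noteq> 0 \<Longrightarrow> ord_at a (to_fract p) = int (Polynomial.order a p)"
  by (simp add: to_fract_def ord_at_Fract)

lemma ord_inf_poly: "p \<noteq> 0 \<Longrightarrow> ord_inf (to_fract p) = - int (degree p)"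
  by (simp add: to_fract_def ord_inf_Fract)

lemma ord_at_linear: "ord_at a (to_fract [:- b, 1:]) = (if a = b then 1 else 0)"
  using order_power_n_n[of b 1] by (auto simp: ord_at_poly order_0I)

lemma ord_inf_linear: "ord_inf (to_fract [:- b, 1:]) = - 1"
  by (simp add: ord_inf_poly)

section \<open>Poles, constants and principal parts on the projective line\<close>

lemma finite_ord_at_poles: "finite {a. \<not> at_least (ord_at a) 0 (x :: 'k::field ratfun)}"
proof (cases x rule: Fract_nonzero_cases)
  case (2 p q)
  have "poly q a = 0" if "\<not> at_least (ord_at a) 0 x" for a
  proof (rule ccontr)
    assume "poly q a \<noteq> 0"
    then have "ord_at a x = int (Polynomial.order a p)"
      unfolding 2(1) ord_at_Fract[OF 2(2,3)] by (simp add: order_0I)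
    then show False using that by (simp add: at_least_def)
  qed
  then have "{a. \<not> at_least (ord_at a) 0 x} \<subseteq> {a. poly q a = 0}" by blast
  then show ?thesis using poly_roots_finite[OF 2(3)] finite_subset by blast
qed simp

text \<open>In a fraction with denominator of least degree, a root of the denominator would by
  regularity be a root of the numerator and could be cancelled. So the denominator is constant, and
  regularity at infinity makes the numerator constant too.\<close>

lemma regular_everywhere_const:
  fixes x :: "'k::alg_closed_field ratfun"
  assumes fin: "\<And>a. at_least (ord_at a) 0 x" and inf: "at_least ord_inf 0 x"
  shows "\<exists>c. x = const_rf c"
proof (cases "x = 0")
  case True
  then show ?thesis by (intro exI[of _ 0]) simp
next
  case False
  let ?P = "\<lambda>(p, q). x = Fract p q \<and> p \<noteq> 0 \<and> q \<noteq> 0"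
  obtain p0 q0 where "?P (p0, q0)" using False by (cases x rule: Fract_nonzero_cases) auto
  from ex_has_least_nat[of ?P, OF this, of "\<lambda>pq. degree (snd pq)"]
  obtain pq where pq: "?P pq" "\<And>pq'. ?P pq' \<Longrightarrow> degree (snd pq) \<le> degree (snd pq')"
    by blast
  obtain p q where [simp]: "pq = (p, q)" by (cases pq)
  have x: "x = Fract p q" "p \<noteq> 0" "q \<noteq> 0" using pq(1) by simp_all
  have "degree q = 0"
  proof (rule ccontr)
    assume "degree q \<noteq> 0"
    then obtain a where a: "poly q a = 0" using alg_closed_imp_poly_has_root[of q] by auto
    then have "Polynomial.order a q \<noteq> 0" using order_root[of q a] x by simp
    moreover have "0 \<le> ord_at a x" using fin[of a] False by (simp add: at_least_def)
    then have "Polynomial.order a q \<le> Polynomial.order a p"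
      unfolding x(1) ord_at_Fract[OF x(2,3)] by simp
    ultimately have "Polynomial.order a p \<noteq> 0" by simp
    then have "poly p a = 0" using order_root[of p a] by blast
    then obtain p' where p': "p = [:- a, 1:] * p'" by (auto simp: poly_eq_0_iff_dvd dvd_def)
    obtain q' where q': "q = [:- a, 1:] * q'" using a by (auto simp: poly_eq_0_iff_dvd dvd_def)
    have "x = Fract p' q'" unfolding x p' q' by (rule mult_fract_cancel) simp
    moreover have "p' \<noteq> 0" "q' \<noteq> 0" using x p' q' by auto
    ultimately have "degree q \<le> degree q'" using pq(2)[of "(p', q')"] by simp
    moreover have "degree q = 1 + degree q'" unfolding q' using \<open>q' \<noteq> 0\<close> by (subst degree_mult_eq) auto
    ultimately show False by simp
  qed
  moreover from this have "degree p = 0"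
    using inf False unfolding at_least_def x(1) ord_inf_Fract[OF x(2,3)] by simp
  ultimately obtain d e where de: "p = [:d:]" "q = [:e:]" by (metis degree_eq_zeroE)
  then have "x = const_rf (d / e)" using x by (simp add: const_rf_Fract eq_fract)
  then show ?thesis ..
qed

text \<open>The polar part of the expansion in t - a: its negative powers are regular at the other
  points and vanish at infinity.\<close>

lemma principal_part_at:
  obtains y where "at_least (ord_at a) 0 (x - y)" "\<And>b. b \<noteq> a \<Longrightarrow> at_least (ord_at b) 0 y"
    "at_least ord_inf 0 (y :: 'k::field ratfun)"
proof -
  let ?u = "to_fract [:- a, 1:] :: 'k ratfun"
  have u: "?u \<in> UNIV" "?u \<noteq> 0" "ord_at a ?u = 1" by (simp_all add: ord_at_linear)
  define n where "n = min 0 (ord_at a x)"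
  have x: "x \<in> UNIV" "at_least (ord_at a) n x" by (simp_all add: at_least_def n_def)
  obtain c where c: "at_least (ord_at a) 0 (x - (\<Sum>m\<in>{n..<0}. scale_rf (c m) (?u powi m)))"
    using ord_at.expansion[OF u x] by blast
  show ?thesis
  proof (rule that[OF c])
    fix b assume "b \<noteq> a"
    then show "at_least (ord_at b) 0 (\<Sum>m\<in>{n..<0}. scale_rf (c m) (?u powi m))"
      by (intro ord_at.at_least_sum ord_at.at_least_scale ord_at.at_least_power_int) (auto simp: ord_at_linear)
  next
    show "at_least ord_inf 0 (\<Sum>m\<in>{n..<0}. scale_rf (c m) (?u powi m))"
      by (intro ord_inf.at_least_sum ord_inf.at_least_scale ord_inf.at_least_power_int) (auto simp: ord_inf_linear)
  qed
qed

lemma ord_inf_var: "ord_inf (inverse var_rf :: 'k::field ratfun) = 1"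
  using ord_inf_linear[of "0 :: 'k"] by (simp add: ord_inf.v_inverse)

lemma ord_at_var: "ord_at a var_rf = (if a = 0 then 1 else 0)"
  using ord_at_linear[of a 0] by simp

lemma principal_part_inf:
  obtains y where "at_least ord_inf 0 (x - y)" "\<And>a. at_least (ord_at a) 0 (y :: 'k::field ratfun)"
proof -
  let ?u = "inverse var_rf :: 'k ratfun"
  have u: "?u \<in> UNIV" "?u \<noteq> 0" "ord_inf ?u = 1" by (simp_all add: ord_inf_var)
  define n where "n = min 0 (ord_inf x)"
  have x: "x \<in> UNIV" "at_least ord_inf n x" by (simp_all add: at_least_def n_def)
  obtain c where c: "at_least ord_inf 0 (x - (\<Sum>m\<in>{n..<0}. scale_rf (c m) (?u powi m)))"
    using ord_inf.expansion[OF u x] by blast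
  show ?thesis
  proof (rule that[OF c])
    fix a
    have "ord_at a ?u = - ord_at a var_rf" by (intro ord_at.v_inverse) auto
    then show "at_least (ord_at a) 0 (\<Sum>m\<in>{n..<0}. scale_rf (c m) (?u powi m))"
      by (intro ord_at.at_least_sum ord_at.at_least_scale ord_at.at_least_power_int) (auto simp: ord_at_var)
  qed
qed

section \<open>Gaps and chains\<close>

text \<open>For \<delta> > 0 and finite \<open>L\<close> this is the number of maximal chains l, l +
  \<delta>, l + 2 \<delta>, ... in \<open>L\<close>, counted by their last elements.\<close>

definition chain_number :: "nat set \<Rightarrow> nat \<Rightarrow> nat" where
  "chain_number L \<delta> = card {l \<in> L. l + \<delta> \<notin> L}"

context unibranch_curve
begin

lemma finite_chain_ends: "finite {l \<in> - S. l + \<delta> \<notin> - S}"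
  by (rule finite_subset[OF _ finite_gaps]) auto

text \<open>The difference splits by sign: its nonnegative elements are the gaps l with l + \<delta>
  in \<open>S\<close>, and the negative ones come from the s < \<delta>.\<close>

lemma pencil_degree_eq_chain_number:
  "pencil_degree \<delta> = chain_number (- S) \<delta> + card {s \<in> S. s < \<delta>}"
proof -
  let ?I = "(\<lambda>s. int s - int \<delta>) ` S - int ` S"
  have eq: "?I = int ` {l \<in> - S. l + \<delta> \<notin> - S'} \<union> (\<lambda>s. int s - int \<delta>) ` {s \<in> S. s < \<delta>}" if "S' = S" for S'
    unfolding that
  proof (intro Set.set_eqI iffI)
    fix x assume "x \<in> ?I"
    then obtain s where s: "s \<in> S" "x = int s - int \<delta>" "x \<notin> int ` S" by auto
    show "x \<in> int ` {l \<in> - S. l + \<delta> \<notin> - S} \<union> (\<lambda>s. int s - int \<delta>) ` {s \<in> S. s < \<delta>}"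
    proof (cases "s < \<delta>")
      case False
      then have x: "x = int (s - \<delta>)" using s by simp
      then have "s - \<delta> \<notin> S" using s(3) by blast
      then show ?thesis using s(1) x False by (intro UnI1 image_eqI[of _ _ "s - \<delta>"]) auto
    qed (use s in auto)
  next
    fix x assume "x \<in> int ` {l \<in> - S. l + \<delta> \<notin> - S} \<union> (\<lambda>s. int s - int \<delta>) ` {s \<in> S. s < \<delta>}"
    then show "x \<in> ?I"
    proof
      assume "x \<in> int ` {l \<in> - S. l + \<delta> \<notin> - S}"
      then obtain l where l: "x = int l" "l \<notin> S" "l + \<delta> \<in> S" by auto
      then show ?thesis by (auto intro!: image_eqI[of _ _ "l + \<delta>"])
    qed auto
  qed
  have "card (int ` {l \<in> - S. l + \<delta> \<notin> - S} \<union> (\<lambda>s. int s - int \<delta>) ` {s \<in> S. s < \<delta>}) =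
      card (int ` {l \<in> - S. l + \<delta> \<notin> - S}) + card ((\<lambda>s. int s - int \<delta>) ` {s \<in> S. s < \<delta>})"
  proof (rule card_Un_disjoint)
    show "finite (int ` {l \<in> - S. l + \<delta> \<notin> - S})" by (intro finite_imageI finite_chain_ends)
    show "finite ((\<lambda>s. int s - int \<delta>) ` {s \<in> S. s < \<delta>})" by simp
  qed auto
  also have "card (int ` {l \<in> - S. l + \<delta> \<notin> - S}) = chain_number (- S) \<delta>"
    unfolding chain_number_def by (rule card_image) (simp add: inj_on_def)
  also have "card ((\<lambda>s. int s - int \<delta>) ` {s \<in> S. s < \<delta>}) = card {s \<in> S. s < \<delta>}"
    by (rule card_image) (simp add: inj_on_def)
  finally show ?thesis unfolding pencil_degree_def using eq[OF refl] by simp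
qed

text \<open>Each residue class modulo m contributes at most one element: if x is in S - m, then x +
  k m with k > 0 is already in \<open>S\<close>.\<close>

lemma pencil_degree_at_most: "m \<in> S \<Longrightarrow> m > 0 \<Longrightarrow> pencil_degree m \<le> m"
proof -
  assume m: "m \<in> S" "m > 0"
  let ?I = "(\<lambda>s. int s - int m) ` S - int ` S"
  have mult: "k * m \<in> S" for k by (induction k) (simp_all add: zero_S add_S m)
  have less: False if "x \<in> ?I" "y \<in> ?I" "x mod int m = y mod int m" "x < y" for x y
  proof -
    obtain s where s: "s \<in> S" "x = int s - int m" using \<open>x \<in> ?I\<close> by auto
    have "int m dvd y - x" using that(3) by (metis mod_eq_dvd_iff)
    then obtain k where k: "y - x = int m * k" by auto
    have "0 < int m * k" using k that(4) by simp
    then have "k > 0" using m by (simp add: zero_less_mult_iff)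
    then have "y = int (s + nat (k - 1) * m)"
      using k s by (simp add: algebra_simps)
    moreover have "s + nat (k - 1) * m \<in> S" using s mult add_S by blast
    ultimately show False using that(2) by blast
  qed
  have "inj_on (\<lambda>x. x mod int m) ?I"
    using less by (intro inj_onI) (metis linorder_less_linear)
  then have "card ?I = card ((\<lambda>x. x mod int m) ` ?I)" by (simp add: card_image)
  also have "\<dots> \<le> card {0..<int m}" using m by (intro card_mono) auto
  finally show ?thesis by (simp add: pencil_degree_def)
qed

text \<open>Beyond the multiplicity \<open>m\<close> of \<open>S\<close> the gaps \<open>1, \<dots>, m - 1\<close> lie on different chains.\<close>

lemma chain_number_ge:
  assumes "\<And>s. s \<in> S \<Longrightarrow> s > 0 \<Longrightarrow> m \<le> s" and "m < \<delta>"
  shows "m \<le> chain_number (- S) \<delta> + 1"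
proof -
  let ?top = "{l \<in> - S. l + \<delta> \<notin> - S}"
  have "{1..<m} \<subseteq> (\<lambda>l. l mod \<delta>) ` ?top"
  proof
    fix r assume r: "r \<in> {1..<m}"
    \<comment> \<open>The largest gap in the class of r modulo \<delta> ends its chain, and
      different classes give different ends.\<close>
    let ?R = "{l \<in> - S. l mod \<delta> = r}"
    have "r \<in> ?R" using r assms(1)[of r] assms(2) by auto
    moreover have fin: "finite ?R" by (rule finite_subset[OF _ finite_gaps]) auto
    ultimately have max: "Max ?R \<in> ?R" by (intro Max_in) auto
    have "Max ?R + \<delta> \<notin> ?R" using Max_ge[OF fin, of "Max ?R + \<delta>"] assms(2) by auto
    then have "Max ?R \<in> ?top" using max by auto
    then show "r \<in> (\<lambda>l. l mod \<delta>) ` ?top" using max by force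
  qed
  then have "card {1..<m} \<le> card ((\<lambda>l. l mod \<delta>) ` ?top)"
    by (intro card_mono finite_imageI finite_chain_ends)
  also have "\<dots> \<le> card ?top" by (intro card_image_le finite_chain_ends)
  finally show ?thesis by (simp add: chain_number_def)
qed

lemma pencil_degree_iff_chain_number:
  "(\<exists>\<delta>>0. pencil_degree \<delta> \<le> e + 1) \<longleftrightarrow> (\<exists>\<delta>>0. chain_number (- S) \<delta> \<le> e)"
proof
  assume "\<exists>\<delta>>0. pencil_degree \<delta> \<le> e + 1"
  then obtain \<delta> where \<delta>: "\<delta> > 0" "pencil_degree \<delta> \<le> e + 1" by blast
  \<comment> \<open>The element 0 of \<open>S\<close> becomes negative under the shift and accounts
    for the difference of 1 between the two bounds.\<close>
  have "card {0 :: nat} \<le> card {s \<in> S. s < \<delta>}"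
    using zero_S \<delta>(1) by (intro card_mono) auto
  then have "chain_number (- S) \<delta> \<le> e" using \<delta>(2) by (simp add: pencil_degree_eq_chain_number)
  then show "\<exists>\<delta>>0. chain_number (- S) \<delta> \<le> e" using \<delta>(1) by blast
next
  assume "\<exists>\<delta>>0. chain_number (- S) \<delta> \<le> e"
  then obtain \<delta> where \<delta>: "\<delta> > 0" "chain_number (- S) \<delta> \<le> e" by blast
  define m where "m = (LEAST s. s \<in> S \<and> s > 0)"
  \<comment> \<open>\<open>Suc c\<close> and not \<open>c\<close>, because a positive element is
    required and \<open>c\<close> may be 0.\<close>
  have "Suc c \<in> S \<and> Suc c > 0" by (simp add: conductor_S)
  then have m: "m \<in> S \<and> m > 0" unfolding m_def by (rule LeastI)
  have least: "m \<le> s" if "s \<in> S" "s > 0" for s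
    unfolding m_def using that by (intro Least_le) auto
  show "\<exists>\<delta>>0. pencil_degree \<delta> \<le> e + 1"
  proof (cases "\<delta> \<le> m")
    case True
    then have "{s \<in> S. s < \<delta>} \<subseteq> {0}" using least by force
    then have "card {s \<in> S. s < \<delta>} \<le> card {0 :: nat}" by (intro card_mono) auto
    then have "pencil_degree \<delta> \<le> e + 1" using \<delta>(2) by (simp add: pencil_degree_eq_chain_number)
    then show ?thesis using \<delta>(1) by blast
  next
    case False
    then have "m \<le> e + 1" using chain_number_ge[of m \<delta>] least \<delta>(2) by force
    then show ?thesis using pencil_degree_at_most[of m] m by (intro exI[of _ m]) auto
  qed
qed

end

text \<open>With three elements, a difference \<delta> of two of them joins these into one chain;
  fewer elements are trivial. This matches the convention that a curve in a plane lies on a surface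
  scroll.\<close>

lemma small_chain_number:
  assumes "card L \<le> 3" "finite L"
  shows "\<exists>\<delta>>0. chain_number L \<delta> \<le> 2"
proof (cases "card L \<le> 2")
  case True
  have "chain_number L 1 \<le> card L"
    unfolding chain_number_def using assms by (intro card_mono) auto
  then show ?thesis using True by (intro exI[of _ 1]) simp
next
  case False
  then obtain l l' where l: "l \<in> L" "l' \<in> L" "l < l'"
    by (metis assms(2) card_le_Suc0_iff_eq le_SucI linorder_less_linear numeral_2_eq_2)
  have "{x \<in> L. x + (l' - l) \<notin> L} \<subseteq> L - {l}" using l by auto
  then have "chain_number L (l' - l) \<le> card (L - {l})"
    unfolding chain_number_def using assms by (intro card_mono) auto
  then show ?thesis using l assms by (intro exI[of _ "l' - l"]) auto
qed

section \<open>Monomial curves on scrolls\<close>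

lemma scroll_cols_snoc:
  "scroll_cols (m @ [a]) = scroll_cols m @ map (\<lambda>r. sum_list m + length m + r) [0..<a]"
proof -
  have "map (\<lambda>i. map (\<lambda>r. sum_list (take i (m @ [a])) + i + r) [0..<(m @ [a]) ! i]) [0..<length m] =
      map (\<lambda>i. map (\<lambda>r. sum_list (take i m) + i + r) [0..<m ! i]) [0..<length m]"
    by (intro map_cong) (auto simp: nth_append)
  note eq = this
  have len: "[0..<length (m @ [a])] = [0..<length m] @ [length m]" by simp
  show ?thesis unfolding scroll_cols_def len map_append concat_append eq by simp
qed

lemma scroll_cols_Nil [simp]: "scroll_cols [] = []"
  by (simp add: scroll_cols_def)

lemma length_scroll_cols: "length (scroll_cols m) = sum_list m"
  by (induction m rule: rev_induct) (simp_all add: scroll_cols_snoc)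

lemma scroll_cols_less: "j \<in> set (scroll_cols m) \<Longrightarrow> j + 1 < sum_list m + length m"
proof (induction m rule: rev_induct)
  case (snoc a m)
  then have "j \<in> set (scroll_cols m) \<or> j \<in> (\<lambda>r. sum_list m + length m + r) ` {0..<a}"
    by (simp only: scroll_cols_snoc set_append set_map set_upt Un_iff)
  then show ?case using snoc.IH by auto
qed simp

lemma distinct_scroll_cols: "distinct (scroll_cols m)"
proof (induction m rule: rev_induct)
  case (snoc a m)
  have "distinct (map (\<lambda>r. sum_list m + length m + r) [0..<a])"
    by (simp add: distinct_map inj_on_def)
  moreover have "set (scroll_cols m) \<inter> set (map (\<lambda>r. sum_list m + length m + r) [0..<a]) = {}"
    using scroll_cols_less[of _ m] by fastforce
  ultimately show ?case using snoc by (simp only: scroll_cols_snoc distinct_append)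
qed simp

section \<open>Matrices with two rows and rank less than 2\<close>

lemma rank_2_minor:
  fixes A :: "'k::field mat"
  assumes A: "A \<in> carrier_mat 2 nc" and rank: "vec_space.rank 2 A < 2" and j: "i < nc" "j < nc"
  shows "A $$ (0, i) * A $$ (1, j) = A $$ (0, j) * A $$ (1, i)"
proof (rule ccontr)
  assume neq: "A $$ (0, i) * A $$ (1, j) \<noteq> A $$ (0, j) * A $$ (1, i)"
  interpret vec_space "TYPE('k)" 2 .
  let ?B = "mat_of_cols 2 [col A i, col A j]"
  have "?B \<in> carrier_mat 2 (length [col A i, col A j])" by (rule mat_of_cols_carrier(1))
  then have B: "?B \<in> carrier_mat 2 2" by (simp add: numeral_2_eq_2)
  have "col A k \<in> carrier_vec 2" for k by (rule carrier_vecI) (use A in simp)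
  then have cols: "cols ?B = [col A i, col A j]" by (intro cols_mat_of_cols) auto
  have "col A i \<noteq> col A j"
  proof
    assume eq: "col A i = col A j"
    have "col A i $ r = A $$ (r, i)" "col A j $ r = A $$ (r, j)" if "r < 2" for r
      using A j that by simp_all
    then have "A $$ (r, i) = A $$ (r, j)" if "r < 2" for r using eq that by metis
    then show False using neq by simp
  qed
  then have dist: "distinct (cols ?B)" by (simp add: cols)
  have "lin_indpt (set (cols ?B))"
  proof
    assume "lin_dep (set (cols ?B))"
    then obtain w where w: "w \<in> carrier_vec 2" "w \<noteq> 0\<^sub>v 2" "?B *\<^sub>v w = 0\<^sub>v 2"
      using lin_depE[OF B _ dist] by blast
    have eq: "A $$ (r, i) * w $ 0 + A $$ (r, j) * w $ 1 = 0" if r: "r < 2" for r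
    proof -
      have "(?B *\<^sub>v w) $ r = (\<Sum>k<2. ?B $$ (r, k) * w $ k)"
        using B w(1) r by (simp add: scalar_prod_def atLeast0LessThan)
      also have "\<dots> = A $$ (r, i) * w $ 0 + A $$ (r, j) * w $ 1"
        using A j r by (simp add: mat_of_cols_index numeral_2_eq_2)
      finally show ?thesis using w(3) r by simp
    qed
    \<comment> \<open>By Cramer's rule the minor \<open>D\<close> annihilates the coefficients of a
      vanishing combination of the two columns.\<close>
    define D where "D = A $$ (0, i) * A $$ (1, j) - A $$ (0, j) * A $$ (1, i)"
    have "D * w $ 0 = A $$ (1, j) * (A $$ (0, i) * w $ 0 + A $$ (0, j) * w $ 1) -
        A $$ (0, j) * (A $$ (1, i) * w $ 0 + A $$ (1, j) * w $ 1)"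
      "D * w $ 1 = A $$ (0, i) * (A $$ (1, i) * w $ 0 + A $$ (1, j) * w $ 1) -
        A $$ (1, i) * (A $$ (0, i) * w $ 0 + A $$ (0, j) * w $ 1)"
      unfolding D_def by (simp_all add: algebra_simps)
    then have "D * w $ 0 = 0" "D * w $ 1 = 0" using eq[of 0] eq[of 1] by simp_all
    moreover have "D \<noteq> 0" using neq by (simp add: D_def)
    ultimately have "w = 0\<^sub>v 2" using w(1) by (intro eq_vecI) (auto simp: less_2_cases_iff)
    then show False using w(2) by simp
  qed
  then have "card (set (cols ?B)) \<le> rank A"
    using A j by (intro rank_ge_card_indpt[OF A]) (auto simp: cols cols_def)
  moreover have "card (set (cols ?B)) = 2" using distinct_card[OF dist] by (simp add: cols)
  ultimately show False using rank by simp
qed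

lemma rank_less_2:
  fixes A :: "'k::field mat"
  assumes A: "A \<in> carrier_mat 2 nc" and st: "s \<noteq> 0 \<or> t \<noteq> 0"
    and rel: "\<And>j. j < nc \<Longrightarrow> s * A $$ (1, j) = t * A $$ (0, j)"
  shows "vec_space.rank 2 A < 2"
proof -
  interpret vec_space "TYPE('k)" 2 .
  have "rank A \<le> 1"
  proof (cases "s = 0")
    case True
    then have "A $$ (0, j) = 0" if "j < nc" for j using rel[OF that] st by simp
    then show ?thesis
      using A by (intro rank_le_1_product_entries[of A nc "\<lambda>r. if r = 0 then 0 else 1" "\<lambda>j. A $$ (1, j)"])
        (auto simp: less_2_cases_iff)
  next
    case False
    then have "A $$ (1, j) = t / s * A $$ (0, j)" if "j < nc" for j
      using rel[OF that] by (simp add: field_simps)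
    then show ?thesis
      using A by (intro rank_le_1_product_entries[of A nc "\<lambda>r. if r = 0 then 1 else t / s" "\<lambda>j. A $$ (0, j)"])
        (auto simp: less_2_cases_iff)
  qed
  then show ?thesis by simp
qed

lemma scroll_matrix_carrier: "scroll_matrix m x \<in> carrier_mat 2 (sum_list m)"
  by (simp add: scroll_matrix_def)

text \<open>The minors are homogeneous, so they vanish for every representative of the point and not
  only for the one that witnesses membership in the scroll.\<close>

lemma scroll_minor:
  fixes x :: "'k::field vec"
  assumes x: "x \<in> carrier_vec (N + 1)" and mem: "proj_point x \<in> scroll N m \<sigma>"
    and \<sigma>: "\<sigma> permutes {..N}" and N: "sum_list m + length m = N + 1"
    and j: "j \<in> set (scroll_cols m)" "j' \<in> set (scroll_cols m)"
  shows "x $ \<sigma> j * x $ \<sigma> (j' + 1) = x $ \<sigma> j' * x $ \<sigma> (j + 1)"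
proof -
  obtain y :: "'k vec" where y: "proj_point x = proj_point y" "y \<in> carrier_vec (N + 1)"
    "vec_space.rank 2 (scroll_matrix m (\<lambda>j. y $ \<sigma> j)) < 2"
    using mem by (auto simp: scroll_def)
  have "x \<in> proj_point x" by (auto simp: proj_point_def intro!: exI[of _ 1])
  then obtain c where c: "x = c \<cdot>\<^sub>v y" using y by (auto simp: proj_point_def)
  obtain i i' where i: "i < sum_list m" "scroll_cols m ! i = j" "i' < sum_list m" "scroll_cols m ! i' = j'"
    using j by (auto simp: in_set_conv_nth length_scroll_cols)
  have "y $ \<sigma> j * y $ \<sigma> (j' + 1) = y $ \<sigma> j' * y $ \<sigma> (j + 1)"
    using rank_2_minor[OF scroll_matrix_carrier y(3) i(1,3)] i by (simp add: scroll_matrix_def)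
  moreover have "\<sigma> k < N + 1" if "k < N + 1" for k
    using permutes_in_image[OF \<sigma>, of k] that by simp
  then have "x $ \<sigma> k = c * y $ \<sigma> k" if "k < N + 1" for k
    using y(2) that by (simp add: c)
  moreover have "j < N + 1" "j' < N + 1" "j + 1 < N + 1" "j' + 1 < N + 1"
    using scroll_cols_less[OF j(1)] scroll_cols_less[OF j(2)] N by simp_all
  ultimately show ?thesis by simp
qed

text \<open>A chain of k coordinates fills a block with k - 1 columns, since its last coordinate
  heads no column; a single element gives an empty block. So no column joins two different
  chains.\<close>

lemma scroll_cols_chains:
  assumes "\<And>cs. cs \<in> set css \<Longrightarrow> cs \<noteq> [] \<and> successively R cs"
    and "j \<in> set (scroll_cols (map (\<lambda>cs. length cs - 1) css))"
  shows "R (concat css ! j) (concat css ! (j + 1))"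
  using assms
proof (induction css rule: rev_induct)
  case (snoc cs css)
  let ?m = "map (\<lambda>cs. length cs - 1) css"
  have len: "sum_list ?m + length ?m = length (concat css)"
    using snoc.prems(1)
  proof (induction css)
    case (Cons a css)
    then have "length a \<ge> 1" by (cases a) auto
    then show ?case using Cons by simp
  qed simp
  have "j \<in> set (scroll_cols ?m) \<or> j \<in> (\<lambda>r. length (concat css) + r) ` {0..<length cs - 1}"
    using snoc.prems(2)
    by (simp only: map_append list.map scroll_cols_snoc set_append set_map set_upt Un_iff len)
  then consider "j \<in> set (scroll_cols ?m)" | "j \<in> (\<lambda>r. length (concat css) + r) ` {0..<length cs - 1}"
    by blast
  then show ?case
  proof cases
    case 1
    then have "j + 1 < length (concat css)" using scroll_cols_less len by metis
    moreover have "R (concat css ! j) (concat css ! (j + 1))"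
      using snoc.IH snoc.prems(1) 1 by simp
    ultimately show ?thesis by (simp add: nth_append)
  next
    case 2
    then obtain r where "j = length (concat css) + r" "r \<in> {0..<length cs - 1}" by (rule imageE)
    then have r: "r < length cs - 1" "j = length (concat css) + r" by simp_all
    have "successively R cs" using snoc.prems(1) by simp
    then have "R (cs ! r) (cs ! Suc r)" using r(1) by (simp add: successively_conv_nth)
    then show ?thesis using r by (simp add: nth_append)
  qed
qed simp

lemma successively_mono_last:
  fixes f :: "'a \<Rightarrow> nat"
  assumes "successively (\<lambda>i j. f j = f i + \<delta>) cs" "cs \<noteq> []"
  shows "f (hd cs) \<le> f (last cs)"
  using assms by (induction cs rule: induct_list012) auto

lemma distinct_if_mset_set: "mset xs = mset_set (I :: nat set) \<Longrightarrow> distinct xs"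
  by (metis mset_eq_imp_distinct_iff distinct_sorted_list_of_set sorted_list_of_mset_set
      mset_sorted_list_of_multiset)

text \<open>Starting from one-element chains, two chains can be merged as long as there are more
  chains than elements without successor.\<close>

lemma chain_partition:
  assumes inj: "inj_on b I" and fin: "finite (I :: nat set)" and \<delta>: "\<delta> > (0 :: nat)"
    and k: "card {i \<in> I. b i + \<delta> \<notin> b ` I} \<le> k" "k \<le> card I"
  shows "\<exists>css. length css = k \<and> (\<forall>cs\<in>set css. cs \<noteq> [] \<and> successively (\<lambda>i j. b j = b i + \<delta>) cs) \<and>
    mset (concat css) = mset_set I"
  using k(2,1)
proof (induction k rule: inc_induct)
  case base
  let ?css = "map (\<lambda>i. [i]) (sorted_list_of_set I)"
  have "concat ?css = sorted_list_of_set I" by (induction "sorted_list_of_set I") auto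
  then have "mset (concat ?css) = mset_set I"
    by (metis sorted_list_of_mset_set mset_sorted_list_of_multiset)
  then show ?case by (intro exI[of _ ?css]) auto
next
  case (step k)
  let ?R = "\<lambda>i j. b j = b i + \<delta>"
  have "card {i \<in> I. b i + \<delta> \<notin> b ` I} \<le> Suc k" using step by simp
  then obtain css where css: "length css = Suc k"
    "\<And>cs. cs \<in> set css \<Longrightarrow> cs \<noteq> [] \<and> successively ?R cs" "mset (concat css) = mset_set I"
    using step.IH by blast
  have "[] \<notin> set css" using css(2) by blast
  then have "removeAll [] css = css" by simp
  moreover have "distinct (concat css)"
    using distinct_if_mset_set[OF css(3)] .
  ultimately have dist: "distinct css" "\<And>cs. cs \<in> set css \<Longrightarrow> distinct cs"
    "\<And>cs ds. cs \<in> set css \<Longrightarrow> ds \<in> set css \<Longrightarrow> cs \<noteq> ds \<Longrightarrow> set cs \<inter> set ds = {}"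
    by (auto simp: distinct_concat_iff)
  have un: "\<Union>(set ` set css) = I"
    using arg_cong[OF css(3), of set_mset] fin by simp
  have "inj_on last (set css)"
  proof (rule inj_onI)
    fix cs ds assume "cs \<in> set css" "ds \<in> set css" "last cs = last ds"
    then show "cs = ds" using dist(3)[of cs ds] css(2) by (metis disjoint_iff last_in_set)
  qed
  \<comment> \<open>There are \<open>Suc k\<close> different last elements but at most
    \<open>k\<close> elements without successor, so some chain can be continued.\<close>
  then have "card (last ` set css) = Suc k" using dist(1) css(1) by (simp add: card_image distinct_card)
  moreover have "card {i \<in> I. b i + \<delta> \<notin> b ` I} < Suc k" using step by simp
  ultimately have "\<not> last ` set css \<subseteq> {i \<in> I. b i + \<delta> \<notin> b ` I}"
    using card_mono[of "{i \<in> I. b i + \<delta> \<notin> b ` I}" "last ` set css"] fin by auto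
  then obtain cs where cs: "cs \<in> set css" "last cs \<in> I" "b (last cs) + \<delta> \<in> b ` I"
    using css(2) un last_in_set by fastforce
  then obtain j where j: "j \<in> I" "b j = b (last cs) + \<delta>" by auto
  obtain ds where ds: "ds \<in> set css" "j \<in> set ds" using j(1) un by blast
  \<comment> \<open>If j were not first in its chain \<open>ds\<close>, its predecessor there would
    be \<open>last cs\<close> by injectivity of \<open>b\<close>; then ds = cs, and the last element
    would occur before the end.\<close>
  have hd: "hd ds = j"
  proof (rule ccontr)
    assume "hd ds \<noteq> j"
    obtain r where r: "r < length ds" "ds ! r = j" using ds(2) by (auto simp: in_set_conv_nth)
    have "r \<noteq> 0" using r \<open>hd ds \<noteq> j\<close> by (metis hd_conv_nth length_greater_0_conv less_zeroE list.size(3))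
    then obtain q where q: "r = Suc q" by (cases r) auto
    then have "b j = b (ds ! q) + \<delta>" using css(2)[OF ds(1)] r by (auto simp: successively_conv_nth)
    moreover have qI: "ds ! q \<in> I" using un ds(1) r q by (metis UN_I Suc_lessD nth_mem)
    ultimately have eq: "ds ! q = last cs" using j inj cs(2) by (simp add: inj_on_eq_iff)
    then have "ds = cs"
      using dist(3)[OF ds(1) cs(1)] css(2)[OF cs(1)] r q by (metis Suc_lessD disjoint_iff last_in_set nth_mem)
    then have "ds ! q = ds ! (length ds - 1)" using eq css(2)[OF ds(1)] by (simp add: last_conv_nth)
    then show False using dist(2)[OF ds(1)] r q by (simp add: nth_eq_iff_index_eq)
  qed
  \<comment> \<open>A chain is never merged with itself, as \<open>b\<close> increases along it by
    \<delta> > 0.\<close>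
  have neq: "cs \<noteq> ds"
    using successively_mono_last[of b \<delta> cs] css(2)[OF cs(1)] j(2) \<delta> hd by force
  define rest where "rest = remove1 ds (remove1 cs css)"
  have "ds \<in># mset css - {#cs#}"
    using ds(1) neq by (simp add: in_diff_count count_greater_zero_iff)
  then have "mset css - {#cs#} = add_mset ds (mset css - {#cs#} - {#ds#})" by (simp only: insert_DiffM)
  moreover have "mset css = add_mset cs (mset css - {#cs#})" using cs(1) by (simp only: insert_DiffM set_mset_mset)
  moreover have "mset rest = mset css - {#cs#} - {#ds#}" by (simp only: rest_def mset_remove1)
  ultimately have ms: "mset css = add_mset cs (add_mset ds (mset rest))" by metis
  have sub: "set rest \<subseteq> set css" unfolding rest_def by (meson notin_set_remove1 subsetI)
  have "mset (concat ((cs @ ds) # rest)) = sum_mset (image_mset mset (mset css))"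
    unfolding ms by (simp add: mset_concat flip: sum_mset_sum_list)
  also have "\<dots> = mset_set I" using css(3) by (simp add: mset_concat flip: sum_mset_sum_list)
  finally have "mset (concat ((cs @ ds) # rest)) = mset_set I" .
  moreover have "length ((cs @ ds) # rest) = k"
    using arg_cong[OF ms, of size] css(1) by simp
  moreover have "successively ?R (cs @ ds)"
    using css(2)[OF cs(1)] css(2)[OF ds(1)] hd j(2) by (simp add: successively_append_iff)
  then have "\<forall>es\<in>set ((cs @ ds) # rest). es \<noteq> [] \<and> successively ?R es"
    using css(2) sub cs(1) by auto
  ultimately show ?case by blast
qed

text \<open>If the exponents in each column differ by \<delta>, then s^\<delta> times the second row
  is t^\<delta> times the first. So a partition of the coordinates into \<open>d\<close> chains
  determines the blocks and the reordering, and \<open>d\<close> \<le> \<open>N\<close> leaves at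
  least one column.\<close>

lemma monomial_curve_on_scroll:
  assumes mono: "monomial_exponents N b" and d: "1 \<le> d" "d \<le> N" and \<delta>: "\<delta> > 0"
    and chains: "chain_number (b ` {..N}) \<delta> \<le> d"
  shows "lies_on_scroll d N (monomial_points N b :: 'k::field vec set set)"
proof -
  have b0: "b 0 = 0" and sm: "strict_mono_on {..N} b" using mono by (auto simp: monomial_exponents_def)
  have inj: "inj_on b {..N}" using sm by (rule strict_mono_on_imp_inj_on)
  have le: "b i \<le> b N" if "i \<le> N" for i
    using strict_mono_onD[OF sm, of i N] that by (cases "i = N") auto
  let ?ends = "{i \<in> {..N}. b i + \<delta> \<notin> b ` {..N}}"
  have "{l \<in> b ` {..N}. l + \<delta> \<notin> b ` {..N}} = b ` ?ends" by auto
  moreover have "card (b ` ?ends) = card ?ends"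
    by (rule card_image, rule inj_on_subset[OF inj]) auto
  ultimately have "card ?ends \<le> d" using chains unfolding chain_number_def by simp
  then obtain css where css: "length css = d"
    "\<And>cs. cs \<in> set css \<Longrightarrow> cs \<noteq> [] \<and> successively (\<lambda>i j. b j = b i + \<delta>) cs"
    "mset (concat css) = mset_set {..N}"
    using chain_partition[OF inj _ \<delta>, of d] d by auto
  define m where "m = map (\<lambda>cs. length cs - 1) css"
  define xs where "xs = concat css"
  have xs: "set xs = {..N}" "distinct xs" "length xs = N + 1"
  proof -
    show "set xs = {..N}" using arg_cong[OF css(3), of set_mset] by (simp add: xs_def)
    show "distinct xs" unfolding xs_def
      using distinct_if_mset_set[OF css(3)] .
    show "length xs = N + 1" using arg_cong[OF css(3), of size] by (simp add: xs_def)
  qed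
  have lm: "length m = d" by (simp add: m_def css)
  have sm_len: "sum_list m + length m = N + 1"
  proof -
    have "sum_list (map (\<lambda>cs. length cs - 1) css) + length css = length (concat css)"
      using css(2)
    proof (induction css)
      case (Cons a css)
      then have "length a \<ge> 1" by (cases a) auto
      then show ?case using Cons by simp
    qed simp
    then show ?thesis using xs(3) by (simp add: m_def xs_def)
  qed
  \<comment> \<open>The coordinates in the order in which the chains list them, fixed beyond
    \<open>N\<close> as \<open>permutes\<close> demands.\<close>
  define \<sigma> where "\<sigma> j = (if j \<le> N then xs ! j else j)" for j
  have "bij_betw \<sigma> {..N} {..N}"
  proof -
    have "bij_betw (\<lambda>j. xs ! j) {..<length xs} (set xs)" using xs by (intro bij_betw_nth) auto
    moreover have "{..<length xs} = {..N}" by (simp add: xs(3) lessThan_Suc_atMost)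
    ultimately have "bij_betw (\<lambda>j. xs ! j) {..N} {..N}" using xs(1) by simp
    then show ?thesis by (subst bij_betw_cong[of _ \<sigma> "\<lambda>j. xs ! j"]) (simp_all add: \<sigma>_def)
  qed
  then have perm: "\<sigma> permutes {..N}" by (rule bij_imp_permutes) (simp add: \<sigma>_def)
  have step: "b (\<sigma> (j + 1)) = b (\<sigma> j) + \<delta>" "\<sigma> (j + 1) \<le> N" "\<sigma> j \<le> N"
    if "j \<in> set (scroll_cols m)" for j
  proof -
    have jN: "j + 1 \<le> N" using scroll_cols_less[OF that] sm_len by simp
    then show "b (\<sigma> (j + 1)) = b (\<sigma> j) + \<delta>"
      using scroll_cols_chains[of css "\<lambda>i j. b j = b i + \<delta>" j] css(2) that
      by (simp add: \<sigma>_def m_def xs_def)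
    show "\<sigma> (j + 1) \<le> N" "\<sigma> j \<le> N"
      using permutes_in_image[OF perm, of "j + 1"] permutes_in_image[OF perm, of j] jN by auto
  qed
  have "(monomial_points N b :: 'k vec set set) \<subseteq> scroll N m \<sigma>"
  proof
    fix Q :: "'k vec set" assume "Q \<in> monomial_points N b"
    then obtain s t where Q: "Q = proj_point (vec (N + 1) (\<lambda>i. t ^ b i * s ^ (b N - b i)))"
      and st: "(s, t) \<noteq> (0, 0)" by (auto simp: monomial_points_def)
    let ?x = "vec (N + 1) (\<lambda>i. t ^ b i * s ^ (b N - b i))"
    have "?x \<noteq> 0\<^sub>v (N + 1)"
    proof
      assume z: "?x = 0\<^sub>v (N + 1)"
      have "?x $ 0 = 0" "?x $ N = 0" unfolding z by simp_all
      then show False using st b0 by simp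
    qed
    moreover have "vec_space.rank 2 (scroll_matrix m (\<lambda>j. ?x $ \<sigma> j)) < 2"
    proof (rule rank_less_2[OF scroll_matrix_carrier])
      show "s ^ \<delta> \<noteq> 0 \<or> t ^ \<delta> \<noteq> 0" using st by auto
      fix i assume i: "i < sum_list m"
      let ?j = "scroll_cols m ! i"
      have "?j \<in> set (scroll_cols m)" using i by (simp add: length_scroll_cols)
      note st = step[OF this]
      have "b N - b (\<sigma> ?j) = (b N - b (\<sigma> (?j + 1))) + \<delta>" using st(1) le[OF st(2)] by simp
      then have "s ^ \<delta> * ?x $ \<sigma> (?j + 1) = t ^ \<delta> * ?x $ \<sigma> ?j"
        using st by (simp add: power_add)
      then show "s ^ \<delta> * scroll_matrix m (\<lambda>j. ?x $ \<sigma> j) $$ (1, i) =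
          t ^ \<delta> * scroll_matrix m (\<lambda>j. ?x $ \<sigma> j) $$ (0, i)"
        using i by (simp add: scroll_matrix_def)
    qed
    ultimately show "Q \<in> scroll N m \<sigma>" unfolding scroll_def Q
      by (intro CollectI exI[of _ ?x] conjI refl vec_carrier)
  qed
  then show ?thesis
    unfolding lies_on_scroll_def using lm sm_len d perm
    by (intro exI[of _ m] exI[of _ \<sigma>]) simp
qed

section \<open>Multipliers of a space of functions and shifts of its valuations\<close>

context rf_valuation
begin

lemma values_span:
  assumes "finite C" "C \<subseteq> K" "0 \<notin> C" "inj_on v C"
  shows "v ` (rf.span C - {0}) = v ` C"
proof
  show "v ` (rf.span C - {0}) \<subseteq> v ` C"
    using distinct_values[OF assms] by (auto simp: rf.span_finite[OF assms(1)])
  show "v ` C \<subseteq> v ` (rf.span C - {0})"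
    using assms(3) rf.span_base by (intro image_mono) blast
qed

text \<open>Subtracting a constant from a multiplier \<open>x\<close> does not change \<open>V + x V\<close>, but makes its
  valuation nonzero.\<close>

lemma multiplier_values:
  assumes C: "finite C" "C \<subseteq> K" "0 \<notin> C" "inj_on v C"
    and x: "x \<in> K" "\<And>a. x \<noteq> const_rf a"
    and B: "finite B" "\<And>z. z \<in> rf.span C \<Longrightarrow> x * z \<in> rf.span (B \<union> C)"
  obtains \<delta> where "\<delta> \<noteq> 0" "card ((\<lambda>n. n + \<delta>) ` v ` C - v ` C) \<le> card B"
proof -
  obtain a where a: "x - const_rf a \<noteq> 0" "v (x - const_rf a) \<noteq> 0"
  proof (cases "v x = 0")
    case True
    then have "at_least v 0 x" by (simp add: at_least_def)
    then obtain a where "at_least v 1 (x - const_rf a)" using v_residue[OF x(1)] by blast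
    moreover have "x - const_rf a \<noteq> 0" using x(2)[of a] by simp
    ultimately show ?thesis using that[of a] by (auto simp: at_least_def)
  next
    case False
    then show ?thesis using that[of 0] x(2)[of 0] by simp
  qed
  let ?y = "x - const_rf a"
  have y: "?y \<in> K" using x(1) by simp
  have "?y * z \<in> rf.span (B \<union> C)" if "z \<in> rf.span C" for z
  proof -
    have "scale_rf a z \<in> rf.span (B \<union> C)"
      using that rf.span_mono[of C "B \<union> C"] by (auto intro: rf.span_scale)
    then have "x * z - scale_rf a z \<in> rf.span (B \<union> C)" using B(2)[OF that] by (rule rf.span_diff[rotated])
    then show ?thesis by (simp add: scale_rf_def left_diff_distrib)
  qed
  then have "(*) ?y ` C \<subseteq> rf.span (B \<union> C)" using rf.span_base by blast
  also have "\<dots> \<subseteq> rf.span (B \<union> rf.span C)" using rf.span_superset by (intro rf.span_mono) blast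
  finally have M: "(*) ?y ` C \<subseteq> rf.span (B \<union> rf.span C)" .
  have MK: "(*) ?y ` C \<subseteq> K" using y C(2) by auto
  note le = card_values_le[OF rf.subspace_span MK B(1) M]
  have "(\<lambda>n. n + v ?y) ` v ` C = v ` ((*) ?y ` C - {0})"
  proof -
    have "(*) ?y ` C - {0} = (*) ?y ` C" using a(1) C(3) by auto
    moreover have "v (?y * z) = v z + v ?y" if "z \<in> C" for z
      using that C y a(1) by (subst v_mult) auto
    ultimately show ?thesis by (auto simp: image_image)
  qed
  then show ?thesis using that[OF a(2)] le(2) values_span[OF C] by simp
qed

end

text \<open>Over a finite field, 1 plus the product of all t - a has no root.\<close>

lemma infinite_UNIV_alg_closed: "infinite (UNIV :: 'k::alg_closed_field set)"
proof
  assume fin: "finite (UNIV :: 'k set)"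
  define q :: "'k poly" where "q = (\<Prod>a\<in>UNIV. [:- a, 1:])"
  have deg: "degree q = card (UNIV :: 'k set)" unfolding q_def by (subst degree_prod_eq_sum_degree) auto
  have "card (UNIV :: 'k set) > 0" using fin by (simp add: card_gt_0_iff)
  then have "degree (q + 1) > 0" using deg by (subst degree_add_eq_left) auto
  then obtain z where "poly (q + 1) z = 0" using alg_closed_imp_poly_has_root by blast
  moreover have "poly q z = 0" using fin by (auto simp: q_def poly_prod)
  ultimately show False by simp
qed

lemma poly_eq_nonzero_points:
  fixes p q :: "'k::alg_closed_field poly"
  assumes "\<And>z. z \<noteq> 0 \<Longrightarrow> poly p z = poly q z"
  shows "p = q"
proof (rule ccontr)
  assume "p \<noteq> q"
  then have "finite {z. poly (p - q) z = 0}" by (intro poly_roots_finite) simp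
  moreover have "UNIV - {0} \<subseteq> {z. poly (p - q) z = 0}" using assms by auto
  ultimately have "finite (UNIV - {0 :: 'k})" by (rule finite_subset[rotated])
  then show False using infinite_UNIV_alg_closed[where 'k='k] by simp
qed

text \<open>The differences of F + d and of F - d with a finite set F both have |F| - |F \<inter> (F
  + d)| elements, so the sign of the shift is immaterial. Negative shifts do occur, since a
  multiplier may have a pole.\<close>

lemma card_shift_eq_chain_number:
  fixes L :: "nat set"
  assumes "finite L" "\<delta> \<noteq> 0"
  shows "card ((\<lambda>n. n + \<delta>) ` int ` L - int ` L) = chain_number L (nat \<bar>\<delta>\<bar>)"
proof -
  have pos: "card ((\<lambda>n. n + int k) ` int ` L - int ` L) = chain_number L k" for k
  proof -
    have "(\<lambda>n. n + int k) ` int ` L - int ` L = (\<lambda>l. int l + int k) ` {l \<in> L. l + k \<notin> L}"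
    proof (intro Set.set_eqI iffI)
      fix n assume "n \<in> (\<lambda>n. n + int k) ` int ` L - int ` L"
      then obtain l where l: "l \<in> L" "n = int l + int k" "n \<notin> int ` L" by auto
      then have "n = int (l + k)" by simp
      then have "l + k \<notin> L" using l(3) by blast
      then show "n \<in> (\<lambda>l. int l + int k) ` {l \<in> L. l + k \<notin> L}" using l by blast
    next
      fix n assume "n \<in> (\<lambda>l. int l + int k) ` {l \<in> L. l + k \<notin> L}"
      then obtain l where l: "l \<in> L" "l + k \<notin> L" "n = int l + int k" by auto
      then have "n = int (l + k)" by simp
      then have "n \<notin> int ` L" using l(2) by (auto simp del: of_nat_add)
      then show "n \<in> (\<lambda>n. n + int k) ` int ` L - int ` L" using l by auto
    qed
    then show ?thesis by (simp add: chain_number_def card_image inj_on_def)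
  qed
  have neg: "card ((\<lambda>n. n - d) ` F - F) = card ((\<lambda>n. n + d) ` F - F)" if "finite F" for F :: "int set" and d
  proof -
    have "(\<lambda>n. n + d) ` ((\<lambda>n. n - d) ` F \<inter> F) = F \<inter> (\<lambda>n. n + d) ` F"
    proof (intro Set.set_eqI iffI)
      fix n assume "n \<in> F \<inter> (\<lambda>n. n + d) ` F"
      then have "n \<in> F" "n - d \<in> F" by auto
      then show "n \<in> (\<lambda>n. n + d) ` ((\<lambda>n. n - d) ` F \<inter> F)"
        by (intro image_eqI[of _ _ "n - d"]) auto
    qed auto
    moreover have "inj_on (\<lambda>n. n + d) S" for S by (simp add: inj_on_def)
    ultimately have eq: "card ((\<lambda>n. n - d) ` F \<inter> F) = card ((\<lambda>n. n + d) ` F \<inter> F)"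
      by (metis card_image Int_commute)
    have "card ((\<lambda>n. n - d) ` F) = card F" "card ((\<lambda>n. n + d) ` F) = card F"
      by (simp_all add: card_image inj_on_def)
    then show ?thesis using eq that by (simp add: card_Diff_subset_Int)
  qed
  show ?thesis
  proof (cases "\<delta> \<ge> 0")
    case True
    then show ?thesis using pos[of "nat \<delta>"] by simp
  next
    case False
    then have "(\<lambda>n. n + \<delta>) ` int ` L = (\<lambda>n. n - int (nat (- \<delta>))) ` int ` L" by simp
    then show ?thesis using neg[of "int ` L" "int (nat (- \<delta>))"] pos[of "nat (- \<delta>)"] assms False by simp
  qed
qed

section \<open>Two bases of the sections of \<omega> and their relation\<close>

lemma mem_proj_point: "x \<in> proj_point x"
  by (auto simp: proj_point_def intro!: exI[of _ 1])

text \<open>A binomial equation of the monomial curve between the coordinates with exponents 0, l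
  and m; both sides have degree m, so a common factor c is allowed.\<close>

lemma monomial_identity:
  fixes c s t :: "'a::comm_ring_1"
  assumes "l \<le> m" "m \<le> n"
  shows "(c * (t ^ m * s ^ (n - m))) ^ l * (c * (t ^ 0 * s ^ (n - 0))) ^ (m - l) =
    (c * (t ^ l * s ^ (n - l))) ^ m"
proof -
  obtain q where m: "m = l + q" using assms le_Suc_ex by blast
  obtain r where n: "n = l + q + r" using assms le_Suc_ex m by metis
  have e: "r * l + (l + q + r) * q = (q + r) * (l + q)" "(l + q) * l = l * (l + q)"
    by (simp_all add: algebra_simps)
  have "n - m = r" "n - 0 = l + q + r" "m - l = q" "n - l = q + r" by (simp_all add: m n)
  then have "(c * (t ^ m * s ^ (n - m))) ^ l * (c * (t ^ 0 * s ^ (n - 0))) ^ (m - l) =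
      (c ^ l * c ^ q) * t ^ ((l + q) * l) * (s ^ (r * l) * s ^ ((l + q + r) * q))"
    by (simp add: m power_mult_distrib ac_simps flip: power_mult)
  also have "\<dots> = c ^ (l + q) * t ^ (l * (l + q)) * s ^ ((q + r) * (l + q))"
    by (simp only: e flip: power_add)
  also have "\<dots> = (c * (t ^ l * s ^ (n - l))) ^ m"
    using \<open>n - l = q + r\<close> by (simp add: m power_mult_distrib mult.assoc flip: power_mult)
  finally show ?thesis .
qed

text \<open>The sections of \<omega>, made polynomial by a common factor, with two bases: the
  monomials t^e, where \<open>E\<close> arises from the gaps, and the \<open>p i\<close>, whose
  values are points of the canonical model. The point z = 0 is left out because all
  \<open>p i\<close> may vanish there.\<close>

locale monomial_coordinates =
  fixes E :: "nat set" and p :: "nat \<Rightarrow> 'k::alg_closed_field poly" and g d :: nat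
    and Z :: "'k vec set set"
  assumes finite_E: "finite E"
    and inj_p: "inj_on (\<lambda>i. to_fract (p i)) {..<g}"
    and independent_p: "rf.independent ((\<lambda>i. to_fract (p i)) ` {..<g})"
    and span_p: "rf.span ((\<lambda>i. to_fract (p i)) ` {..<g}) = rf.span ((\<lambda>e. var_rf ^ e) ` E)"
    and points_Z: "z \<noteq> 0 \<Longrightarrow> proj_point (vec g (\<lambda>i. poly (p i) z)) \<in> Z"
    and d: "1 \<le> d" "d < g"
begin

abbreviation "P i \<equiv> to_fract (p i)"

lemma P_nonzero: "i < g \<Longrightarrow> P i \<noteq> 0"
  using independent_p rf.dependent_zero by (metis imageI lessThan_iff)

lemma not_proportional:
  assumes "i < g" "j < g" "i \<noteq> j"
  shows "P i \<noteq> scale_rf a (P j)"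
proof
  assume "P i = scale_rf a (P j)"
  moreover have "P j \<in> P ` {..<g} - {P i}"
    using assms inj_p by (auto simp: inj_on_def)
  ultimately have "P i \<in> rf.span (P ` {..<g} - {P i})" by (metis rf.span_base rf.span_scale)
  then show False using independent_p assms by (auto simp: rf.dependent_def)
qed

lemma monomials_E:
  shows "finite ((\<lambda>e. var_rf ^ e) ` E)" "0 \<notin> (\<lambda>e. var_rf ^ e) ` E"
    "inj_on (ord_at 0) ((\<lambda>e. (var_rf :: 'k ratfun) ^ e) ` E)"
    "ord_at 0 ` (\<lambda>e. (var_rf :: 'k ratfun) ^ e) ` E = int ` E"
proof -
  have v: "ord_at 0 ((var_rf :: 'k ratfun) ^ e) = int e" for e
    by (simp add: ord_at.v_power ord_at_var)
  show "finite ((\<lambda>e. var_rf ^ e) ` E)" using finite_E by simp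
  show "0 \<notin> (\<lambda>e. var_rf ^ e) ` E" by auto
  show "inj_on (ord_at 0) ((\<lambda>e. (var_rf :: 'k ratfun) ^ e) ` E)" by (rule inj_onI) (auto simp: v)
  show "ord_at 0 ` (\<lambda>e. (var_rf :: 'k ratfun) ^ e) ` E = int ` E" by (simp add: image_image v)
qed

text \<open>The minors vanish at infinitely many points, hence as polynomials, and the two rows have
  a common quotient \<open>x\<close>. Multiplication by \<open>x\<close> sends the coordinates of
  the first row into the span, and the other ones produce \<open>B\<close>. This bound is
  independent of the basis and is evaluated on the monomials by the order at 0.\<close>

lemma scroll_imp_chain:
  assumes "lies_on_scroll d (g - 1) Z"
  shows "\<exists>\<delta>>0. chain_number E \<delta> \<le> d"
proof -
  obtain m \<sigma> where m: "length m = d" "sum_list m \<ge> 1" "g - 1 = sum_list m + d - 1"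
    and \<sigma>: "\<sigma> permutes {..g - 1}" and sub: "Z \<subseteq> scroll (g - 1) m \<sigma>"
    using assms unfolding lies_on_scroll_def by blast
  have sum: "sum_list m + length m = g - 1 + 1" using m d by simp
  define J where "J = set (scroll_cols m)"
  have card_J: "card J = sum_list m"
    unfolding J_def by (simp add: distinct_card distinct_scroll_cols length_scroll_cols)
  have J: "j + 1 < g" if "j \<in> J" for j
    using scroll_cols_less[of j m] that sum d by (simp add: J_def)
  have \<sigma>g: "\<sigma> j < g \<longleftrightarrow> j < g" for j
    using permutes_in_image[OF \<sigma>, of j] d by auto
  have minor: "p (\<sigma> j) * p (\<sigma> (j' + 1)) = p (\<sigma> j') * p (\<sigma> (j + 1))" if j: "j \<in> J" "j' \<in> J" for j j'
  proof (rule poly_eq_nonzero_points)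
    fix z :: 'k assume "z \<noteq> 0"
    then have "proj_point (vec g (\<lambda>i. poly (p i) z)) \<in> scroll (g - 1) m \<sigma>" using points_Z sub by blast
    from scroll_minor[OF _ this \<sigma> sum, of j j'] j
    have "vec g (\<lambda>i. poly (p i) z) $ \<sigma> j * vec g (\<lambda>i. poly (p i) z) $ \<sigma> (j' + 1) =
        vec g (\<lambda>i. poly (p i) z) $ \<sigma> j' * vec g (\<lambda>i. poly (p i) z) $ \<sigma> (j + 1)"
      using d by (simp add: J_def)
    moreover have "\<sigma> j < g" "\<sigma> j' < g" "\<sigma> (j + 1) < g" "\<sigma> (j' + 1) < g"
      using J[OF j(1)] J[OF j(2)] by (simp_all add: \<sigma>g)
    ultimately show "poly (p (\<sigma> j) * p (\<sigma> (j' + 1))) z = poly (p (\<sigma> j') * p (\<sigma> (j + 1))) z" by simp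
  qed
  have "J \<noteq> {}" using card_J m(2) by (metis card.empty not_one_le_zero)
  then obtain j0 where j0: "j0 \<in> J" by blast
  have lt: "\<sigma> j0 < g" "\<sigma> (j0 + 1) < g" using J[OF j0] by (simp_all add: \<sigma>g)
  define x where "x = P (\<sigma> (j0 + 1)) / P (\<sigma> j0)"
  have xP: "x * P (\<sigma> j) = P (\<sigma> (j + 1))" if "j \<in> J" for j
  proof -
    have "P (\<sigma> j) * P (\<sigma> (j0 + 1)) = P (\<sigma> j0) * P (\<sigma> (j + 1))"
      using arg_cong[OF minor[OF that j0], of to_fract] by simp
    then show ?thesis using P_nonzero[OF lt(1)] by (simp add: x_def field_simps)
  qed
  have "\<sigma> (j0 + 1) \<noteq> \<sigma> j0" using permutes_inj[OF \<sigma>] by (simp add: inj_eq)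
  have nonconst: "x \<noteq> const_rf a" for a
  proof
    assume "x = const_rf a"
    then have "P (\<sigma> (j0 + 1)) = scale_rf a (P (\<sigma> j0))"
      using xP[OF j0] by (simp add: scale_rf_def)
    then show False using not_proportional lt \<open>\<sigma> (j0 + 1) \<noteq> \<sigma> j0\<close> by blast
  qed
  define B where "B = (\<lambda>i. x * P i) ` ({..<g} - \<sigma> ` J)"
  have "card (\<sigma> ` J) = sum_list m"
    using card_J permutes_inj[OF \<sigma>] by (metis card_image inj_on_subset subset_UNIV)
  moreover have "\<sigma> j < g" if "j \<in> J" for j using J[OF that] by (simp add: \<sigma>g)
  then have "\<sigma> ` J \<subseteq> {..<g}" by auto
  \<comment> \<open>There are \<open>sum_list m\<close> columns and \<open>sum_list m + d\<close>
    coordinates.\<close>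
  ultimately have "card ({..<g} - \<sigma> ` J) = d"
    using sum m(1) d by (subst card_Diff_subset) (auto intro: finite_subset)
  then have B: "finite B" "card B \<le> d"
    unfolding B_def by (auto intro: card_image_le[THEN order_trans])
  have "x * P i \<in> rf.span (B \<union> P ` {..<g})" if i: "i < g" for i
  proof (cases "i \<in> \<sigma> ` J")
    case True
    then obtain j where j: "j \<in> J" "i = \<sigma> j" by blast
    have "\<sigma> (j + 1) < g" using J[OF j(1)] by (simp add: \<sigma>g)
    then show ?thesis using xP[OF j(1)] j(2) by (auto intro: rf.span_base)
  qed (use i in \<open>auto simp: B_def intro: rf.span_base\<close>)
  then have "(*) x ` P ` {..<g} \<subseteq> rf.span (B \<union> P ` {..<g})" by auto
  then have "rf.span ((*) x ` P ` {..<g}) \<subseteq> rf.span (B \<union> P ` {..<g})"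
    by (intro rf.span_minimal) auto
  then have sub1: "(*) x ` rf.span (P ` {..<g}) \<subseteq> rf.span (B \<union> P ` {..<g})"
    unfolding linear_span_image[OF linear_mult_rf] .
  let ?C = "(\<lambda>e. (var_rf :: 'k ratfun) ^ e) ` E"
  have "rf.span (B \<union> P ` {..<g}) \<subseteq> rf.span (B \<union> ?C)"
  proof (intro rf.span_minimal rf.subspace_span Un_least)
    have "P ` {..<g} \<subseteq> rf.span ?C" unfolding span_p[symmetric] by (rule rf.span_superset)
    also have "\<dots> \<subseteq> rf.span (B \<union> ?C)" by (intro rf.span_mono) auto
    finally show "P ` {..<g} \<subseteq> rf.span (B \<union> ?C)" .
  qed (auto intro: rf.span_base)
  then have "x * z \<in> rf.span (B \<union> ?C)" if "z \<in> rf.span ?C" for z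
    using that sub1 unfolding span_p by blast
  from ord_at.multiplier_values[OF monomials_E(1) _ monomials_E(2,3) _ nonconst B(1) this]
  obtain \<delta> where "\<delta> \<noteq> 0" "card ((\<lambda>n. n + \<delta>) ` int ` E - int ` E) \<le> card B"
    by (metis monomials_E(4) UNIV_I subset_UNIV)
  then show ?thesis
    using B(2) finite_E by (intro exI[of _ "nat \<bar>\<delta>\<bar>"]) (simp add: card_shift_eq_chain_number)
qed

text \<open>If all finite orders agreed, P i / P j or its inverse, whichever is regular at infinity,
  would be regular everywhere and therefore constant.\<close>

lemma orders_differ: 
  assumes "i < g" "j < g" "i \<noteq> j"
  shows "\<exists>a. ord_at a (P i) \<noteq> ord_at a (P j)"
proof (rule ccontr)
  assume "\<not> ?thesis"
  then have eq: "ord_at a (P i) = ord_at a (P j)" for a by blast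
  note nz = P_nonzero[OF assms(1)] P_nonzero[OF assms(2)]
  have *: False
    if ij: "i < g" "j < g" "i \<noteq> j" "\<And>a. ord_at a (P i) = ord_at a (P j)" and inf: "ord_inf (P j) \<le> ord_inf (P i)" for i j
  proof -
    note nz = P_nonzero[OF ij(1)] P_nonzero[OF ij(2)]
    have "\<exists>a. P i / P j = const_rf a"
      using nz ij(4) inf by (intro regular_everywhere_const) (auto simp: at_least_def ord_at.v_divide ord_inf.v_divide)
    then obtain a where "P i = scale_rf a (P j)" using nz by (auto simp: scale_rf_def field_simps)
    then show False using not_proportional ij by blast
  qed
  show False
    using *[OF assms eq] *[OF assms(2,1) assms(3)[symmetric] eq[symmetric]] by linarith
qed

text \<open>A priori the exponents \<open>b\<close> are unrelated to \<open>E\<close>. The binomial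
  equations of the curve, valid for all z \<noteq> 0, become identities between the
  \<open>p i\<close>; at a point \<open>a\<close> where p 0 and p 1 have different orders they show
  that the orders are an affine function of \<open>b\<close>. A shift \<delta> of \<open>E\<close>,
  seen as multiplication by t^\<delta>, thus becomes a shift of the orders at \<open>a\<close> and
  then of \<open>b\<close>.\<close>

lemma chain_imp_scroll:
  assumes Z: "Z = monomial_points (g - 1) b" and mono: "monomial_exponents (g - 1) b"
    and \<delta>: "\<delta> > 0" "chain_number E \<delta> \<le> d"
  shows "lies_on_scroll d (g - 1) Z"
proof -
  have b0: "b 0 = 0" and sm: "strict_mono_on {..g - 1} b" using mono by (auto simp: monomial_exponents_def)
  have less: "b i < b j" if "i < j" "j < g" for i j
    using strict_mono_onD[OF sm, of i j] that by auto
  have b1: "b 1 > 0" using less[of 0 1] d b0 by simp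
  have ident: "p i ^ b 1 * p 0 ^ (b i - b 1) = p 1 ^ b i" if i: "1 \<le> i" "i < g" for i
  proof (rule poly_eq_nonzero_points)
    fix z :: 'k assume "z \<noteq> 0"
    then have "proj_point (vec g (\<lambda>i. poly (p i) z)) \<in> monomial_points (g - 1) b" using points_Z Z by blast
    then obtain s t where st: "proj_point (vec g (\<lambda>i. poly (p i) z)) =
        proj_point (vec g (\<lambda>i. t ^ b i * s ^ (b (g - 1) - b i)))"
      using d by (auto simp: monomial_points_def)
    then have "vec g (\<lambda>i. poly (p i) z) \<in> proj_point (vec g (\<lambda>i. t ^ b i * s ^ (b (g - 1) - b i)))"
      using mem_proj_point by metis
    then obtain c where c: "vec g (\<lambda>i. poly (p i) z) = c \<cdot>\<^sub>v vec g (\<lambda>i. t ^ b i * s ^ (b (g - 1) - b i))"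
      by (auto simp: proj_point_def)
    have pz: "poly (p k) z = c * (t ^ b k * s ^ (b (g - 1) - b k))" if "k < g" for k
    proof -
      have "vec g (\<lambda>i. poly (p i) z) $ k = (c \<cdot>\<^sub>v vec g (\<lambda>i. t ^ b i * s ^ (b (g - 1) - b i))) $ k"
        using c by simp
      then show ?thesis using that by simp
    qed
    have "b 1 \<le> b i" using less[of 1 i] i by (cases "i = 1") auto
    moreover have "i = g - 1 \<or> i < g - 1" using i by linarith
    then have "b i \<le> b (g - 1)" using less[of i "g - 1"] i by auto
    moreover have "poly (p 0) z = c * (t ^ 0 * s ^ (b (g - 1) - 0))" using pz[of 0] d b0 by simp
    ultimately show "poly (p i ^ b 1 * p 0 ^ (b i - b 1)) z = poly (p 1 ^ b i) z"
      using monomial_identity[of "b 1" "b i" "b (g - 1)" c t s] pz[of i] pz[of 1] i d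
      by (simp only: poly_mult poly_power)
  qed
  obtain a where a: "ord_at a (P 0) \<noteq> ord_at a (P 1)" using orders_differ[of 0 1] d by auto
  define w where "w i = ord_at a (P i)" for i
  define \<rho> where "\<rho> = w 1 - w 0"
  have \<rho>: "\<rho> \<noteq> 0" using a by (simp add: \<rho>_def w_def)
  \<comment> \<open>The orders at \<open>a\<close> of both sides of the binomial identity.\<close>
  have w: "int (b 1) * (w i - w 0) = int (b i) * \<rho>" if i: "i < g" for i
  proof (cases "i = 0")
    case False
    have nz: "P i \<noteq> 0" "P 0 \<noteq> 0" "P 1 \<noteq> 0" using P_nonzero i d by auto
    have "P i ^ b 1 * P 0 ^ (b i - b 1) = P 1 ^ b i"
      using arg_cong[OF ident[of i], of to_fract] False i by (simp add: to_fract_power)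
    then have "ord_at a (P i ^ b 1 * P 0 ^ (b i - b 1)) = ord_at a (P 1 ^ b i)" by simp
    then have "int (b 1) * w i + int (b i - b 1) * w 0 = int (b i) * w 1"
      using nz by (simp add: ord_at.v_mult ord_at.v_power w_def)
    moreover have "b 1 \<le> b i" using less[of 1 i] i False by (cases "i = 1") auto
    ultimately show ?thesis by (simp add: \<rho>_def algebra_simps of_nat_diff)
  qed (simp add: b0)
  have w_diff: "int (b 1) * (w j - w i) = (int (b j) - int (b i)) * \<rho>" if "i < g" "j < g" for i j
    using w[OF that(1)] w[OF that(2)] by (simp add: algebra_simps)
  have inj_b: "inj_on b {..<g}"
    using sm strict_mono_on_imp_inj_on d by (metis Suc_pred' lessThan_Suc_atMost less_le_trans less_one nat_neq_iff not_less0)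
  have inj_w: "inj_on w {..<g}"
  proof (rule inj_onI)
    fix i j assume "i \<in> {..<g}" "j \<in> {..<g}" "w i = w j"
    then have "b i = b j" using w_diff[of i j] \<rho> by simp
    then show "i = j" using inj_b \<open>i \<in> {..<g}\<close> \<open>j \<in> {..<g}\<close> by (auto dest: inj_onD)
  qed
  let ?C = "P ` {..<g}" and ?D = "(\<lambda>e. (var_rf :: 'k ratfun) ^ e) ` E"
  have C: "finite ?C" "0 \<notin> ?C" "inj_on (ord_at a) ?C" "ord_at a ` ?C = w ` {..<g}"
    using P_nonzero inj_w by (auto simp: inj_on_def w_def image_image)
  \<comment> \<open>Multiplication by t^\<delta> enlarges the span by at most \<open>d\<close>
    dimensions, which is now read in the basis \<open>P i\<close> at \<open>a\<close>.\<close>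
  define x where "x = (var_rf :: 'k ratfun) ^ \<delta>"
  have nonconst: "x \<noteq> const_rf e" for e
  proof
    assume x: "x = const_rf e"
    have "ord_at 0 x = int \<delta>" by (simp add: x_def ord_at.v_power ord_at_var)
    moreover have "x \<noteq> 0" by (simp add: x_def)
    then have "ord_at 0 x = 0" using x ord_at.v_const[of e 0] by auto
    ultimately show False using \<delta>(1) by simp
  qed
  define B where "B = (\<lambda>e. (var_rf :: 'k ratfun) ^ (e + \<delta>)) ` {e \<in> E. e + \<delta> \<notin> E}"
  have finB: "finite B" using finite_E by (simp add: B_def)
  have "card B \<le> card {e \<in> E. e + \<delta> \<notin> E}"
    unfolding B_def using finite_E by (intro card_image_le) simp
  then have B: "finite B" "card B \<le> d" using finB \<delta>(2) by (simp_all add: chain_number_def)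
  have "x * y \<in> rf.span (B \<union> ?D)" if y: "y \<in> ?D" for y
  proof -
    obtain e where e: "e \<in> E" "y = var_rf ^ e" using y by blast
    have "x * y = var_rf ^ (e + \<delta>)" by (simp add: x_def e(2) power_add mult.commute)
    then have "x * y \<in> B \<union> ?D" using e(1) by (cases "e + \<delta> \<in> E") (auto simp only: B_def)
    then show ?thesis by (rule rf.span_base)
  qed
  then have "rf.span ((*) x ` ?D) \<subseteq> rf.span (B \<union> ?D)" by (intro rf.span_minimal) auto
  moreover have "rf.span (B \<union> ?D) \<subseteq> rf.span (B \<union> ?C)"
  proof (intro rf.span_minimal rf.subspace_span Un_least)
    have "?D \<subseteq> rf.span ?C" unfolding span_p by (rule rf.span_superset)
    also have "\<dots> \<subseteq> rf.span (B \<union> ?C)" by (intro rf.span_mono) auto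
    finally show "?D \<subseteq> rf.span (B \<union> ?C)" .
  qed (auto intro: rf.span_base)
  ultimately have "(*) x ` rf.span ?C \<subseteq> rf.span (B \<union> ?C)"
    unfolding span_p linear_span_image[OF linear_mult_rf] by blast
  then have "x * z \<in> rf.span (B \<union> ?C)" if "z \<in> rf.span ?C" for z using that by blast
  from ord_at.multiplier_values[OF C(1) _ C(2,3) _ nonconst B(1) this]
  obtain \<delta>' where \<delta>': "\<delta>' \<noteq> 0" "card ((\<lambda>n. n + \<delta>') ` w ` {..<g} - w ` {..<g}) \<le> card B"
    by (metis C(4) UNIV_I subset_UNIV)
  let ?I = "{i. i < g \<and> w i + \<delta>' \<notin> w ` {..<g}}"
  have "(\<lambda>n. n + \<delta>') ` w ` {..<g} - w ` {..<g} = (\<lambda>i. w i + \<delta>') ` ?I" by auto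
  moreover have "inj_on (\<lambda>i. w i + \<delta>') ?I" using inj_w by (auto simp: inj_on_def)
  ultimately have cardI: "card ?I \<le> d" using \<delta>'(2) B(2) by (simp add: card_image)
  \<comment> \<open>Since \<open>d\<close> < \<open>g\<close>, some order is shifted onto another
    one. Such a pair i0, j0 converts \<delta>' into a shift \<epsilon> of the exponents, which by
    affinity is the same for all pairs.\<close>
  have "?I \<noteq> {..<g}"
  proof
    assume eq: "?I = {..<g}"
    have "card {..<g} \<le> d" using cardI unfolding eq .
    then show False using d by simp
  qed
  then obtain i0 where i0: "i0 < g" "w i0 + \<delta>' \<in> w ` {..<g}" by blast
  then obtain j0 where "j0 < g" "w i0 + \<delta>' = w j0" by auto
  with i0 have ij0: "i0 < g" "j0 < g" "w i0 + \<delta>' = w j0" by simp_all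
  define \<epsilon> where "\<epsilon> = int (b j0) - int (b i0)"
  have step: "int (b j) = int (b i) + \<epsilon>" if "i < g" "j < g" "w i + \<delta>' = w j" for i j
  proof -
    have "w j - w i = \<delta>'" "w j0 - w i0 = \<delta>'" using that(3) ij0(3) by linarith+
    then have "(int (b j) - int (b i)) * \<rho> = \<epsilon> * \<rho>"
      using w_diff[OF that(1,2)] w_diff[OF ij0(1,2)] by (simp only: \<epsilon>_def)
    then show ?thesis using \<rho> by simp
  qed
  have "\<epsilon> \<noteq> 0"
  proof
    assume "\<epsilon> = 0"
    then have "int (b 1) * (w j0 - w i0) = 0" using w_diff[OF ij0(1,2)] by (simp add: \<epsilon>_def)
    then have "w j0 = w i0" using b1 by simp
    then show False using ij0(3) \<delta>'(1) by linarith
  qed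
  have "(\<lambda>n. n + \<epsilon>) ` int ` b ` {..<g} - int ` b ` {..<g} \<subseteq> (\<lambda>i. int (b i) + \<epsilon>) ` ?I"
  proof
    fix n assume n: "n \<in> (\<lambda>n. n + \<epsilon>) ` int ` b ` {..<g} - int ` b ` {..<g}"
    then obtain i where i: "i < g" "n = int (b i) + \<epsilon>" by auto
    have "w i + \<delta>' \<notin> w ` {..<g}"
    proof
      assume "w i + \<delta>' \<in> w ` {..<g}"
      then obtain j where j: "j < g" "w i + \<delta>' = w j" by auto
      then have "n = int (b j)" using step[OF i(1) j] i by simp
      then show False using n j by auto
    qed
    then show "n \<in> (\<lambda>i. int (b i) + \<epsilon>) ` ?I" using i by auto
  qed
  then have "card ((\<lambda>n. n + \<epsilon>) ` int ` b ` {..<g} - int ` b ` {..<g}) \<le> card ((\<lambda>i. int (b i) + \<epsilon>) ` ?I)"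
    by (intro card_mono finite_imageI) simp_all
  also have "\<dots> \<le> card ?I" by (intro card_image_le) simp
  finally have "chain_number (b ` {..<g}) (nat \<bar>\<epsilon>\<bar>) \<le> d"
    using cardI \<open>\<epsilon> \<noteq> 0\<close> by (simp add: card_shift_eq_chain_number)
  moreover have "{..<g} = {..g - 1}" using d by auto
  ultimately show ?thesis
    unfolding Z using \<open>\<epsilon> \<noteq> 0\<close> d by (intro monomial_curve_on_scroll[OF mono, of _ "nat \<bar>\<epsilon>\<bar>"]) auto
qed

end

section \<open>Substitutions in \<open>k(t)\<close>\<close>

definition peval :: "'k::field poly \<Rightarrow> 'k ratfun \<Rightarrow> 'k ratfun" where
  "peval f x = poly (map_poly const_rf f) x"

lemma peval_0 [simp]: "peval 0 x = 0"
  by (simp add: peval_def)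

lemma peval_pCons [simp]: "peval (pCons c f) x = const_rf c + x * peval f x"
  by (simp add: peval_def map_poly_pCons)

lemma peval_1 [simp]: "peval 1 x = 1"
  by (simp add: one_pCons)

lemma peval_add [simp]: "peval (f + g) x = peval f x + peval g x"
  by (induction f g rule: poly_induct2) (simp_all add: algebra_simps)

lemma peval_smult [simp]: "peval (Polynomial.smult c f) x = const_rf c * peval f x"
  by (induction f) (simp_all add: algebra_simps)

lemma peval_mult [simp]: "peval (f * g) x = peval f x * peval g x"
  by (induction f) (simp_all add: algebra_simps)

lemma peval_power [simp]: "peval (f ^ m) x = peval f x ^ m"
  by (induction m) simp_all

lemma peval_sum [simp]: "peval (\<Sum>i\<in>I. f i) x = (\<Sum>i\<in>I. peval (f i) x)"
  by (induction I rule: infinite_finite_induct) simp_all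

lemma peval_monom [simp]: "peval (monom c m) x = const_rf c * x ^ m"
  by (simp add: monom_altdef)

lemma peval_altdef: "peval f x = (\<Sum>i\<le>degree f. const_rf (coeff f i) * x ^ i)"
proof -
  have "peval (\<Sum>i\<le>degree f. monom (coeff f i) i) x = (\<Sum>i\<le>degree f. const_rf (coeff f i) * x ^ i)"
    by simp
  then show ?thesis by (simp only: poly_as_sum_of_monoms)
qed

lemma peval_var: "peval f var_rf = to_fract f"
proof (induction f)
  case (pCons c f)
  have "pCons c f = [:c:] + [:0, 1:] * f" by simp
  then have "to_fract (pCons c f) = to_fract [:c:] + to_fract [:0, 1:] * to_fract f"
    by (simp only: to_fract_add to_fract_mult)
  then show ?case using pCons by (simp add: const_rf_def)
qed simp

text \<open>The embedding of \<open>k(t)\<close> into itself with \<open>t \<mapsto> \<theta>\<close>, meaningful for transcendental \<open>\<theta>\<close>.\<close>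

definition subst_rf :: "'k::field ratfun \<Rightarrow> 'k ratfun \<Rightarrow> 'k ratfun" where
  "subst_rf \<theta> x = (THE y. \<exists>f g. g \<noteq> 0 \<and> x = Fract f g \<and> y = peval f \<theta> / peval g \<theta>)"

locale transcendental_element =
  fixes \<theta> :: "'k::field ratfun"
  assumes ord_nz: "ord_at 0 \<theta> \<noteq> 0" and \<theta>_nz: "\<theta> \<noteq> 0"
begin

text \<open>The powers of \<theta> have pairwise different orders at 0, namely the multiples of that
  of \<theta>, so no nonzero polynomial vanishes at \<theta>.\<close>

lemma peval_nonzero: "f \<noteq> 0 \<Longrightarrow> peval f \<theta> \<noteq> 0"
proof -
  assume f: "f \<noteq> 0"
  let ?C = "(\<lambda>i. \<theta> ^ i) ` {..degree f}"
  have v: "ord_at 0 (\<theta> ^ i) = int i * ord_at 0 \<theta>" for i using \<theta>_nz by (simp add: ord_at.v_power)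
  have inj: "inj_on (\<lambda>i. \<theta> ^ i) {..degree f}"
    by (rule inj_onI) (metis v mult_cancel_right of_nat_eq_iff ord_nz)
  have C: "finite ?C" "?C \<subseteq> UNIV" "0 \<notin> ?C" using \<theta>_nz by auto
  have "inj_on (ord_at 0) ?C" by (rule inj_onI) (use v ord_nz in auto)
  note dist = ord_at.distinct_values[OF C this, of "\<lambda>x. coeff f (nat (ord_at 0 x div ord_at 0 \<theta>))"]
  have "(\<Sum>x\<in>?C. scale_rf (coeff f (nat (ord_at 0 x div ord_at 0 \<theta>))) x) = peval f \<theta>"
    unfolding peval_altdef by (subst sum.reindex[OF inj]) (simp add: v ord_nz scale_rf_def)
  moreover have "coeff f (nat (ord_at 0 (\<theta> ^ degree f) div ord_at 0 \<theta>)) \<noteq> 0" using f by (simp add: v ord_nz)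
  ultimately show ?thesis using dist by fastforce
qed

lemma subst_Fract: "g \<noteq> 0 \<Longrightarrow> subst_rf \<theta> (Fract f g) = peval f \<theta> / peval g \<theta>"
  unfolding subst_rf_def
proof (rule the_equality)
  fix y assume g: "g \<noteq> 0" and "\<exists>f' g'. g' \<noteq> 0 \<and> Fract f g = Fract f' g' \<and> y = peval f' \<theta> / peval g' \<theta>"
  then obtain f' g' where *: "g' \<noteq> 0" "Fract f g = Fract f' g'" "y = peval f' \<theta> / peval g' \<theta>" by blast
  then have "f * g' = f' * g" using g by (simp add: eq_fract)
  then have "peval f \<theta> * peval g' \<theta> = peval f' \<theta> * peval g \<theta>" by (metis peval_mult)
  then show "y = peval f \<theta> / peval g \<theta>"
    using peval_nonzero[OF g] peval_nonzero[OF *(1)] *(3) by (simp add: frac_eq_eq)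
qed blast

lemma Fract_cases2:
  obtains f g where "x = Fract f g" "g \<noteq> (0 :: 'k poly)"
  by (metis Fract_cases)

lemma subst_add: "subst_rf \<theta> (x + y) = subst_rf \<theta> x + subst_rf \<theta> y"
proof -
  obtain f g f' g' where *: "x = Fract f g" "g \<noteq> 0" "y = Fract f' g'" "g' \<noteq> 0" by (metis Fract_cases2)
  then show ?thesis
    using peval_nonzero[OF *(2)] peval_nonzero[OF *(4)] by (simp add: subst_Fract add_frac_eq)
qed

lemma subst_mult: "subst_rf \<theta> (x * y) = subst_rf \<theta> x * subst_rf \<theta> y"
proof -
  obtain f g f' g' where *: "x = Fract f g" "g \<noteq> 0" "y = Fract f' g'" "g' \<noteq> 0" by (metis Fract_cases2)
  then show ?thesis by (simp add: subst_Fract)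
qed

lemma subst_to_fract: "subst_rf \<theta> (to_fract f) = peval f \<theta>"
  by (simp add: to_fract_def subst_Fract)

lemma subst_const [simp]: "subst_rf \<theta> (const_rf c) = const_rf c"
  by (simp add: const_rf_def[of c] subst_to_fract)

lemma subst_0 [simp]: "subst_rf \<theta> 0 = 0" and subst_1 [simp]: "subst_rf \<theta> 1 = 1"
  using subst_const[of 0] subst_const[of 1] by simp_all

lemma subst_var [simp]: "subst_rf \<theta> var_rf = \<theta>"
  by (simp add: subst_to_fract)

lemma subst_uminus: "subst_rf \<theta> (- x) = - subst_rf \<theta> x"
  using subst_add[of x "- x"] by (simp add: eq_neg_iff_add_eq_0 add.commute)

lemma subst_diff: "subst_rf \<theta> (x - y) = subst_rf \<theta> x - subst_rf \<theta> y"
  using subst_add[of x "- y"] by (simp add: subst_uminus)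

lemma subst_power: "subst_rf \<theta> (x ^ m) = subst_rf \<theta> x ^ m"
  by (induction m) (simp_all add: subst_mult)

lemma subst_eq_0_iff [simp]: "subst_rf \<theta> x = 0 \<longleftrightarrow> x = 0"
proof
  assume *: "subst_rf \<theta> x = 0"
  show "x = 0"
  proof (rule ccontr)
    assume "x \<noteq> 0"
    then have "subst_rf \<theta> (x * inverse x) = 1" by simp
    then show False using * by (simp only: subst_mult) simp
  qed
qed simp

lemma inj_subst: "inj (subst_rf \<theta>)"
proof (rule injI)
  fix x y assume "subst_rf \<theta> x = subst_rf \<theta> y"
  then have "subst_rf \<theta> (x - y) = 0" by (simp only: subst_diff) simp
  then show "x = y" by simp
qed

lemma subst_inverse: "subst_rf \<theta> (inverse x) = inverse (subst_rf \<theta> x)"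
proof (cases "x = 0")
  case False
  then have "subst_rf \<theta> x * subst_rf \<theta> (inverse x) = 1" by (simp flip: subst_mult)
  then show ?thesis by (metis inverse_unique)
qed simp

lemma subst_divide: "subst_rf \<theta> (x / y) = subst_rf \<theta> x / subst_rf \<theta> y"
  by (simp add: divide_inverse subst_mult subst_inverse)

lemma subst_peval: "subst_rf \<theta> (peval f x) = peval f (subst_rf \<theta> x)"
  by (induction f) (simp_all add: subst_add subst_mult)

lemma inv_subst [simp]: "inv_into UNIV (subst_rf \<theta>) (subst_rf \<theta> x) = x"
  using inj_subst by simp

lemma const_subfield_range: "const_subfield (range (subst_rf \<theta>))"
proof
  show "const_rf c \<in> range (subst_rf \<theta>)" for c by (metis rangeI subst_const)
qed (auto simp flip: subst_add subst_mult subst_inverse)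

text \<open>The substitution is an isomorphism onto its range and fixes the constants, so the orders
  on k(t) can be moved to k(\<theta>).\<close>

lemma valuation_range:
  assumes "rf_valuation UNIV w"
  shows "rf_valuation (range (subst_rf \<theta>)) (\<lambda>x. w (inv_into UNIV (subst_rf \<theta>) x))"
proof -
  interpret w: rf_valuation UNIV w by fact
  interpret const_subfield "range (subst_rf \<theta>)" by (rule const_subfield_range)
  have c: "inv_into UNIV (subst_rf \<theta>) (const_rf c) = const_rf c" for c by (metis inv_subst subst_const)
  have al: "at_least (\<lambda>x. w (inv_into UNIV (subst_rf \<theta>) x)) i (subst_rf \<theta> x) \<longleftrightarrow> at_least w i x" for i x
    by (simp add: at_least_def)
  show ?thesis
  proof unfold_locales
    fix x assume "x \<in> range (subst_rf \<theta>)" "at_least (\<lambda>x. w (inv_into UNIV (subst_rf \<theta>) x)) 0 x"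
    then obtain y where y: "x = subst_rf \<theta> y" "at_least w 0 y" using al by auto
    then obtain c where "at_least w 1 (y - const_rf c)" using w.v_residue by blast
    then show "\<exists>c. at_least (\<lambda>x. w (inv_into UNIV (subst_rf \<theta>) x)) 1 (x - const_rf c)"
      using al[of 1 "y - const_rf c"] by (intro exI[of _ c]) (simp add: y subst_diff)
  qed (auto simp: c w.v_mult w.v_const simp flip: subst_mult subst_add intro!: w.v_add)
qed

end

section \<open>Forms and polynomials with exponents in a semigroup\<close>

lemma mpoly_eval_hom:
  fixes H :: "'r::comm_ring_1 \<Rightarrow> 's::comm_ring_1" and h :: "'k::field \<Rightarrow> 'r"
  assumes "\<And>f g. H (f + g) = H f + H g" "\<And>f g. H (f * g) = H f * H g" "H 0 = 0" "H 1 = 1"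
  shows "H (mpoly_eval h x F) = mpoly_eval (\<lambda>c. H (h c)) (\<lambda>i. H (x i)) F"
proof -
  have s: "H (sum f I) = (\<Sum>i\<in>I. H (f i))" for f and I :: "'c set"
    by (induction I rule: infinite_finite_induct) (simp_all add: assms)
  have p: "H (prod f I) = (\<Prod>i\<in>I. H (f i))" for f and I :: "'c set"
    by (induction I rule: infinite_finite_induct) (simp_all add: assms)
  have pw: "H (y ^ m) = H y ^ m" for y m by (induction m) (simp_all add: assms)
  show ?thesis unfolding mpoly_eval_def by (simp add: s p pw assms)
qed

text \<open>For a semigroup \<open>S\<close> this is the semigroup ring k[t^S].\<close>

definition poly_supp :: "nat set \<Rightarrow> 'k::field poly set" where
  "poly_supp S = {f. \<forall>m. coeff f m \<noteq> 0 \<longrightarrow> m \<in> S}"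

locale numerical_semigroup =
  fixes S :: "nat set" and c :: nat
  assumes zero_mem: "0 \<in> S" and add_mem: "s \<in> S \<Longrightarrow> s' \<in> S \<Longrightarrow> s + s' \<in> S"
    and conductor: "c \<le> s \<Longrightarrow> s \<in> S"
begin

lemma supp_const: "[:a:] \<in> poly_supp S"
  by (auto simp: poly_supp_def coeff_pCons zero_mem split: nat.splits)

lemma supp_one: "1 \<in> poly_supp S"
  using supp_const[of 1] by (simp add: one_pCons)

lemma supp_add: "f \<in> poly_supp S \<Longrightarrow> g \<in> poly_supp S \<Longrightarrow> f + g \<in> poly_supp S"
proof -
  assume f: "f \<in> poly_supp S" and g: "g \<in> poly_supp S"
  have "m \<in> S" if "coeff (f + g) m \<noteq> 0" for m
  proof -
    have "coeff f m \<noteq> 0 \<or> coeff g m \<noteq> 0" using that by auto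
    then show ?thesis using f g unfolding poly_supp_def by blast
  qed
  then show ?thesis by (simp add: poly_supp_def)
qed

lemma supp_mult: "f \<in> poly_supp S \<Longrightarrow> g \<in> poly_supp S \<Longrightarrow> f * g \<in> poly_supp S"
proof -
  assume f: "f \<in> poly_supp S" and g: "g \<in> poly_supp S"
  have "m \<in> S" if m: "coeff (f * g) m \<noteq> 0" for m
  proof -
    have "(\<Sum>i\<le>m. coeff f i * coeff g (m - i)) \<noteq> 0" using m by (simp add: coeff_mult)
    then obtain i where "i \<le> m" "coeff f i * coeff g (m - i) \<noteq> 0" by (metis (mono_tags, lifting) atMost_iff sum.neutral)
    then have "i \<in> S" "m - i \<in> S" "i + (m - i) = m" using f g by (auto simp: poly_supp_def)
    then show "m \<in> S" using add_mem by metis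
  qed
  then show ?thesis by (simp add: poly_supp_def)
qed

lemma supp_smult: "f \<in> poly_supp S \<Longrightarrow> Polynomial.smult a f \<in> poly_supp S"
  using supp_mult[OF supp_const[of a]] by simp

lemma supp_diff: "f \<in> poly_supp S \<Longrightarrow> g \<in> poly_supp S \<Longrightarrow> f - g \<in> poly_supp S"
  using supp_add[of f "Polynomial.smult (- 1) g"] supp_smult[of g "- 1"] by simp

lemma supp_power: "f \<in> poly_supp S \<Longrightarrow> f ^ m \<in> poly_supp S"
  by (induction m) (simp_all add: supp_one supp_mult)

lemma supp_sum: "(\<And>i. i \<in> I \<Longrightarrow> f i \<in> poly_supp S) \<Longrightarrow> sum f I \<in> poly_supp S"
  by (induction I rule: infinite_finite_induct)
    (use supp_const[of 0] in \<open>auto simp: supp_add\<close>)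

lemma supp_monom: "s \<in> S \<Longrightarrow> monom a s \<in> poly_supp S"
  by (auto simp: poly_supp_def)

lemma supp_conductor: "monom 1 c * f \<in> poly_supp S"
proof -
  have "m \<in> S" if "coeff (monom 1 c * f) m \<noteq> 0" for m
    using that by (cases "c \<le> m") (auto simp: coeff_monom_mult conductor)
  then show ?thesis by (simp add: poly_supp_def)
qed

text \<open>The geometric series for the inverse of g / g(0) = 1 - N, cut off before N^c: as N has
  no constant term, N^c is divisible by t^c. Unlike the true inverse, the result is a polynomial,
  and it stays in the semigroup ring.\<close>

lemma truncated_inverse:
  assumes g: "g \<in> poly_supp S" "poly g 0 \<noteq> 0"
  obtains h e where "h \<in> poly_supp S" "g * h = 1 - monom 1 c * e"
proof -
  define b where "b = poly g 0"
  define N where "N = 1 - Polynomial.smult (inverse b) g"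
  have N: "N \<in> poly_supp S" unfolding N_def by (intro supp_diff supp_one supp_smult g)
  have "poly N 0 = 0" using g(2) by (simp add: N_def b_def)
  then obtain N' where N': "N = [:0, 1:] * N'" using poly_eq_0_iff_dvd[of N 0] by (auto simp: dvd_def)
  define h where "h = Polynomial.smult (inverse b) (\<Sum>i<c. N ^ i)"
  have "g * Polynomial.smult (inverse b) 1 = 1 - N" by (simp add: N_def)
  then have "g * h = (1 - N) * (\<Sum>i<c. N ^ i)"
    unfolding h_def by (metis (no_types, lifting) mult.assoc mult_smult_left mult_smult_right mult.left_neutral)
  also have "\<dots> = 1 - N ^ c" by (rule one_diff_power_eq[symmetric])
  also have "N ^ c = monom 1 c * N' ^ c"
    unfolding N' by (simp only: power_mult_distrib monom_altdef smult_1_left)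
  finally have "g * h = 1 - monom 1 c * N' ^ c" .
  moreover have "h \<in> poly_supp S" unfolding h_def by (intro supp_smult supp_sum supp_power N)
  ultimately show ?thesis using that by blast
qed

end

lemma numerical_semigroup_UNIV: "numerical_semigroup UNIV c"
  by unfold_locales auto

section \<open>Evaluation of forms\<close>

lemma mpoly_eval_superset:
  assumes "finite A" "Poly_Mapping.keys F \<subseteq> A" "h 0 = 0"
  shows "mpoly_eval h x F = (\<Sum>m\<in>A. h (Poly_Mapping.lookup F m) *
    (\<Prod>i\<in>Poly_Mapping.keys m. x i ^ Poly_Mapping.lookup m i))"
  unfolding mpoly_eval_def using assms by (intro sum.mono_neutral_left) (auto simp: in_keys_iff)

lemma mpoly_eval_add:
  fixes h :: "'k::field \<Rightarrow> 'r::comm_ring_1"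
  assumes "h 0 = 0" "\<And>a b. h (a + b) = h a + h b"
  shows "mpoly_eval h x (F + G) = mpoly_eval h x F + mpoly_eval h x G"
proof -
  let ?A = "Poly_Mapping.keys F \<union> Poly_Mapping.keys G"
  have fin: "finite ?A" by simp
  have "Poly_Mapping.keys (F + G) \<subseteq> ?A" by (rule Poly_Mapping.keys_add)
  then show ?thesis
    using mpoly_eval_superset[of ?A _ h x] fin assms
    by (simp add: lookup_add distrib_right sum.distrib)
qed

lemma is_form_add: "is_form n r F \<Longrightarrow> is_form n r G \<Longrightarrow> is_form n r (F + G)"
  unfolding is_form_def using Poly_Mapping.keys_add[of F G] by blast

lemma mpoly_eval_form:
  fixes h :: "'k::field \<Rightarrow> 'r::comm_ring_1"
  assumes F: "is_form n r F" and x: "\<And>i. i \<le> n \<Longrightarrow> x i = u * y i"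
  shows "mpoly_eval h x F = u ^ r * mpoly_eval h y F"
proof -
  have "(\<Prod>i\<in>Poly_Mapping.keys m. x i ^ Poly_Mapping.lookup m i) =
      u ^ r * (\<Prod>i\<in>Poly_Mapping.keys m. y i ^ Poly_Mapping.lookup m i)"
    if m: "m \<in> Poly_Mapping.keys F" for m
  proof -
    have k: "Poly_Mapping.keys m \<subseteq> {..n}" "(\<Sum>i\<in>Poly_Mapping.keys m. Poly_Mapping.lookup m i) = r"
      using F m by (auto simp: is_form_def)
    have "(\<Prod>i\<in>Poly_Mapping.keys m. x i ^ Poly_Mapping.lookup m i) =
        (\<Prod>i\<in>Poly_Mapping.keys m. u ^ Poly_Mapping.lookup m i * y i ^ Poly_Mapping.lookup m i)"
      using k(1) x by (intro prod.cong) (auto simp: power_mult_distrib)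
    also have "\<dots> = u ^ (\<Sum>i\<in>Poly_Mapping.keys m. Poly_Mapping.lookup m i) *
        (\<Prod>i\<in>Poly_Mapping.keys m. y i ^ Poly_Mapping.lookup m i)"
      by (simp add: prod.distrib power_sum)
    finally show ?thesis by (simp add: k(2))
  qed
  then show ?thesis unfolding mpoly_eval_def by (simp add: sum_distrib_left mult.left_commute)
qed

text \<open>By descent \<zeta> divides every element of \<open>S\<close>, in particular c and c + 1,
  so \<zeta> = 1 and \<open>S\<close> is closed under predecessors. The assumption is what a
  principal maximal ideal at the origin implies.\<close>

lemma (in numerical_semigroup) translate_imp_UNIV:
  assumes "\<zeta> > 0" "\<And>s. s \<in> S \<Longrightarrow> s > 0 \<Longrightarrow> \<exists>s'\<in>S. s = \<zeta> + s'"
  shows "S = UNIV"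
proof -
  have dvd: "\<zeta> dvd s" if "s \<in> S" for s
    using that
  proof (induction s rule: less_induct)
    case (less s)
    show ?case
    proof (cases "s = 0")
      case False
      then obtain s' where s': "s' \<in> S" "s = \<zeta> + s'" using assms(2)[OF less.prems] by auto
      then have "\<zeta> dvd s'" using less.IH[of s'] assms(1) by simp
      then show ?thesis using s'(2) by simp
    qed simp
  qed
  have "\<zeta> dvd Suc c" "\<zeta> dvd c" using dvd conductor by auto
  then have "\<zeta> dvd 1" by (metis dvd_add_right_iff Suc_eq_plus1)
  then have \<zeta>: "\<zeta> = 1" by simp
  have "c \<in> S" by (simp add: conductor)
  have down: "s \<in> S" if "Suc s \<in> S" for s
    using assms(2)[OF that] \<zeta> by auto
  have "s \<in> S" for s
  proof (cases "c \<le> s")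
    case False
    then have "s \<le> c" by simp
    then show ?thesis by (induction rule: inc_induct) (use \<open>c \<in> S\<close> down in auto)
  qed (rule conductor)
  then show ?thesis by auto
qed

section \<open>Charts of monomial curves\<close>

definition generated_semigroup :: "nat \<Rightarrow> (nat \<Rightarrow> nat) \<Rightarrow> nat set" where
  "generated_semigroup n c = {\<Sum>i\<le>n. e i * c i | e. True}"

lemma generated_semigroup_zero: "0 \<in> generated_semigroup n c"
  by (auto simp: generated_semigroup_def intro!: exI[of _ "\<lambda>_. 0"])

lemma generated_semigroup_add:
  assumes "s \<in> generated_semigroup n c" "s' \<in> generated_semigroup n c"
  shows "s + s' \<in> generated_semigroup n c"
proof -
  obtain e e' where "s = (\<Sum>i\<le>n. e i * c i)" "s' = (\<Sum>i\<le>n. e' i * c i)"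
    using assms by (auto simp: generated_semigroup_def)
  then have "s + s' = (\<Sum>i\<le>n. (e i + e' i) * c i)" by (simp add: sum.distrib distrib_right)
  then show ?thesis by (auto simp: generated_semigroup_def)
qed

lemma generated_semigroup_generator: "i \<le> n \<Longrightarrow> c i \<in> generated_semigroup n c"
proof -
  assume "i \<le> n"
  then have "c i = (\<Sum>j\<le>n. (if j = i then 1 else 0) * c j)"
    by (simp add: if_distrib[of "\<lambda>x. x * _"] cong: if_cong)
  then show ?thesis
    unfolding generated_semigroup_def by (intro CollectI exI[of _ "\<lambda>j. if j = i then 1 else 0"] conjI TrueI)
qed

lemma generated_semigroup_mult:
  assumes "s \<in> generated_semigroup n c" shows "k * s \<in> generated_semigroup n c"
proof (induction k)
  case (Suc k)
  then show ?case using generated_semigroup_add[OF assms Suc] by simp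
qed (simp add: generated_semigroup_zero)

text \<open>The least positive difference q of two elements divides every generator, since otherwise
  a remainder would be a smaller difference; hence q = 1. With y and y + 1 in the semigroup,
  division with remainder by y writes every s \<ge> y^2 as a combination of the two.\<close>

lemma generated_semigroup_cofinite:
  assumes gcd: "Gcd (c ` {..n}) = 1"
  shows "\<exists>k. \<forall>s\<ge>k. s \<in> generated_semigroup n c"
proof -
  let ?S = "generated_semigroup n c"
  let ?Q = "\<lambda>q. q > 0 \<and> (\<exists>y\<in>?S. y + q \<in> ?S)"
  have "\<not> (\<forall>i\<le>n. c i = 0)"
  proof
    assume "\<forall>i\<le>n. c i = 0"
    then have "c ` {..n} = {0}" by auto
    then show False using gcd by simp
  qed
  then obtain i where "i \<le> n" "c i > 0" by auto
  then have "?Q (c i)" using generated_semigroup_generator generated_semigroup_zero by (metis add_0)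
  define q where "q = (LEAST q. ?Q q)"
  have Q: "?Q q" unfolding q_def using \<open>?Q (c i)\<close> by (rule LeastI)
  then obtain y where y: "y \<in> ?S" "y + q \<in> ?S" by blast
  have "q dvd c i" if i: "i \<le> n" for i
  proof (rule ccontr)
    assume "\<not> q dvd c i"
    then have pos: "c i mod q > 0" by (simp add: dvd_eq_mod_eq_0)
    obtain k r where r: "c i = k * q + r" "r = c i mod q"
      using div_mult_mod_eq[of "c i" q] by metis
    \<comment> \<open>This element and k (y + q) have the difference r.\<close>
    have "k * y + c i \<in> ?S"
      by (rule generated_semigroup_add[OF generated_semigroup_mult[OF y(1)] generated_semigroup_generator[OF i]])
    moreover have "k * y + c i = k * (y + q) + r" by (subst r(1)) (simp only: distrib_left add.assoc)
    ultimately have "k * (y + q) + r \<in> ?S" by (simp only:)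
    moreover have "k * (y + q) \<in> ?S" by (rule generated_semigroup_mult[OF y(2)])
    ultimately have "?Q r" using pos r(2) by blast
    then have "q \<le> r" unfolding q_def by (rule Least_le)
    moreover have "r < q" using Q r(2) by simp
    ultimately show False by simp
  qed
  then have "q dvd Gcd (c ` {..n})" by (intro Gcd_greatest) auto
  then have q: "q = 1" using gcd by simp
  show ?thesis
  proof (intro exI[of _ "y * y"] allI impI)
    fix s assume s: "y * y \<le> s"
    show "s \<in> ?S"
    proof (cases "y = 0")
      case True
      then have "s * 1 \<in> ?S" using y q by (intro generated_semigroup_mult) simp
      then show ?thesis by simp
    next
      case False
      have "y \<le> s div y" using s False by (metis div_le_mono nonzero_mult_div_cancel_right)
      moreover have "s mod y < y" using False by simp
      ultimately have le: "s mod y \<le> s div y" by simp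
      then have "(s div y - s mod y) * y + s mod y * (y + q) \<in> ?S"
        using generated_semigroup_add[OF generated_semigroup_mult[OF y(1)] generated_semigroup_mult[OF y(2)]]
        by blast
      moreover have "(s div y - s mod y) * y + s mod y * (y + q) = s"
      proof -
        obtain r where r: "s div y = s mod y + r" using le le_Suc_ex by blast
        then have "(s div y - s mod y) * y + s mod y * (y + q) = (s div y) * y + s mod y"
          by (simp add: q algebra_simps)
        then show ?thesis by simp
      qed
      ultimately show ?thesis by simp
    qed
  qed
qed

lemma order_0_coeff: "f \<noteq> 0 \<Longrightarrow> coeff f (Polynomial.order 0 f) \<noteq> (0 :: 'k::field)"
proof -
  assume f: "f \<noteq> 0"
  obtain f' where f': "f = [:- 0, 1:] ^ Polynomial.order 0 f * f'" "\<not> [:- 0, 1:] dvd f'"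
    using order_decomp[OF f] by blast
  have "f = monom 1 (Polynomial.order 0 f) * f'"
    by (subst f'(1)) (simp add: monom_altdef)
  then have "coeff f (Polynomial.order 0 f) = coeff (monom 1 (Polynomial.order 0 f) * f') (Polynomial.order 0 f)"
    by simp
  also have "\<dots> = coeff f' 0" by (simp only: coeff_monom_mult) simp
  finally show ?thesis using f'(2) poly_eq_0_iff_dvd[of f' 0] by (simp add: poly_0_coeff_0)
qed

lemma proj_point_eqD: "proj_point x = proj_point y \<Longrightarrow> \<exists>c. c \<noteq> 0 \<and> x = c \<cdot>\<^sub>v y"
  using mem_proj_point[of x] by (auto simp: proj_point_def)

lemma proj_point_smult: "(c :: 'k::field) \<noteq> 0 \<Longrightarrow> proj_point (c \<cdot>\<^sub>v x) = proj_point x"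
proof -
  assume c: "c \<noteq> 0"
  have "\<exists>b. b \<noteq> 0 \<and> a \<cdot>\<^sub>v x = b \<cdot>\<^sub>v (c \<cdot>\<^sub>v x)" if "a \<noteq> 0" for a
    using that c by (intro exI[of _ "a / c"]) (simp add: smult_smult_assoc)
  moreover have "\<exists>b. b \<noteq> 0 \<and> a \<cdot>\<^sub>v (c \<cdot>\<^sub>v x) = b \<cdot>\<^sub>v x" if "a \<noteq> 0" for a
    using that c by (intro exI[of _ "a * c"]) (simp add: smult_smult_assoc)
  ultimately show ?thesis unfolding proj_point_def by blast
qed

text \<open>An affine chart of a monomial curve, with coordinate \<open>\<theta> = t\<^sup>d\<close> or \<open>\<theta> = t\<^sup>-\<^sup>d\<close>. It omits
  only the point all of whose coordinates except the \<open>q\<close>-th vanish.\<close>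

locale monomial_chart = transcendental_element \<theta> for \<theta> :: "'k::alg_closed_field ratfun" +
  fixes n :: nat and a c :: "nat \<Rightarrow> nat" and piv q :: nat and u :: "'k ratfun"
  assumes piv: "piv \<le> n" "c piv = 0" and q: "q \<le> n" "0 < c q"
    and c_max: "i \<le> n \<Longrightarrow> i \<noteq> q \<Longrightarrow> c i < c q"
    and gcd_c: "Gcd (c ` {..n}) = 1"
    and parametrization: "i \<le> n \<Longrightarrow> to_fract (monom 1 (a i)) = u * \<theta> ^ c i" and u_nz: "u \<noteq> 0"
    and monomial_points_eq: "(monomial_points n a :: 'k vec set set) =
      {proj_point (vec (n + 1) (\<lambda>i. t ^ c i * s ^ (c q - c i))) | s t. (s, t) \<noteq> (0, 0)}"
begin

abbreviation "X \<equiv> monomial_curve n a :: ('k vec set, 'k) curve"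

definition S :: "nat set" where
  "S = generated_semigroup n c"

definition cond :: nat where
  "cond = (SOME k. \<forall>s\<ge>k. s \<in> S)"

sublocale numerical_semigroup S cond
proof
  show "0 \<in> S" by (simp add: S_def generated_semigroup_zero)
  show "s \<in> S \<Longrightarrow> s' \<in> S \<Longrightarrow> s + s' \<in> S" for s s' by (simp add: S_def generated_semigroup_add)
  have "\<exists>k. \<forall>s\<ge>k. s \<in> S" using generated_semigroup_cofinite[OF gcd_c] by (simp add: S_def)
  from someI_ex[OF this] show "cond \<le> s \<Longrightarrow> s \<in> S" for s unfolding cond_def by blast
qed

definition affine_point :: "'k \<Rightarrow> 'k vec set" where
  "affine_point z = proj_point (vec (n + 1) (\<lambda>i. z ^ c i))"

definition far_point :: "'k vec set" where
  "far_point = proj_point (vec (n + 1) (\<lambda>i. if i = q then 1 else 0))"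

lemma mem_points:
  "(s, t) \<noteq> (0, 0) \<Longrightarrow> proj_point (vec (n + 1) (\<lambda>i. t ^ c i * s ^ (c q - c i))) \<in> points X"
  unfolding monomial_curve_def curve.simps monomial_points_eq by blast

lemma points_eq: "points X = insert far_point (range affine_point)"
proof
  show "points X \<subseteq> insert far_point (range affine_point)"
  proof
    fix P assume "P \<in> points X"
    then obtain s t where P: "P = proj_point (vec (n + 1) (\<lambda>i. t ^ c i * s ^ (c q - c i)))"
      and st: "(s, t) \<noteq> (0, 0)" by (auto simp: monomial_curve_def monomial_points_eq)
    show "P \<in> insert far_point (range affine_point)"
    proof (cases "s = 0")
      case True
      have "t ^ c i * s ^ (c q - c i) = t ^ c q * (if i = q then 1 else 0)" if "i < n + 1" for i
        using that c_max[of i] True by auto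
      then have "vec (n + 1) (\<lambda>i. t ^ c i * s ^ (c q - c i)) =
          t ^ c q \<cdot>\<^sub>v vec (n + 1) (\<lambda>i. if i = q then 1 else 0)"
        by (intro eq_vecI) auto
      then show ?thesis using True st proj_point_smult[of "t ^ c q"] by (simp add: P far_point_def)
    next
      case False
      have "t ^ c i * s ^ (c q - c i) = s ^ c q * (t / s) ^ c i" if "i < n + 1" for i
      proof -
        have "c i \<le> c q" using that c_max[of i] by (cases "i = q") auto
        then show ?thesis using False by (simp add: power_divide power_diff)
      qed
      then have "vec (n + 1) (\<lambda>i. t ^ c i * s ^ (c q - c i)) = s ^ c q \<cdot>\<^sub>v vec (n + 1) (\<lambda>i. (t / s) ^ c i)"
        by (intro eq_vecI) auto
      then have "P = affine_point (t / s)"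
        using False proj_point_smult[of "s ^ c q"] by (simp add: P affine_point_def)
      then show ?thesis by blast
    qed
  qed
next
  have "affine_point z \<in> points X" for z
    using mem_points[of 1 z] by (simp add: affine_point_def)
  moreover have "far_point \<in> points X"
  proof -
    have "(1 :: 'k) ^ c i * 0 ^ (c q - c i) = (if i = q then 1 else 0)" if "i < n + 1" for i
      using that c_max[of i] by auto
    then have "vec (n + 1) (\<lambda>i. (1 :: 'k) ^ c i * 0 ^ (c q - c i)) = vec (n + 1) (\<lambda>i. if i = q then 1 else 0)"
      by (intro eq_vecI) auto
    then show ?thesis
      using mem_points[of 0 1] by (simp add: far_point_def)
  qed
  ultimately show "insert far_point (range affine_point) \<subseteq> points X" by blast
qed

lemma piv_neq_q: "piv \<noteq> q"
  using piv q by auto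

lemma far_point_neq: "affine_point z \<noteq> far_point"
proof
  assume "affine_point z = far_point"
  then obtain b where b: "vec (n + 1) (\<lambda>i. z ^ c i) = b \<cdot>\<^sub>v vec (n + 1) (\<lambda>i. if i = q then 1 else 0)"
    unfolding affine_point_def far_point_def using proj_point_eqD by blast
  have "vec (n + 1) (\<lambda>i. z ^ c i) $ piv = (b \<cdot>\<^sub>v vec (n + 1) (\<lambda>i. if i = q then 1 else 0)) $ piv"
    using b by simp
  then show False using piv piv_neq_q by simp
qed

text \<open>The coordinates give equal powers for all exponents in \<open>S\<close>, and two
  consecutive exponents determine z. This is where the coprimality of the exponents enters.\<close>

lemma inj_affine_point: "inj affine_point"
proof (rule injI)
  fix z z' assume "affine_point z = affine_point z'"
  then obtain b where b: "vec (n + 1) (\<lambda>i. z ^ c i) = b \<cdot>\<^sub>v vec (n + 1) (\<lambda>i. z' ^ c i)"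
    unfolding affine_point_def using proj_point_eqD by blast
  have bi: "z ^ c i = b * z' ^ c i" if "i \<le> n" for i
  proof -
    have "vec (n + 1) (\<lambda>i. z ^ c i) $ i = (b \<cdot>\<^sub>v vec (n + 1) (\<lambda>i. z' ^ c i)) $ i"
      using b by simp
    then show ?thesis using that by simp
  qed
  have "b = 1" using bi[OF piv(1)] piv(2) by simp
  then have eq: "z ^ c i = z' ^ c i" if "i \<le> n" for i using bi that by simp
  have S: "z ^ s = z' ^ s" if s: "s \<in> S" for s
  proof -
    obtain e where "s = (\<Sum>i\<le>n. e i * c i)" using s by (auto simp: S_def generated_semigroup_def)
    then have "z ^ s = (\<Prod>i\<le>n. (z ^ c i) ^ e i)" "z' ^ s = (\<Prod>i\<le>n. (z' ^ c i) ^ e i)"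
      by (simp_all add: power_sum power_mult mult.commute)
    then show ?thesis using eq by simp
  qed
  \<comment> \<open>The exponents are positive, so that the case z = 0 is detected as well.\<close>
  have "z ^ Suc cond = z' ^ Suc cond" "z ^ Suc (Suc cond) = z' ^ Suc (Suc cond)"
    using conductor by (intro S, simp)+
  then show "z = z'"
    by (metis mult_right_cancel power_Suc power_eq_0_iff power_0_Suc zero_less_Suc)
qed

section \<open>Local rings in a chart\<close>

definition form_poly :: "'k mpoly \<Rightarrow> 'k poly" where
  "form_poly F = mpoly_eval (\<lambda>b. [:b:]) (\<lambda>i. monom 1 (c i)) F"

lemma form_poly_supp:
  assumes F: "is_form n r F"
  shows "form_poly F \<in> poly_supp S"
proof -
  have "[:Poly_Mapping.lookup F m:] * (\<Prod>i\<in>Poly_Mapping.keys m. monom 1 (c i) ^ Poly_Mapping.lookup m i)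
      \<in> poly_supp S" if m: "m \<in> Poly_Mapping.keys F" for m
  proof -
    have k: "Poly_Mapping.keys m \<subseteq> {..n}" using F m by (auto simp: is_form_def)
    have pm: "monom (1 :: 'k) (c i) ^ e \<in> poly_supp S" if "i \<le> n" for i e
      using that by (intro supp_power supp_monom) (simp add: S_def generated_semigroup_generator)
    have "(\<Prod>i\<in>I. monom (1 :: 'k) (c i) ^ Poly_Mapping.lookup m i) \<in> poly_supp S" if "finite I" "I \<subseteq> {..n}" for I
      using that by (induction I rule: finite_induct) (auto intro: supp_mult supp_one pm)
    then show ?thesis using k by (intro supp_mult supp_const) auto
  qed
  then show ?thesis unfolding form_poly_def mpoly_eval_def by (intro supp_sum) auto
qed

lemma eval_form:
  assumes F: "is_form n r F"
  shows "mpoly_eval const_rf (\<lambda>i. to_fract (monom 1 (a i))) F = u ^ r * peval (form_poly F) \<theta>"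
proof -
  have "peval (form_poly F) \<theta> = mpoly_eval const_rf (\<lambda>i. \<theta> ^ c i) F"
    unfolding form_poly_def by (subst mpoly_eval_hom[where H = "\<lambda>f. peval f \<theta>"]) simp_all
  then show ?thesis using mpoly_eval_form[OF F, of "\<lambda>i. to_fract (monom 1 (a i))" u "\<lambda>i. \<theta> ^ c i"]
    parametrization by simp
qed

lemma eval_form_point:
  fixes x :: "'k vec"
  assumes F: "is_form n r F" and x: "x = b \<cdot>\<^sub>v vec (n + 1) (\<lambda>i. z ^ c i)"
  shows "mpoly_eval id (\<lambda>i. x $ i) F = b ^ r * poly (form_poly F) z"
proof -
  have "poly (form_poly F) z = mpoly_eval id (\<lambda>i. z ^ c i) F"
    unfolding form_poly_def
    by (subst mpoly_eval_hom[where H = "\<lambda>f. poly f z"]) (simp_all add: poly_monom id_def)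
  then show ?thesis using mpoly_eval_form[OF F, of "\<lambda>i. x $ i" b "\<lambda>i. z ^ c i" id] by (simp add: x)
qed

text \<open>Monomials of the semigroup ring come from products of coordinates, and the coordinate
  \<open>piv\<close>, which is 1 in the chart, pads them to any larger degree. All large r are
  covered because numerator and denominator of a quotient must have the same degree.\<close>

lemma poly_form:
  assumes f: "f \<in> poly_supp S"
  shows "\<exists>r0. \<forall>r\<ge>r0. \<exists>F. is_form n r F \<and> form_poly F = f"
proof -
  have mono: "\<exists>r0. \<forall>r\<ge>r0. \<exists>F. is_form n r F \<and> form_poly F = monom b m" if m: "m \<in> S" for m b
  proof -
    obtain e where e: "m = (\<Sum>i\<le>n. e i * c i)" using m by (auto simp: S_def generated_semigroup_def)
    show ?thesis
    proof (intro exI[of _ "\<Sum>i\<le>n. e i"] allI impI)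
      fix r assume r: "(\<Sum>i\<le>n. e i) \<le> r"
      define e' where "e' = (\<lambda>i. if i \<le> n then (if i = piv then e i + (r - (\<Sum>i\<le>n. e i)) else e i) else 0)"
      define \<mu> where "\<mu> = Abs_poly_mapping e'"
      have "finite {i. e' i \<noteq> 0}" by (rule finite_subset[of _ "{..n}"]) (auto simp: e'_def)
      then have look: "Poly_Mapping.lookup \<mu> = e'" by (simp add: \<mu>_def Abs_poly_mapping_inverse)
      have keys: "Poly_Mapping.keys \<mu> \<subseteq> {..n}" by (auto simp: in_keys_iff look e'_def split: if_splits)
      have "(\<Sum>i\<in>Poly_Mapping.keys \<mu>. Poly_Mapping.lookup \<mu> i) = (\<Sum>i\<le>n. e' i)"
        unfolding look[symmetric] using keys by (intro sum.mono_neutral_left) (auto simp: in_keys_iff)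
      also have "\<dots> = (\<Sum>i\<le>n. e i + (if i = piv then r - (\<Sum>i\<le>n. e i) else 0))"
        by (intro sum.cong) (auto simp: e'_def)
      also have "\<dots> = r" using piv r by (simp add: sum.distrib)
      finally have deg: "(\<Sum>i\<in>Poly_Mapping.keys \<mu>. Poly_Mapping.lookup \<mu> i) = r" .
      have "(\<Prod>i\<in>Poly_Mapping.keys \<mu>. monom (1 :: 'k) (c i) ^ Poly_Mapping.lookup \<mu> i) =
          (\<Prod>i\<le>n. monom 1 (c i) ^ e' i)"
        unfolding look[symmetric] using keys by (intro prod.mono_neutral_left) (auto simp: in_keys_iff)
      also have "\<dots> = (\<Prod>i\<le>n. [:0, 1:] ^ (e i * c i))"
        using piv(2) by (intro prod.cong) (auto simp: e'_def monom_altdef mult.commute simp flip: power_mult)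
      also have "\<dots> = monom 1 m" by (simp add: e monom_altdef power_sum)
      finally have prod: "(\<Prod>i\<in>Poly_Mapping.keys \<mu>. monom (1 :: 'k) (c i) ^ Poly_Mapping.lookup \<mu> i) = monom 1 m" .
      let ?F = "Poly_Mapping.single \<mu> b"
      have "is_form n r ?F" using keys deg by (auto simp: is_form_def)
      moreover have "form_poly ?F = monom b m"
        unfolding form_poly_def using mpoly_eval_superset[of "{\<mu>}" ?F "\<lambda>b. [:b:]" "\<lambda>i. monom 1 (c i)"]
        by (simp add: prod smult_monom)
      ultimately show "\<exists>F. is_form n r F \<and> form_poly F = monom b m" by blast
    qed
  qed
  have "\<exists>r0. \<forall>r\<ge>r0. \<exists>F. is_form n r F \<and> form_poly F = (\<Sum>m\<in>I. monom (coeff f m) m)"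
    if "finite I" "I \<subseteq> S" for I
    using that
  proof (induction I rule: finite_induct)
    case empty
    have "is_form n r 0" "form_poly 0 = 0" for r by (simp_all add: is_form_def form_poly_def mpoly_eval_def)
    then show ?case by auto
  next
    case (insert m I)
    then obtain r0 where r0: "\<And>r. r \<ge> r0 \<Longrightarrow> \<exists>F. is_form n r F \<and> form_poly F = (\<Sum>m\<in>I. monom (coeff f m) m)"
      by auto
    obtain r1 where r1: "\<And>r. r \<ge> r1 \<Longrightarrow> \<exists>F. is_form n r F \<and> form_poly F = monom (coeff f m) m"
      using mono[of m "coeff f m"] insert.prems by auto
    show ?case
    proof (intro exI[of _ "max r0 r1"] allI impI)
      fix r assume "max r0 r1 \<le> r"
      then obtain F G where "is_form n r F" "form_poly F = (\<Sum>m\<in>I. monom (coeff f m) m)"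
        "is_form n r G" "form_poly G = monom (coeff f m) m"
        using r0[of r] r1[of r] by auto
      moreover have "form_poly (G + F) = form_poly G + form_poly F"
        unfolding form_poly_def by (rule mpoly_eval_add) simp_all
      ultimately show "\<exists>F. is_form n r F \<and> form_poly F = (\<Sum>m\<in>insert m I. monom (coeff f m) m)"
        using insert.hyps by (intro exI[of _ "G + F"]) (simp add: is_form_add)
    qed
  qed
  moreover have "f = (\<Sum>m\<in>{m. coeff f m \<noteq> 0}. monom (coeff f m) m)" "finite {m. coeff f m \<noteq> 0}"
  proof -
    have "{m. coeff f m \<noteq> 0} \<subseteq> {..degree f}" by (auto intro: le_degree)
    then show "finite {m. coeff f m \<noteq> 0}" by (rule finite_subset) simp
    have "(\<Sum>m\<in>{m. coeff f m \<noteq> 0}. monom (coeff f m) m) = (\<Sum>m\<le>degree f. monom (coeff f m) m)"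
      using \<open>{m. coeff f m \<noteq> 0} \<subseteq> {..degree f}\<close> by (intro sum.mono_neutral_left) auto
    then show "f = (\<Sum>m\<in>{m. coeff f m \<noteq> 0}. monom (coeff f m) m)" by (simp add: poly_as_sum_of_monoms)
  qed
  moreover have "{m. coeff f m \<noteq> 0} \<subseteq> S" using f by (auto simp: poly_supp_def)
  ultimately show ?thesis by metis
qed

text \<open>The localization of k[\<theta>^S] at the point: in a quotient of forms of equal degree
  the factor u^r cancels, and the dehomogenizations remain.\<close>

lemma local_ring_affine_point:
  "local_ring X (affine_point z) =
    {subst_rf \<theta> (Fract f g) | f g. f \<in> poly_supp S \<and> g \<in> poly_supp S \<and> poly g z \<noteq> 0}" (is "_ = ?R")
proof
  let ?ev = "mpoly_eval const_rf (\<lambda>i. to_fract (monom 1 (a i)))"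
  have quot: "u ^ r * peval f \<theta> / (u ^ r * peval g \<theta>) = subst_rf \<theta> (Fract f g)" if "poly g z \<noteq> 0" for r f g
  proof -
    have "g \<noteq> 0" using that by auto
    then show ?thesis using u_nz by (simp add: subst_Fract)
  qed
  show "local_ring X (affine_point z) \<subseteq> ?R"
  proof
    fix y assume "y \<in> local_ring X (affine_point z)"
    then obtain F G r and x :: "'k vec" where *: "y = ?ev F / ?ev G" "is_form n r F" "is_form n r G"
      "x \<in> affine_point z" "mpoly_eval id (\<lambda>i. x $ i) G \<noteq> 0"
      by (auto simp: monomial_curve_def)
    obtain b where x: "x = b \<cdot>\<^sub>v vec (n + 1) (\<lambda>i. z ^ c i)"
      using *(4) by (auto simp: affine_point_def proj_point_def)
    have "poly (form_poly G) z \<noteq> 0" using *(5) eval_form_point[OF *(3) x] by auto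
    moreover from this have "y = subst_rf \<theta> (Fract (form_poly F) (form_poly G))"
      unfolding *(1) eval_form[OF *(2)] eval_form[OF *(3)] by (rule quot)
    ultimately show "y \<in> ?R" using form_poly_supp *(2,3) by blast
  qed
  show "?R \<subseteq> local_ring X (affine_point z)"
  proof
    fix y assume "y \<in> ?R"
    then obtain f g where y: "y = subst_rf \<theta> (Fract f g)" "f \<in> poly_supp S" "g \<in> poly_supp S" "poly g z \<noteq> 0"
      by blast
    obtain r0 r1 where r: "\<And>r. r \<ge> r0 \<Longrightarrow> \<exists>F. is_form n r F \<and> form_poly F = f"
      "\<And>r. r \<ge> r1 \<Longrightarrow> \<exists>F. is_form n r F \<and> form_poly F = g"
      using poly_form[OF y(2)] poly_form[OF y(3)] by auto
    obtain F G where FG: "is_form n (max r0 r1) F" "form_poly F = f" "is_form n (max r0 r1) G" "form_poly G = g"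
      using r(1)[of "max r0 r1"] r(2)[of "max r0 r1"] by auto
    have "?ev F / ?ev G = y"
      unfolding eval_form[OF FG(1)] eval_form[OF FG(3)] FG(2,4) y(1) by (rule quot[OF y(4)])
    moreover have "vec (n + 1) (\<lambda>i. z ^ c i) \<in> affine_point z"
      unfolding affine_point_def by (rule mem_proj_point)
    moreover have "mpoly_eval id (\<lambda>i. vec (n + 1) (\<lambda>i. z ^ c i) $ i) G \<noteq> 0"
      using eval_form_point[OF FG(3), of "vec (n + 1) (\<lambda>i. z ^ c i)" 1 z] y(4) FG(4) by simp
    ultimately show "y \<in> local_ring X (affine_point z)"
      using FG(1,3) unfolding monomial_curve_def by auto
  qed
qed

text \<open>For z \<noteq> 0, expanding a fraction by t^cond moves numerator and denominator into
  the semigroup ring without creating a zero at z.\<close>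

lemma local_ring_smooth_point:
  assumes "z \<noteq> 0 \<or> S = UNIV"
  shows "local_ring X (affine_point z) = subst_rf \<theta> ` {x. at_least (ord_at z) 0 x}"
proof
  show "local_ring X (affine_point z) \<subseteq> subst_rf \<theta> ` {x. at_least (ord_at z) 0 x}"
  proof
    fix y assume "y \<in> local_ring X (affine_point z)"
    then obtain f g where y: "y = subst_rf \<theta> (Fract f g)" "poly g z \<noteq> 0"
      unfolding local_ring_affine_point by blast
    then have "g \<noteq> 0" by auto
    then have "at_least (ord_at z) 0 (Fract f g)"
      using y(2) by (cases "f = 0") (auto simp: at_least_def ord_at_Fract Fract_eq_0_iff order_0I)
    then show "y \<in> subst_rf \<theta> ` {x. at_least (ord_at z) 0 x}" using y(1) by blast
  qed
  show "subst_rf \<theta> ` {x. at_least (ord_at z) 0 x} \<subseteq> local_ring X (affine_point z)"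
  proof clarify
    fix x :: "'k ratfun" assume "at_least (ord_at z) 0 x"
    then obtain f g where x: "x = Fract f g" "poly g z \<noteq> 0" by (rule regular_Fract)
    show "subst_rf \<theta> x \<in> local_ring X (affine_point z)"
    proof (cases "S = UNIV")
      case True
      then have "f \<in> poly_supp S" "g \<in> poly_supp S" by (simp_all add: poly_supp_def)
      then show ?thesis unfolding local_ring_affine_point using x by blast
    next
      case False
      then have "z \<noteq> 0" using assms by blast
      then have "poly (monom 1 cond * g) z \<noteq> 0" using x(2) by (simp add: poly_monom)
      moreover have "x = Fract (monom 1 cond * f) (monom 1 cond * g)"
        unfolding x(1) by (rule mult_fract_cancel[symmetric]) simp
      ultimately show ?thesis
        unfolding local_ring_affine_point using supp_conductor by blast
    qed
  qed
qed

lemma span_powers: "rf.span ((\<lambda>s. \<theta> ^ s) ` S) = (\<lambda>f. peval f \<theta>) ` poly_supp S"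
proof
  have sub: "rf.subspace ((\<lambda>f. peval f \<theta>) ` poly_supp S)"
  proof (rule rf.subspaceI)
    show "0 \<in> (\<lambda>f. peval f \<theta>) ` poly_supp S" using supp_const[of 0] by force
  next
    fix x y assume "x \<in> (\<lambda>f. peval f \<theta>) ` poly_supp S" "y \<in> (\<lambda>f. peval f \<theta>) ` poly_supp S"
    then show "x + y \<in> (\<lambda>f. peval f \<theta>) ` poly_supp S"
      using supp_add by (force simp flip: peval_add)
  next
    fix b x assume "x \<in> (\<lambda>f. peval f \<theta>) ` poly_supp S"
    then show "scale_rf b x \<in> (\<lambda>f. peval f \<theta>) ` poly_supp S"
      using supp_smult by (force simp: scale_rf_def simp flip: peval_smult)
  qed
  have "\<theta> ^ s \<in> (\<lambda>f. peval f \<theta>) ` poly_supp S" if "s \<in> S" for s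
    using supp_monom[OF that, of 1] by (intro image_eqI[of _ _ "monom 1 s"]) auto
  then show "rf.span ((\<lambda>s. \<theta> ^ s) ` S) \<subseteq> (\<lambda>f. peval f \<theta>) ` poly_supp S"
    using sub by (intro rf.span_minimal) auto
  show "(\<lambda>f. peval f \<theta>) ` poly_supp S \<subseteq> rf.span ((\<lambda>s. \<theta> ^ s) ` S)"
  proof clarify
    fix f :: "'k poly" assume f: "f \<in> poly_supp S"
    have "const_rf (coeff f i) * \<theta> ^ i \<in> rf.span ((\<lambda>s. \<theta> ^ s) ` S)" for i
      using f by (cases "coeff f i = 0")
        (auto simp: poly_supp_def rf.span_zero simp flip: scale_rf_def intro!: rf.span_scale[OF rf.span_base])
    then show "peval f \<theta> \<in> rf.span ((\<lambda>s. \<theta> ^ s) ` S)" unfolding peval_altdef by (rule rf.span_sum)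
  qed
qed

text \<open>Up to order \<open>cond\<close> the fraction f / g equals f h, with h the truncated
  inverse of g. Conversely a remainder t^cond f / g, with g outside the semigroup ring, is expanded
  by an h for which g h = 1 - t^cond e lies in it.\<close>

lemma local_ring_origin:
  "local_ring X (affine_point 0) = {subst_rf \<theta> x | x. \<exists>y\<in>poly_supp S. at_least (ord_at 0) (int cond) (x - to_fract y)}"
proof
  show "local_ring X (affine_point 0) \<subseteq> {subst_rf \<theta> x | x. \<exists>y\<in>poly_supp S. at_least (ord_at 0) (int cond) (x - to_fract y)}"
  proof
    fix w assume "w \<in> local_ring X (affine_point 0)"
    then obtain f g where w: "w = subst_rf \<theta> (Fract f g)" "f \<in> poly_supp S" "g \<in> poly_supp S" "poly g 0 \<noteq> 0"
      unfolding local_ring_affine_point by blast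
    have g: "g \<noteq> 0" using w(4) by auto
    obtain h e where h: "h \<in> poly_supp S" "g * h = 1 - monom 1 cond * e"
      using truncated_inverse[OF w(3,4)] by blast
    have "f - f * h * g = monom 1 cond * (f * e)"
      using arg_cong[OF h(2), of "\<lambda>x. f * x"] by (simp add: algebra_simps)
    then have "Fract f g - to_fract (f * h) = Fract (monom 1 cond * (f * e)) g"
      using g by (simp add: to_fract_def)
    also have "at_least (ord_at 0) (int cond) \<dots>"
    proof (cases "f * e = 0")
      case False
      then have "monom 1 cond * (f * e) \<noteq> 0" by (simp only: mult_eq_0_iff monom_eq_0_iff) simp
      then show ?thesis
        using g w(4) False by (simp only: at_least_def ord_at_Fract order_mult order_0_monom one_neq_zero not_False_eq_True order_0I) simp
    qed (use g in \<open>simp add: at_least_def Fract_eq_0_iff\<close>)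
    finally show "w \<in> {subst_rf \<theta> x | x. \<exists>y\<in>poly_supp S. at_least (ord_at 0) (int cond) (x - to_fract y)}"
      using w(1) supp_mult[OF w(2) h(1)] by blast
  qed
  show "{subst_rf \<theta> x | x. \<exists>y\<in>poly_supp S. at_least (ord_at 0) (int cond) (x - to_fract y)} \<subseteq> local_ring X (affine_point 0)"
  proof clarify
    fix x :: "'k ratfun" and y :: "'k poly" assume y: "y \<in> poly_supp S" "at_least (ord_at 0) (int cond) (x - to_fract y)"
    let ?t = "to_fract (monom 1 cond) :: 'k ratfun"
    have t: "?t \<noteq> 0" "ord_at 0 ?t = int cond" by (simp_all add: ord_at_poly)
    have "at_least (ord_at 0) (int cond + - int cond) ((x - to_fract y) * inverse ?t)"
      using y(2) t by (intro ord_at.at_least_mult) (auto simp: at_least_def ord_at.v_inverse)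
    then have "at_least (ord_at 0) 0 ((x - to_fract y) / ?t)" by (simp add: divide_inverse)
    then obtain f g where fg: "(x - to_fract y) / ?t = Fract f g" "poly g 0 \<noteq> 0" by (rule regular_Fract)
    \<comment> \<open>The inverse is taken in the full polynomial ring, as g need not lie in
      k[t^S].\<close>
    interpret U: numerical_semigroup UNIV cond by (rule numerical_semigroup_UNIV)
    have "g \<in> poly_supp UNIV" by (simp add: poly_supp_def)
    then obtain h e where h: "g * h = 1 - monom 1 cond * e" using U.truncated_inverse[OF _ fg(2)] by blast
    have gh: "g * h \<in> poly_supp S" unfolding h by (intro supp_diff supp_one supp_conductor)
    have g: "g \<noteq> 0" using fg(2) by auto
    have "x = to_fract y + ?t * (to_fract f / to_fract g)"
      using fg(1) t(1) by (simp add: Fract_conv_to_fract field_simps)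
    moreover have hnz: "poly (g * h) 0 \<noteq> 0" if "cond > 0" using that by (simp add: h poly_monom power_0_left)
    show "subst_rf \<theta> x \<in> local_ring X (affine_point 0)"
    \<comment> \<open>For cond = 0 the denominator 1 - t^cond e may vanish at 0, but then
      \<open>S\<close> is everything.\<close>
    proof (cases "cond > 0")
      case True
      then have "h \<noteq> 0" using hnz by auto
      then have "x = Fract (y * (g * h) + monom 1 cond * (f * h)) (g * h)"
      proof -
        have "x * (to_fract g * to_fract h) =
            to_fract y * (to_fract g * to_fract h) + ?t * (to_fract f * to_fract h)"
          using calculation g by (simp add: distrib_right)
        then show ?thesis using g \<open>h \<noteq> 0\<close>
          by (simp add: Fract_conv_to_fract eq_divide_eq del: mult_cancel_left mult_cancel_right)
      qed
      moreover have "y * (g * h) + monom 1 cond * (f * h) \<in> poly_supp S"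
        by (intro supp_add supp_mult[OF y(1) gh] supp_conductor)
      ultimately show ?thesis unfolding local_ring_affine_point using gh hnz[OF True] by blast
    next
      case False
      then have S: "S = UNIV" using conductor by auto
      have "at_least (ord_at 0) 0 (to_fract y)"
        by (cases "y = 0") (simp_all add: at_least_def ord_at_poly)
      then have "at_least (ord_at 0) 0 ((x - to_fract y) + to_fract y)"
        using y(2) False by (intro ord_at.at_least_add) simp_all
      then show ?thesis using local_ring_smooth_point[of 0] S by simp
    qed
  qed
qed

text \<open>Orders in the local ring lie in \<open>S\<close>. If the maximal ideal had a generator
  of order \<zeta>, every positive element of \<open>S\<close> would be \<zeta> plus an element of
  \<open>S\<close>.\<close>

lemma singular_origin:
  assumes "S \<noteq> UNIV"
  shows "singular X (affine_point 0)"
  unfolding singular_def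
proof
  let ?R = "local_ring X (affine_point 0)"
  assume "\<exists>z\<in>?R. max_ideal X (affine_point 0) = {x * z | x. x \<in> ?R}"
  then obtain z where z: "z \<in> ?R" "max_ideal X (affine_point 0) = {x * z | x. x \<in> ?R}" by blast
  have val: "\<exists>x. y = subst_rf \<theta> x \<and> (x = 0 \<or> (\<exists>s\<in>S. ord_at 0 x = int s))" if "y \<in> ?R" for y
  proof -
    obtain f g where y: "y = subst_rf \<theta> (Fract f g)" "f \<in> poly_supp S" "poly g 0 \<noteq> 0"
      using \<open>y \<in> ?R\<close> unfolding local_ring_affine_point by blast
    have g: "g \<noteq> 0" using y(3) by auto
    show ?thesis
    proof (cases "f = 0")
      case True
      then show ?thesis using y(1) g by (intro exI[of _ "Fract f g"]) (simp add: Fract_eq_0_iff)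
    next
      case False
      then have "Polynomial.order 0 f \<in> S" using order_0_coeff y(2) by (auto simp: poly_supp_def)
      then show ?thesis using y(1,3) g False
        by (intro exI[of _ "Fract f g"]) (auto simp: ord_at_Fract order_0I)
    qed
  qed
  have mono: "\<theta> ^ s \<in> max_ideal X (affine_point 0)" if s: "s \<in> S" "s > 0" for s
  proof -
    have "subst_rf \<theta> (Fract (monom 1 s) 1) \<in> ?R"
      unfolding local_ring_affine_point using supp_monom[OF s(1), of 1] supp_one by force
    then have mem: "\<theta> ^ s \<in> ?R" by (simp add: subst_Fract)
    have "\<theta> ^ s * y \<noteq> 1" if y: "y \<in> ?R" for y
    proof
      assume eq: "\<theta> ^ s * y = 1"
      obtain x where x: "y = subst_rf \<theta> x" "x = 0 \<or> (\<exists>s\<in>S. ord_at 0 x = int s)" using val[OF y] by blast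
      have "subst_rf \<theta> (var_rf ^ s * x) = subst_rf \<theta> 1" using eq x(1) by (simp add: subst_mult subst_power)
      then have 1: "var_rf ^ s * x = 1" by (rule injD[OF inj_subst])
      then have "x \<noteq> 0" by auto
      then have "ord_at 0 (var_rf ^ s * x) = int s + ord_at 0 x"
        by (simp add: ord_at.v_mult ord_at.v_power ord_at_var)
      then show False using 1 x(2) \<open>x \<noteq> 0\<close> s(2) by auto
    qed
    then show ?thesis using mem by (auto simp: max_ideal_def)
  qed
  obtain \<xi> where \<xi>: "z = subst_rf \<theta> \<xi>" "\<xi> = 0 \<or> (\<exists>s\<in>S. ord_at 0 \<xi> = int s)" using val[OF z(1)] by blast
  have fact: "\<xi> \<noteq> 0 \<and> (\<exists>s'\<in>S. ord_at 0 \<xi> + int s' = int s)" if s: "s \<in> S" "s > 0" for s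
  proof -
    obtain y where y: "y \<in> ?R" "\<theta> ^ s = y * z" using mono[OF s] z(2) by blast
    obtain x where x: "y = subst_rf \<theta> x" "x = 0 \<or> (\<exists>s\<in>S. ord_at 0 x = int s)" using val[OF y(1)] by blast
    have "subst_rf \<theta> (var_rf ^ s) = subst_rf \<theta> (x * \<xi>)" using y(2) x(1) \<xi>(1) by (simp add: subst_mult subst_power)
    then have eq: "var_rf ^ s = x * \<xi>" by (rule injD[OF inj_subst])
    have nz: "x \<noteq> 0" "\<xi> \<noteq> 0" using eq by auto
    then have "ord_at 0 (x * \<xi>) = ord_at 0 x + ord_at 0 \<xi>" by (simp add: ord_at.v_mult)
    moreover have "ord_at 0 (var_rf ^ s :: 'k ratfun) = int s" by (simp add: ord_at.v_power ord_at_var)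
    ultimately have "ord_at 0 x + ord_at 0 \<xi> = int s" using eq by simp
    moreover obtain s' where "s' \<in> S" "ord_at 0 x = int s'" using x(2) nz by blast
    ultimately show ?thesis using nz by (intro conjI bexI[of _ s']) auto
  qed
  have "\<xi> \<noteq> 0" using fact[of "Suc cond"] conductor by auto
  then obtain \<zeta> where \<zeta>: "\<zeta> \<in> S" "ord_at 0 \<xi> = int \<zeta>" using \<xi>(2) by blast
  \<comment> \<open>An element of order 0 has an inverse in the local ring and cannot lie in the
    maximal ideal.\<close>
  have "\<zeta> > 0"
  proof (rule ccontr)
    assume "\<not> \<zeta> > 0"
    then have o: "ord_at 0 \<xi> = 0" using \<zeta> by simp
    have "z \<in> max_ideal X (affine_point 0)"
    proof -
      have "1 \<in> ?R" unfolding local_ring_affine_point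
        using supp_one by (intro CollectI exI[of _ 1]) (simp add: subst_Fract)
      then have "1 * z \<in> max_ideal X (affine_point 0)" unfolding z(2) by blast
      then show ?thesis by simp
    qed
    then have nu: "\<not> (\<exists>y\<in>?R. z * y = 1)" by (simp add: max_ideal_def)
    obtain f g where fg: "z = subst_rf \<theta> (Fract f g)" "f \<in> poly_supp S" "g \<in> poly_supp S" "poly g 0 \<noteq> 0"
      using z(1) unfolding local_ring_affine_point by blast
    have g: "g \<noteq> 0" using fg(4) by auto
    have "subst_rf \<theta> \<xi> = subst_rf \<theta> (Fract f g)" using \<xi>(1) fg(1) by simp
    then have xi: "\<xi> = Fract f g" by (rule injD[OF inj_subst])
    have f: "f \<noteq> 0" using \<open>\<xi> \<noteq> 0\<close> xi g by (auto simp: Fract_eq_0_iff)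
    have "Polynomial.order 0 f = 0" using o f g fg(4) by (simp add: xi ord_at_Fract order_0I)
    then have "poly f 0 \<noteq> 0" using order_root[of f 0] f by blast
    then have "subst_rf \<theta> (Fract g f) \<in> ?R" unfolding local_ring_affine_point using fg by blast
    moreover have "z * subst_rf \<theta> (Fract g f) = 1"
      using f g peval_nonzero by (simp add: fg(1) subst_Fract)
    ultimately show False using nu by blast
  qed
  moreover have "\<exists>s'\<in>S. s = \<zeta> + s'" if "s \<in> S" "s > 0" for s
    using fact[OF that] \<zeta>(2) by (auto simp flip: of_nat_add)
  ultimately have "S = UNIV" by (rule translate_imp_UNIV)
  then show False using assms by blast
qed

end

section \<open>The exchange of 0 and infinity\<close>

interpretation flip: transcendental_element "inverse var_rf :: 'k::field ratfun"
  by unfold_locales (simp_all add: ord_at.v_inverse ord_at_var)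

lemma ord_at_flip_poly:
  fixes f :: "'k::field poly"
  assumes "f \<noteq> 0"
  shows "ord_at 0 (peval f (inverse var_rf)) = - int (degree f)"
proof -
  let ?w = "inverse var_rf :: 'k ratfun"
  have w: "ord_at 0 (?w ^ i) = - int i" for i
    by (simp add: ord_at.v_power ord_at.v_inverse ord_at_var)
  let ?top = "const_rf (lead_coeff f) * ?w ^ degree f" and ?low = "\<Sum>i<degree f. const_rf (coeff f i) * ?w ^ i"
  have top: "?top \<noteq> 0" "ord_at 0 ?top = - int (degree f)"
    using assms w by (simp_all add: ord_at.v_mult ord_at.v_const del: power_inverse)
  have "at_least (ord_at 0) (- int (degree f) + 1) (const_rf (coeff f i) * ?w ^ i)" if "i < degree f" for i
  proof -
    have "at_least (ord_at 0) (0 + (- int (degree f) + 1)) (const_rf (coeff f i) * ?w ^ i)"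
      using that by (intro ord_at.at_least_mult ord_at.at_least_const) (simp_all add: at_least_def w del: power_inverse)
    then show ?thesis by simp
  qed
  then have "at_least (ord_at 0) (ord_at 0 ?top + 1) ?low"
    unfolding top(2) by (intro ord_at.at_least_sum) auto
  then have "ord_at 0 (?top + ?low) = ord_at 0 ?top" using ord_at.v_add_eq[of ?top ?low] top(1) by simp
  moreover have "peval f ?w = ?top + ?low"
    unfolding peval_altdef by (simp add: lessThan_Suc_atMost[symmetric] del: power_inverse)
  ultimately show ?thesis using top(2) by simp
qed

lemma ord_at_flip: "x \<noteq> 0 \<Longrightarrow> ord_at 0 (subst_rf (inverse var_rf) x) = ord_inf (x :: 'k::field ratfun)"
proof -
  assume "x \<noteq> 0"
  then obtain f g where x: "x = Fract f g" "f \<noteq> 0" "g \<noteq> 0" by (cases x rule: Fract_nonzero_cases) auto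
  have "ord_at 0 (peval f (inverse var_rf) / peval g (inverse var_rf)) = int (degree g) - int (degree f)"
    using x flip.peval_nonzero by (subst ord_at.v_divide) (simp_all add: ord_at_flip_poly)
  then show ?thesis unfolding x(1) flip.subst_Fract[OF x(3)] ord_inf_Fract[OF x(2,3)] .
qed

lemma flip_flip: "subst_rf (inverse var_rf) (subst_rf (inverse var_rf) x) = (x :: 'k::field ratfun)"
proof -
  obtain f g where x: "x = Fract f g" "g \<noteq> 0" using flip.Fract_cases2 by blast
  have "subst_rf (inverse var_rf) (peval f (inverse var_rf)) = to_fract f" for f :: "'k poly"
    by (simp add: flip.subst_peval flip.subst_inverse peval_var)
  then show ?thesis
    unfolding x(1) flip.subst_Fract[OF x(2)] flip.subst_divide by (simp only: Fract_conv_to_fract)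
qed

lemma flip_regular:
  "subst_rf (inverse var_rf) ` {x. at_least (ord_at 0) 0 x} = {x :: 'k::field ratfun. at_least ord_inf 0 x}"
proof -
  have *: "at_least (ord_at 0) 0 (subst_rf (inverse var_rf) x) \<longleftrightarrow> at_least ord_inf 0 x" for x :: "'k ratfun"
    by (cases "x = 0") (simp_all add: at_least_def ord_at_flip)
  show ?thesis
  proof (intro Set.set_eqI iffI)
    fix x :: "'k ratfun" assume "x \<in> subst_rf (inverse var_rf) ` {x. at_least (ord_at 0) 0 x}"
    then obtain y where "x = subst_rf (inverse var_rf) y" "at_least (ord_at 0) 0 y" by blast
    then show "x \<in> {x. at_least ord_inf 0 x}" using *[of x] by (simp add: flip_flip)
  next
    fix x :: "'k ratfun" assume "x \<in> {x. at_least ord_inf 0 x}"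
    then have "subst_rf (inverse var_rf) x \<in> {x. at_least (ord_at 0) 0 x}" using *[of x] by simp
    then show "x \<in> subst_rf (inverse var_rf) ` {x. at_least (ord_at 0) 0 x}"
      by (metis flip_flip imageI)
  qed
qed

text \<open>The far point of the first chart is the origin of the second, whose semigroup has no
  gaps; so only the origin of the first chart may be singular.\<close>

locale complementary_charts = monomial_chart \<theta> n a c piv q u + far: monomial_chart "inverse \<theta>" n a c' piv' q' u'
  for \<theta> :: "'k::alg_closed_field ratfun" and n a c piv q u c' piv' q' u' +
  assumes far_S: "far.S = UNIV" and far_point_eq: "far_point = far.affine_point 0"
begin

text \<open>Substituting the inverse of \<theta> amounts to exchanging t with its inverse and then
  substituting \<theta>; the exchange turns the order at 0 into the order at infinity.\<close>

lemma local_ring_far_point: "local_ring X far_point = subst_rf \<theta> ` {x. at_least ord_inf 0 x}"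
proof -
  have eq: "subst_rf (inverse \<theta>) x = subst_rf \<theta> (subst_rf (inverse var_rf) x)" for x
  proof -
    obtain f g where x: "x = Fract f g" "g \<noteq> 0" using flip.Fract_cases2 by blast
    have "subst_rf \<theta> (peval f (inverse var_rf)) = peval f (inverse \<theta>)" for f
      by (simp add: subst_peval subst_inverse)
    then show ?thesis using x(2)
      unfolding x(1) by (simp add: far.subst_Fract flip.subst_Fract subst_divide)
  qed
  have "local_ring X far_point = subst_rf (inverse \<theta>) ` {x. at_least (ord_at 0) 0 x}"
    unfolding far_point_eq by (rule far.local_ring_smooth_point) (simp add: far_S)
  also have "\<dots> = subst_rf \<theta> ` subst_rf (inverse var_rf) ` {x. at_least (ord_at 0) 0 x}"
    by (simp add: image_image eq)
  finally show ?thesis by (simp only: flip_regular)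
qed

definition val :: "'k vec set \<Rightarrow> 'k ratfun \<Rightarrow> int" where
  "val Q x = (if Q = far_point then ord_inf (inv_into UNIV (subst_rf \<theta>) x)
    else ord_at (THE z. Q = affine_point z) (inv_into UNIV (subst_rf \<theta>) x))"

lemma val_far: "val far_point = (\<lambda>x. ord_inf (inv_into UNIV (subst_rf \<theta>) x))"
  by (simp add: val_def fun_eq_iff)

lemma val_affine: "val (affine_point z) = (\<lambda>x. ord_at z (inv_into UNIV (subst_rf \<theta>) x))"
proof -
  have "(THE y. affine_point z = affine_point y) = z"
    using inj_affine_point by (intro the_equality) (auto dest: injD)
  then show ?thesis using far_point_neq by (simp add: val_def fun_eq_iff)
qed

lemma at_least_val:
  "at_least (val far_point) i (subst_rf \<theta> x) \<longleftrightarrow> at_least ord_inf i x"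
  "at_least (val (affine_point z)) i (subst_rf \<theta> x) \<longleftrightarrow> at_least (ord_at z) i x"
  by (simp_all add: at_least_def val_far val_affine)

lemma function_field_eq: "function_field X = range (subst_rf \<theta>)"
proof
  have sub: "local_ring X P \<subseteq> range (subst_rf \<theta>)" if "P \<in> points X" for P
    using that local_ring_far_point local_ring_affine_point unfolding points_eq by auto
  interpret R: const_subfield "range (subst_rf \<theta>)" by (rule const_subfield_range)
  show "function_field X \<subseteq> range (subst_rf \<theta>)"
  proof
    fix w assume "w \<in> function_field X"
    then obtain x y P where "w = x / y" "P \<in> points X" "x \<in> local_ring X P" "y \<in> local_ring X P"
      unfolding function_field_def by blast
    then show "w \<in> range (subst_rf \<theta>)" using sub[of P] R.divide_mem[of x y] by blast
  qed
  show "range (subst_rf \<theta>) \<subseteq> function_field X"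
  proof
    fix y assume "y \<in> range (subst_rf \<theta>)"
    then obtain x where x: "y = subst_rf \<theta> x" by blast
    obtain f g where fg: "x = Fract f g" "g \<noteq> 0" using Fract_cases2 by blast
    \<comment> \<open>After expansion by t^cond, numerator and denominator lie in the local ring at
      the origin.\<close>
    have mem: "peval (monom 1 cond * f) \<theta> \<in> local_ring X (affine_point 0)" for f
    proof -
      have "subst_rf \<theta> (Fract (monom 1 cond * f) 1) \<in> local_ring X (affine_point 0)"
        unfolding local_ring_affine_point using supp_conductor[of f] supp_one by force
      then show ?thesis by (simp only: subst_Fract one_neq_zero not_False_eq_True peval_1 div_by_1)
    qed
    have "monom 1 cond * g \<noteq> 0" using fg(2) by (simp only: mult_eq_0_iff monom_eq_0_iff) simp
    then have "peval (monom 1 cond * g) \<theta> \<noteq> 0" by (rule peval_nonzero)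
    moreover have "y = peval (monom 1 cond * f) \<theta> / peval (monom 1 cond * g) \<theta>"
      using fg \<theta>_nz by (simp add: x subst_Fract)
    moreover have "affine_point 0 \<in> points X" by (simp add: points_eq)
    ultimately show "y \<in> function_field X" unfolding function_field_def using mem by blast
  qed
qed

lemma unibranch: "unibranch_curve (range (subst_rf \<theta>)) X val (affine_point 0) far_point \<theta> S cond"
proof -
  interpret R: const_subfield "range (subst_rf \<theta>)" by (rule const_subfield_range)
  have pts: "P = far_point \<or> (\<exists>z. P = affine_point z)" if "P \<in> points X" for P
    using that unfolding points_eq by blast
  have aff: "affine_point z \<in> points X" for z by (simp add: points_eq)
  have neq: "far_point \<noteq> affine_point z" for z using far_point_neq by metis
  have aeq: "affine_point z = affine_point z' \<longleftrightarrow> z = z'" for z z'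
    using inj_affine_point by (rule inj_eq)
  show ?thesis
  proof (rule unibranch_curve.intro[OF const_subfield_range], rule unibranch_curve_axioms.intro)
    show "function_field X = range (subst_rf \<theta>)" by (rule function_field_eq)
    show "far_point \<in> points X" by (simp add: points_eq)
    show "affine_point 0 \<in> points X" by (rule aff)
    show "affine_point 0 \<noteq> far_point" by (rule far_point_neq)
    show "\<theta> \<in> range (subst_rf \<theta>)" using subst_var by (metis rangeI)
    have \<theta>: "inv_into UNIV (subst_rf \<theta>) \<theta> = var_rf" using inv_subst[of var_rf] by simp
    show "val (affine_point 0) \<theta> = 1" "val far_point \<theta> = - 1"
      using ord_inf_linear[of "0 :: 'k"] by (simp_all add: val_affine val_far \<theta> ord_at_var)
    show "\<theta> \<noteq> 0" by (rule \<theta>_nz)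
    show "val P \<theta> = 0" if Q: "P \<in> points X" "P \<noteq> affine_point 0" "P \<noteq> far_point" for P
    proof -
      obtain z where z: "P = affine_point z" using pts[OF Q(1)] Q(3) by blast
      then have "z \<noteq> 0" using Q(2) by blast
      then show ?thesis by (simp add: z val_affine \<theta> ord_at_var)
    qed
    show "rf_valuation (range (subst_rf \<theta>)) (val P)" if "P \<in> points X" for P
      using pts[OF that] valuation_range[OF ord_inf.rf_valuation_axioms]
        valuation_range[OF ord_at.rf_valuation_axioms] by (auto simp: val_far val_affine)
    show "\<exists>u\<in>range (subst_rf \<theta>). u \<noteq> 0 \<and> val P u = 1" if "P \<in> points X" for P
      using pts[OF that]
    proof
      assume "P = far_point"
      then show ?thesis
        by (intro bexI[of _ "subst_rf \<theta> (inverse var_rf)"]) (simp_all add: val_far ord_inf_var)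
    next
      assume "\<exists>z. P = affine_point z"
      then obtain z where "P = affine_point z" ..
      then show ?thesis
        by (intro bexI[of _ "subst_rf \<theta> (to_fract [:- z, 1:])"]) (simp_all add: val_affine ord_at_linear)
    qed
    show "finite {P \<in> points X. \<not> at_least (val P) 0 y}" if y: "y \<in> range (subst_rf \<theta>)" for y
    proof -
      obtain x where x: "y = subst_rf \<theta> x" using y by blast
      have "P \<in> insert far_point (affine_point ` {z. \<not> at_least (ord_at z) 0 x})"
        if P: "P \<in> points X" "\<not> at_least (val P) 0 y" for P
      proof (cases "P = far_point")
        case False
        then obtain z where z: "P = affine_point z" using pts[OF P(1)] by blast
        then have "\<not> at_least (ord_at z) 0 x" using P(2) by (simp add: x at_least_val)
        then show ?thesis using z by blast
      qed blast
      then have "{P \<in> points X. \<not> at_least (val P) 0 y} \<subseteq>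
          insert far_point (affine_point ` {z. \<not> at_least (ord_at z) 0 x})" by blast
      then show ?thesis by (rule finite_subset) (simp add: finite_ord_at_poles)
    qed
    show "\<exists>b. y = const_rf b"
      if y: "y \<in> range (subst_rf \<theta>)" and r: "\<And>P. P \<in> points X \<Longrightarrow> at_least (val P) 0 y" for y
    proof -
      obtain x where x: "y = subst_rf \<theta> x" using y by blast
      have "at_least ord_inf 0 x" using r[of far_point] by (simp add: x at_least_val points_eq)
      moreover have "at_least (ord_at z) 0 x" for z using r[OF aff, of z] by (simp add: x at_least_val)
      ultimately obtain b where "x = const_rf b" using regular_everywhere_const by blast
      then show ?thesis using x by auto
    qed
    show "\<exists>w\<in>range (subst_rf \<theta>). at_least (val P) 0 (y - w) \<and> (\<forall>Q\<in>points X - {P}. at_least (val Q) 0 w)"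
      if P: "P \<in> points X" and y: "y \<in> range (subst_rf \<theta>)" for P y
    proof -
      obtain x where x: "y = subst_rf \<theta> x" using y by blast
      show ?thesis using pts[OF P]
      proof
        assume far: "P = far_point"
        obtain w where w: "at_least ord_inf 0 (x - w)" "\<And>z. at_least (ord_at z) 0 w"
          using principal_part_inf by blast
        have "at_least (val Q) 0 (subst_rf \<theta> w)" if "Q \<in> points X - {P}" for Q
          using pts[of Q] that far w(2) by (auto simp: at_least_val)
        then show ?thesis using w(1)
          by (intro bexI[of _ "subst_rf \<theta> w"]) (simp_all add: x far at_least_val flip: subst_diff)
      next
        assume "\<exists>z. P = affine_point z"
        then obtain z where z: "P = affine_point z" ..
        obtain w where w: "at_least (ord_at z) 0 (x - w)" "\<And>z'. z' \<noteq> z \<Longrightarrow> at_least (ord_at z') 0 w"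
          "at_least ord_inf 0 w"
          using principal_part_at by blast
        have "at_least (val Q) 0 (subst_rf \<theta> w)" if Q: "Q \<in> points X - {P}" for Q
        proof (cases "Q = far_point")
          case False
          then obtain z' where "Q = affine_point z'" using pts[of Q] Q by blast
          then show ?thesis using w(2)[of z'] Q z by (auto simp: at_least_val)
        qed (simp add: at_least_val w(3))
        then show ?thesis using w(1)
          by (intro bexI[of _ "subst_rf \<theta> w"]) (simp_all add: x z at_least_val flip: subst_diff)
      qed
    qed
    show "0 \<in> S" "\<And>s s'. s \<in> S \<Longrightarrow> s' \<in> S \<Longrightarrow> s + s' \<in> S" "\<And>s. cond \<le> s \<Longrightarrow> s \<in> S"
      by (fact zero_mem add_mem conductor)+
    show "local_ring X P = {x \<in> range (subst_rf \<theta>). at_least (val P) 0 x}"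
      if P: "P \<in> points X" "P \<noteq> affine_point 0" for P
      using pts[OF P(1)]
    proof
      assume "P = far_point"
      then show ?thesis unfolding \<open>P = far_point\<close> local_ring_far_point by (auto simp: at_least_val)
    next
      assume "\<exists>z. P = affine_point z"
      then obtain z where z: "P = affine_point z" ..
      then have "z \<noteq> 0" using P(2) by auto
      then have "local_ring X P = subst_rf \<theta> ` {x. at_least (ord_at z) 0 x}"
        unfolding z by (intro local_ring_smooth_point) simp
      then show ?thesis by (auto simp: z at_least_val)
    qed
    show "local_ring X (affine_point 0) =
      {x \<in> range (subst_rf \<theta>). \<exists>y\<in>rf.span ((\<lambda>s. \<theta> ^ s) ` S). at_least (val (affine_point 0)) (int cond) (x - y)}"
    proof -
      have eq: "(\<exists>y\<in>rf.span ((\<lambda>s. \<theta> ^ s) ` S). at_least (val (affine_point 0)) (int cond) (subst_rf \<theta> x - y)) \<longleftrightarrow>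
          (\<exists>f\<in>poly_supp S. at_least (ord_at 0) (int cond) (x - to_fract f))" for x
      proof -
        have "at_least (val (affine_point 0)) (int cond) (subst_rf \<theta> x - peval f \<theta>) \<longleftrightarrow>
            at_least (ord_at 0) (int cond) (x - to_fract f)" for f
          using at_least_val(2)[of 0 "int cond" "x - to_fract f"] by (simp only: subst_diff subst_to_fract)
        then show ?thesis unfolding span_powers by simp
      qed
      show ?thesis unfolding local_ring_origin eq[symmetric] by blast
    qed
  qed
qed

end

text \<open>With fewer chains than elements some chain has two members, so \<delta> is a difference
  of two multiples of d and thus itself a multiple of d.\<close>

lemma chain_number_dilate:
  assumes L: "finite L" and d: "d > 0" and e: "e < card L"
  shows "(\<exists>\<delta>>0. chain_number ((*) d ` L) \<delta> \<le> e) \<longleftrightarrow> (\<exists>\<delta>>0. chain_number L \<delta> \<le> e)"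
proof -
  let ?E = "(*) d ` L"
  have inj: "inj_on ((*) d) M" for M using d by (simp add: inj_on_def)
  have dil: "chain_number ?E (d * \<delta>) = chain_number L \<delta>" for \<delta>
  proof -
    have "d * l + d * \<delta> \<in> ?E \<longleftrightarrow> l + \<delta> \<in> L" for l
      using d by (auto simp: image_iff simp flip: distrib_left)
    then have "{x \<in> ?E. x + d * \<delta> \<notin> ?E} = (*) d ` {l \<in> L. l + \<delta> \<notin> L}" by blast
    then show ?thesis unfolding chain_number_def by (simp add: card_image[OF inj])
  qed
  show ?thesis
  proof
    assume "\<exists>\<delta>>0. chain_number ?E \<delta> \<le> e"
    then obtain \<delta> where \<delta>: "\<delta> > 0" "chain_number ?E \<delta> \<le> e" by blast
    have "{x \<in> ?E. x + \<delta> \<notin> ?E} \<noteq> ?E"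
    proof
      assume "{x \<in> ?E. x + \<delta> \<notin> ?E} = ?E"
      then have "chain_number ?E \<delta> = card ?E" by (simp add: chain_number_def)
      then show False using \<delta>(2) e by (simp add: card_image[OF inj])
    qed
    then obtain l l' where "d * l + \<delta> = d * l'" by blast
    then have "d dvd d * l + \<delta>" by simp
    then have "d dvd \<delta>" by (simp only: dvd_add_right_iff[OF dvd_triv_left])
    then obtain k where k: "\<delta> = d * k" by (auto simp: dvd_def)
    then show "\<exists>\<delta>>0. chain_number L \<delta> \<le> e" using \<delta> dil[of k] by (intro exI[of _ k]) auto
  next
    assume "\<exists>\<delta>>0. chain_number L \<delta> \<le> e"
    then obtain \<delta> where "\<delta> > 0" "chain_number L \<delta> \<le> e" by blast
    then show "\<exists>\<delta>>0. chain_number ?E \<delta> \<le> e" using dil[of \<delta>] d by (intro exI[of _ "d * \<delta>"]) simp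
  qed
qed

text \<open>Reflection turns the shift by \<delta> into the shift by -\<delta>, for which the count
  is the same.\<close>

lemma chain_number_reflect:
  assumes L: "finite L" "L \<subseteq> {..M}" and \<delta>: "\<delta> > 0"
  shows "chain_number ((\<lambda>l. M - l) ` L) \<delta> = chain_number L \<delta>"
proof -
  let ?E = "(\<lambda>l. M - l) ` L"
  have E: "int ` ?E = (\<lambda>x. int M - x) ` int ` L"
    unfolding image_image using L(2) by (intro image_cong) (auto simp: of_nat_diff)
  have "(\<lambda>n. n + int \<delta>) ` int ` ?E - int ` ?E = (\<lambda>x. int M - x) ` ((\<lambda>n. n + - int \<delta>) ` int ` L - int ` L)"
  proof -
    have "inj (\<lambda>x. int M - x)" by (simp add: inj_def)
    then have "(\<lambda>x. int M - x) ` ((\<lambda>n. n + - int \<delta>) ` int ` L - int ` L) =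
        (\<lambda>x. int M - x) ` (\<lambda>n. n + - int \<delta>) ` int ` L - (\<lambda>x. int M - x) ` int ` L"
      by (rule image_set_diff)
    moreover have "(\<lambda>x. int M - x) ` (\<lambda>n. n + - int \<delta>) ` int ` L = (\<lambda>n. n + int \<delta>) ` (\<lambda>x. int M - x) ` int ` L"
      unfolding image_image by (intro image_cong) auto
    ultimately show ?thesis unfolding E by simp
  qed
  then have "card ((\<lambda>n. n + int \<delta>) ` int ` ?E - int ` ?E) = card ((\<lambda>n. n + - int \<delta>) ` int ` L - int ` L)"
    by (simp add: card_image inj_on_def)
  then show ?thesis
    using card_shift_eq_chain_number[of ?E "int \<delta>"] card_shift_eq_chain_number[of L "- int \<delta>"] L \<delta> by simp
qed

lemma chain_number_reflect_dilate:
  assumes L: "finite L" "L \<subseteq> {..M}" and d: "d > 0" and e: "e < card L"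
  shows "(\<exists>\<delta>>0. chain_number ((\<lambda>l. d * (M - l)) ` L) \<delta> \<le> e) \<longleftrightarrow> (\<exists>\<delta>>0. chain_number L \<delta> \<le> e)"
proof -
  let ?R = "(\<lambda>l. M - l) ` L"
  have "inj_on (\<lambda>l. M - l) L" using L(2) by (intro inj_onI) (metis atMost_iff diff_diff_cancel subsetD)
  then have card: "card ?R = card L" by (rule card_image)
  have "(\<lambda>l. d * (M - l)) ` L = (*) d ` ?R" by (simp add: image_image)
  then have "(\<exists>\<delta>>0. chain_number ((\<lambda>l. d * (M - l)) ` L) \<delta> \<le> e) \<longleftrightarrow> (\<exists>\<delta>>0. chain_number ?R \<delta> \<le> e)"
    using chain_number_dilate[of ?R d e] L d e card by simp
  also have "\<dots> \<longleftrightarrow> (\<exists>\<delta>>0. chain_number L \<delta> \<le> e)"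
    using chain_number_reflect[OF L] by auto
  finally show ?thesis .
qed

lemma hom_eval_1: "hom_eval D p 1 z = poly p z" if "degree p \<le> D"
proof -
  have "hom_eval D p 1 z = (\<Sum>i\<le>D. coeff p i * z ^ i)" by (simp add: hom_eval_def)
  also have "\<dots> = (\<Sum>i\<le>degree p. coeff p i * z ^ i)"
    using that by (intro sum.mono_neutral_right) (auto simp: coeff_eq_0)
  finally show ?thesis by (simp add: poly_altdef)
qed

lemma subspace_vanishing: "rf.subspace (to_fract ` {f :: 'k::field poly. poly f z = 0})"
proof (rule rf.subspaceI)
  fix b and x :: "'k ratfun" assume "x \<in> to_fract ` {f. poly f z = 0}"
  then obtain f where f: "x = to_fract f" "poly f z = 0" by blast
  then show "scale_rf b x \<in> to_fract ` {f. poly f z = 0}"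
    by (intro image_eqI[of _ _ "[:b:] * f"]) (auto simp only: to_fract_mult scale_rf_def const_rf_def poly_mult mult_zero_right mem_Collect_eq)
next
  fix x y :: "'k ratfun" assume "x \<in> to_fract ` {f. poly f z = 0}" "y \<in> to_fract ` {f. poly f z = 0}"
  then obtain f g where "x = to_fract f" "poly f z = 0" "y = to_fract g" "poly g z = 0" by blast
  then show "x + y \<in> to_fract ` {f. poly f z = 0}" by (intro image_eqI[of _ _ "f + g"]) auto
qed (intro image_eqI[of _ _ 0], auto)

text \<open>The factor \<open>V\<close> clears all denominators at once and serves as the local
  trivialization \<open>u\<close> of \<open>morphism_image\<close> at every point (1 : z) with z
  \<noteq> 0. There the V f i have no common zero, because their span contains monomials, which do
  not vanish at z.\<close>

lemma canonical_coordinates: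
  fixes f :: "nat \<Rightarrow> 'k::alg_closed_field ratfun"
  assumes E: "finite E" and V: "V \<noteq> 0" "rf.span (f ` {..<g}) = (*) (inverse V) ` rf.span ((\<lambda>e. var_rf ^ e) ` E)"
    and inj: "inj_on f {..<g}" and ind: "\<not> rf.dependent (f ` {..<g})" and d: "1 \<le> d" "d < g"
  obtains p where "monomial_coordinates E p g d (morphism_image (g - 1) f)"
proof -
  let ?M = "(\<lambda>e. (var_rf :: 'k ratfun) ^ e) ` E"
  have mult: "(*) V ` (*) (inverse V) ` A = A" for A using V(1) by (simp add: image_image flip: mult.assoc)
  have span: "rf.span ((\<lambda>i. V * f i) ` {..<g}) = rf.span ?M"
  proof -
    have "(\<lambda>i. V * f i) ` {..<g} = (*) V ` f ` {..<g}" by (simp add: image_image)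
    then show ?thesis by (simp only: linear_span_image[OF linear_mult_rf] V(2) mult)
  qed
  have poly: "rf.span ?M \<subseteq> range to_fract"
  proof (rule rf.span_minimal)
    show "rf.subspace (range (to_fract :: 'k poly \<Rightarrow> _))"
    proof (rule rf.subspaceI)
      fix b and x :: "'k ratfun" assume "x \<in> range to_fract"
      then obtain h where "x = to_fract h" by blast
      then have "scale_rf b x = to_fract ([:b:] * h)" by (simp only: to_fract_mult scale_rf_def const_rf_def)
      then show "scale_rf b x \<in> range to_fract" by blast
    next
      show "(0 :: 'k ratfun) \<in> range to_fract" by (metis rangeI to_fract_0)
    qed (auto simp flip: to_fract_add)
  qed (auto simp flip: to_fract_power)
  have "V * f i \<in> range to_fract" if "i < g" for i
    using that span poly rf.span_base[of "V * f i" "(\<lambda>i. V * f i) ` {..<g}"] by blast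
  then have "\<forall>i. \<exists>h. i < g \<longrightarrow> V * f i = to_fract h" by blast
  from choice[OF this] obtain p where "\<forall>i. i < g \<longrightarrow> V * f i = to_fract (p i)" ..
  then have p: "\<And>i. i < g \<Longrightarrow> V * f i = to_fract (p i)" by blast
  have img: "(\<lambda>i. to_fract (p i)) ` {..<g} = (\<lambda>i. V * f i) ` {..<g}" by (intro image_cong) (simp_all add: p)
  have inj_V: "inj ((*) V)" using V(1) by (simp add: inj_def)
  have "monomial_coordinates E p g d (morphism_image (g - 1) f)"
  proof
    show "finite E" "1 \<le> d" "d < g" by fact+
    show "inj_on (\<lambda>i. to_fract (p i)) {..<g}"
    proof (rule inj_onI)
      fix i j assume *: "i \<in> {..<g}" "j \<in> {..<g}" "to_fract (p i) = to_fract (p j)"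
      then have "V * f i = V * f j" using p by simp
      then show "i = j" using V(1) inj * by (auto dest: inj_onD)
    qed
    show "rf.independent ((\<lambda>i. to_fract (p i)) ` {..<g})"
    proof -
      interpret m: Vector_Spaces.linear scale_rf scale_rf "(*) V" by (rule linear_mult_rf)
      have "rf.independent ((*) V ` f ` {..<g})"
        using m.independent_injective_image[OF ind] inj_V by (meson inj_on_subset subset_UNIV)
      then show ?thesis unfolding img by (simp add: image_image)
    qed
    show "rf.span ((\<lambda>i. to_fract (p i)) ` {..<g}) = rf.span ?M" unfolding img by (rule span)
    fix z :: 'k assume z: "z \<noteq> 0"
    let ?x = "vec g (\<lambda>i. poly (p i) z)"
    have "?x \<noteq> 0\<^sub>v g"
    proof
      assume zero: "?x = 0\<^sub>v g"
      have pz: "poly (p i) z = 0" if "i < g" for i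
      proof -
        have "?x $ i = 0\<^sub>v g $ i" using zero by simp
        then show ?thesis using that by simp
      qed
      have "rf.span ((\<lambda>i. to_fract (p i)) ` {..<g}) \<subseteq> to_fract ` {h. poly h z = 0}"
        using pz by (intro rf.span_minimal subspace_vanishing) auto
      then have sub: "?M \<subseteq> to_fract ` {h. poly h z = 0}"
        unfolding img span using rf.span_superset by blast
      \<comment> \<open>A common zero of the \<open>p i\<close> would leave no monomial in the span;
        then f 0 = 0, against independence.\<close>
      have "E = {}"
      proof (rule ccontr)
        assume "E \<noteq> {}"
        then obtain e where "e \<in> E" by blast
        then obtain h where "(var_rf :: 'k ratfun) ^ e = to_fract h" "poly h z = 0" using sub by blast
        then have "[:0, 1:] ^ e = h" by (simp flip: to_fract_power)
        then show False using \<open>poly h z = 0\<close> z by auto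
      qed
      have "to_fract (p 0) \<in> rf.span ((\<lambda>i. to_fract (p i)) ` {..<g})"
        using d by (intro rf.span_base) auto
      then have "to_fract (p 0) = 0" unfolding img span using \<open>E = {}\<close> by simp
      then have "V * f 0 = 0" using p[of 0] d by simp
      then have "f 0 = 0" using V(1) by simp
      moreover have "f 0 \<in> f ` {..<g}" using d by (intro imageI) simp
      ultimately show False using ind rf.dependent_zero[of "f ` {..<g}"] by metis
    qed
    moreover have "has_value (V * f i) 1 z (?x $ i)" if "i < g" for i
      unfolding has_value_def
    proof (intro exI conjI)
      show "degree (p i) \<le> degree (p i)" "degree (1 :: 'k poly) \<le> degree (p i)" by simp_all
      show "hom_eval (degree (p i)) 1 1 z \<noteq> 0" by (simp add: hom_eval_1)
      show "V * f i = Fract (p i) 1" using p[OF that] by (simp add: to_fract_def)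
      show "?x $ i = hom_eval (degree (p i)) (p i) 1 z / hom_eval (degree (p i)) 1 1 z"
        using that by (simp add: hom_eval_1)
    qed
    ultimately show "proj_point ?x \<in> morphism_image (g - 1) f"
      unfolding morphism_image_def using d V(1)
      by (intro CollectI exI[of _ ?x] exI[of _ 1] exI[of _ z] exI[of _ V]) auto
  qed
  then show ?thesis using that by blast
qed

context complementary_charts
begin

text \<open>\<theta> is t^d or t^-d according to whether the possibly singular point lies at 0 or at
  infinity.\<close>

lemma scroll_gonality:
  assumes \<theta>: "\<theta> = var_rf ^ d \<or> \<theta> = inverse var_rf ^ d" and d: "d > 0"
    and \<omega>: "dualizing_sheaf X \<omega>" and f: "monomial_canonical_coordinates X \<omega> f b"
    and Z: "Z = morphism_image (arith_genus X - 1) f"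
  shows "lies_on_scroll 3 (arith_genus X - 1) Z \<and> \<not> lies_on_surface_scroll (arith_genus X - 1) Z \<longleftrightarrow>
    gonality X = 4"
proof -
  interpret U: unibranch_curve "range (subst_rf \<theta>)" X val "affine_point 0" far_point \<theta> S cond
    by (rule unibranch)
  define g where "g = arith_genus X"
  have g: "g = card (- S)" unfolding g_def by (rule U.arith_genus_eq)
  have fin: "finite (- S)" by (rule U.finite_gaps)
  have coords: "inj_on f {..<g}" "\<not> rf.dependent (f ` {..<g})" "rf.span (f ` {..<g}) = H0 X \<omega>"
    "monomial_exponents (g - 1) b" "morphism_image (g - 1) f = monomial_points (g - 1) b"
    using f by (simp_all add: monomial_canonical_coordinates_def g_def Let_def)
  have sub: "- S \<subseteq> {..cond}" using conductor by (metis ComplD atMost_iff nat_le_linear subsetI)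
  \<comment> \<open>An e-fold scroll in the projective space of dimension g - 1 has g - e columns,
    and at least one is required; this is the condition e < g.\<close>
  have scroll: "lies_on_scroll e (g - 1) Z \<longleftrightarrow> e < g \<and> (\<exists>\<delta>>0. chain_number (- S) \<delta> \<le> e)" if e: "2 \<le> e" for e
  proof (cases "e < g")
    case True
    then have "- S \<noteq> {}" using g by auto
    then obtain h where h: "h \<noteq> 0" "H0 X \<omega> = (*) h ` rf.span ((\<lambda>l. \<theta> powi (- int l)) ` (- S))"
      using U.H0_dualizing[OF \<omega>] by blast
    obtain E V where EV: "finite E" "V \<noteq> 0"
      "H0 X \<omega> = (*) (inverse V) ` rf.span ((\<lambda>e. var_rf ^ e) ` E)"
      "(\<exists>\<delta>>0. chain_number E \<delta> \<le> e) \<longleftrightarrow> (\<exists>\<delta>>0. chain_number (- S) \<delta> \<le> e)"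
    proof (cases "\<theta> = var_rf ^ d")
      case theta: True
      \<comment> \<open>The functions t^(-d l) have poles at 0; multiplication by \<open>?T\<close>
        makes them polynomials and reflects the exponents to d (cond - l).\<close>
      let ?T = "(var_rf :: 'k ratfun) ^ (d * cond)"
      let ?E = "(\<lambda>l. d * (cond - l)) ` (- S)"
      have eq: "(\<lambda>l. \<theta> powi (- int l)) ` (- S) = (*) (inverse ?T) ` (\<lambda>e. var_rf ^ e) ` ?E"
        unfolding image_image
      proof (rule image_cong)
        fix l assume "l \<in> - S"
        then obtain k where k: "cond = l + k" using sub le_Suc_ex by blast
        have "(var_rf :: 'k ratfun) \<noteq> 0" by simp
        then show "\<theta> powi (- int l) = inverse ?T * var_rf ^ (d * (cond - l))"
          by (simp add: theta k power_int_minus power_add distrib_left power_mult)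
      qed simp
      have "(*) h ` (*) (inverse ?T) ` Y = (*) (inverse (inverse h * ?T)) ` Y" for Y
        by (simp add: image_image mult.assoc)
      then have "H0 X \<omega> = (*) (inverse (inverse h * ?T)) ` rf.span ((\<lambda>e. var_rf ^ e) ` ?E)"
        unfolding h(2) eq linear_span_image[OF linear_mult_rf] .
      then show ?thesis
        using that[of ?E "inverse h * ?T"] h(1) fin chain_number_reflect_dilate[OF fin sub d, of e] True g by simp
    next
      case False
      then have theta: "\<theta> = inverse var_rf ^ d" using \<theta> by blast
      \<comment> \<open>For \<theta> = t^-d the functions \<theta>^-l are already the monomials t^(d
        l).\<close>
      let ?E = "(*) d ` (- S)"
      have "(\<lambda>l. \<theta> powi (- int l)) ` (- S) = (\<lambda>e. var_rf ^ e) ` ?E"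
        unfolding image_image
        by (rule image_cong) (simp_all add: theta power_int_minus power_inverse power_mult)
      then have "H0 X \<omega> = (*) (inverse (inverse h)) ` rf.span ((\<lambda>e. var_rf ^ e) ` ?E)"
        unfolding h(2) by simp
      then show ?thesis
        using that[of ?E "inverse h"] h(1) fin chain_number_dilate[OF fin d, of e] True g by simp
    qed
    obtain p where p: "monomial_coordinates E p g e (morphism_image (g - 1) f)"
      using canonical_coordinates[OF EV(1,2) _ coords(1,2), of e] EV(3) coords(3) e True by auto
    interpret M: monomial_coordinates E p g e "morphism_image (g - 1) f" by (rule p)
    have "lies_on_scroll e (g - 1) Z \<longleftrightarrow> (\<exists>\<delta>>0. chain_number E \<delta> \<le> e)"
      using M.scroll_imp_chain M.chain_imp_scroll[OF coords(5,4)] by (auto simp: Z g_def)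
    then show ?thesis using EV(4) True by blast
  next
    case False
    have "\<not> lies_on_scroll e (g - 1) Z" using False e by (auto simp: lies_on_scroll_def)
    then show ?thesis using False by blast
  qed
  have gon: "gonality X = 4 \<longleftrightarrow> (\<exists>\<delta>>0. chain_number (- S) \<delta> \<le> 3) \<and> \<not> (\<exists>\<delta>>0. chain_number (- S) \<delta> \<le> 2)"
  proof -
    obtain \<delta> where \<delta>: "\<delta> > 0" "gonality X = int (U.pencil_degree \<delta>)"
      "\<And>\<epsilon>. \<epsilon> > 0 \<Longrightarrow> U.pencil_degree \<delta> \<le> U.pencil_degree \<epsilon>" using U.gonality_eq by blast
    have le: "(\<exists>\<epsilon>>0. U.pencil_degree \<epsilon> \<le> k) \<longleftrightarrow> gonality X \<le> int k" for k
    proof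
      assume "\<exists>\<epsilon>>0. U.pencil_degree \<epsilon> \<le> k"
      then obtain \<epsilon> where "\<epsilon> > 0" "U.pencil_degree \<epsilon> \<le> k" by blast
      then show "gonality X \<le> int k" using \<delta>(2) \<delta>(3)[of \<epsilon>] by linarith
    next
      assume "gonality X \<le> int k"
      then show "\<exists>\<epsilon>>0. U.pencil_degree \<epsilon> \<le> k" using \<delta>(1,2) by (intro exI[of _ \<delta>]) linarith
    qed
    have "(\<exists>\<delta>>0. chain_number (- S) \<delta> \<le> 3) \<longleftrightarrow> gonality X \<le> 4"
      using U.pencil_degree_iff_chain_number[of 3] le[of 4] by simp
    moreover have "(\<exists>\<delta>>0. chain_number (- S) \<delta> \<le> 2) \<longleftrightarrow> gonality X \<le> 3"
      using U.pencil_degree_iff_chain_number[of 2] le[of 3] by simp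
    moreover have "gonality X = 4 \<longleftrightarrow> gonality X \<le> 4 \<and> \<not> gonality X \<le> 3" by linarith
    ultimately show ?thesis by (simp only:)
  qed
  \<comment> \<open>For g \<le> 3 the plane convention applies to \<open>C'\<close>; correspondingly
    the gonality is at most 3.\<close>
  have small: "\<exists>\<delta>>0. chain_number (- S) \<delta> \<le> 2" if "g \<le> 3"
    using small_chain_number[of "- S"] that fin g by simp
  have "lies_on_surface_scroll (g - 1) Z \<longleftrightarrow> g \<le> 3 \<or> (\<exists>\<delta>>0. chain_number (- S) \<delta> \<le> 2)"
    using scroll[of 2] by (auto simp: lies_on_surface_scroll_def)
  moreover have "lies_on_scroll 3 (g - 1) Z \<longleftrightarrow> 3 < g \<and> (\<exists>\<delta>>0. chain_number (- S) \<delta> \<le> 3)"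
    by (rule scroll) simp
  ultimately show ?thesis
    unfolding g_def[symmetric] gon using small not_le[of g 3] by argo
qed

end

text \<open>A common factor d of the exponents is absorbed by replacing s and t by their d-th
  powers, which reaches every pair over an algebraically closed field.\<close>

lemma monomial_points_power:
  assumes c: "\<And>i. i \<le> n \<Longrightarrow> a i = d * c i" and d: "d > 0"
  shows "(monomial_points n a :: 'k::alg_closed_field vec set set) =
    {proj_point (vec (n + 1) (\<lambda>i. t ^ c i * s ^ (c n - c i))) | s t. (s, t) \<noteq> (0, 0)}" (is "_ = ?R")
proof -
  have *: "vec (n + 1) (\<lambda>i. t ^ a i * s ^ (a n - a i)) =
      vec (n + 1) (\<lambda>i. (t ^ d) ^ c i * (s ^ d) ^ (c n - c i))" for s t :: 'k
    by (intro eq_vecI) (simp_all add: c flip: power_mult diff_mult_distrib2)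
  show ?thesis
  proof
    have "(s ^ d, t ^ d) \<noteq> (0, 0)" if "(s, t) \<noteq> (0, 0)" for s t :: 'k using that d by auto
    then show "monomial_points n a \<subseteq> ?R" unfolding monomial_points_def * by blast
  next
    show "?R \<subseteq> monomial_points n a"
    proof
      fix P assume "P \<in> ?R"
      then obtain s t where P: "P = proj_point (vec (n + 1) (\<lambda>i. t ^ c i * s ^ (c n - c i)))" "(s, t) \<noteq> (0, 0)"
        by blast
      obtain y z where "y ^ d = s" "z ^ d = t" using nth_root_exists[OF d] by metis
      then have "(y, z) \<noteq> (0, 0)" "P = proj_point (vec (n + 1) (\<lambda>i. z ^ a i * y ^ (a n - a i)))"
        using P d unfolding * by (auto simp: zero_power)
      then show "P \<in> monomial_points n a" unfolding monomial_points_def by blast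
    qed
  qed
qed

theorem theorem5p1:
  fixes n :: nat and a b :: "nat \<Rightarrow> nat"
    and C :: "('k::alg_closed_field vec set, 'k) curve"
    and \<omega> :: "'k vec set \<Rightarrow> 'k ratfun set" and f :: "nat \<Rightarrow> 'k ratfun"
    and C' :: "'k vec set set"
  assumes "n \<ge> 1" and "monomial_exponents n a" and "C = monomial_curve n a"
    and "\<exists>!P. P \<in> points C \<and> singular C P"
    and "dualizing_sheaf C \<omega>"
    and "monomial_canonical_coordinates C \<omega> f b"
    and "C' = morphism_image (arith_genus C - 1) f"
  shows "lies_on_scroll 3 (arith_genus C - 1) C' \<and>
           \<not> lies_on_surface_scroll (arith_genus C - 1) C' \<longleftrightarrow>
         gonality C = 4"
proof -
  define d where "d = Gcd (a ` {..n})"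
  define c where "c i = a i div d" for i
  have a0: "a 0 = 0" and mono: "\<And>i j. i < j \<Longrightarrow> j \<le> n \<Longrightarrow> a i < a j"
    using assms(2) by (auto simp: monomial_exponents_def strict_mono_on_def)
  have an: "a n > 0" using mono[of 0 n] a0 assms(1) by simp
  then have d: "d > 0" unfolding d_def by (metis Gcd_0_iff atMost_iff gr0I image_eqI insertE order_refl subsetD singletonD)
  have ac: "a i = d * c i" if "i \<le> n" for i
    using that by (simp add: c_def d_def)
  have c0: "c 0 = 0" by (simp add: c_def a0)
  have cn: "i < n \<Longrightarrow> c i < c n" for i
    using mono[of i n] ac[of i] ac[of n] by simp
  have c_pos: "0 < i \<Longrightarrow> i \<le> n \<Longrightarrow> 0 < c i" for i
    using mono[of 0 i] ac[of i] a0 by simp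
  have cle: "i \<le> n \<Longrightarrow> c i \<le> c n" for i using cn[of i] by (cases "i = n") auto
  have "a ` {..n} = (*) d ` c ` {..n}" unfolding image_image using ac by (intro image_cong) auto
  then have "d = d * Gcd (c ` {..n})" using Gcd_mult[of d "c ` {..n}"] d_def by simp
  then have gcd: "Gcd (c ` {..n}) = 1" using d by simp
  \<comment> \<open>A common divisor of the reversed exponents divides c n, the one for i = 0, and
    hence all c i.\<close>
  have gcd': "Gcd ((\<lambda>i. c n - c i) ` {..n}) = 1"
  proof -
    let ?g = "Gcd ((\<lambda>i. c n - c i) ` {..n})"
    have *: "?g dvd c n - c i" if "i \<le> n" for i using that by (intro Gcd_dvd) auto
    then have n: "?g dvd c n" using *[of 0] c0 by simp
    have "?g dvd c i" if "i \<le> n" for i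
      using dvd_diff_nat[OF n *[OF that]] cle[OF that] by simp
    then have "?g dvd Gcd (c ` {..n})" by (intro Gcd_greatest) auto
    then show ?thesis using gcd by simp
  qed
  have var_a: "to_fract (monom 1 (a i)) = (var_rf :: 'k ratfun) ^ a i" for i
    by (simp add: monom_altdef flip: to_fract_power)
  have pts: "(monomial_points n a :: 'k vec set set) =
      {proj_point (vec (n + 1) (\<lambda>i. t ^ c i * s ^ (c n - c i))) | s t. (s, t) \<noteq> (0, 0)}"
    using ac d by (rule monomial_points_power)
  let ?\<theta> = "var_rf ^ d :: 'k ratfun" and ?\<eta> = "inverse var_rf ^ d :: 'k ratfun"
  \<comment> \<open>In the chart around t = 0 the coordinate 0 is 1 and no factor is split off; in
    the chart at infinity the coordinate n is 1 after the factor t^(a n) is removed.\<close>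
  interpret zero: monomial_chart ?\<theta> n a c 0 n 1
  proof
    show "ord_at 0 ?\<theta> \<noteq> 0" using d by (simp add: ord_at.v_power ord_at_var)
    show "to_fract (monom 1 (a i)) = 1 * ?\<theta> ^ c i" if "i \<le> n" for i
      unfolding var_a by (simp add: ac[OF that] power_mult)
  qed (use cn[of 0] assms(1) c0 cn gcd pts in auto)
  interpret inf: monomial_chart ?\<eta> n a "\<lambda>i. c n - c i" n 0 "var_rf ^ a n"
  proof
    show "ord_at 0 ?\<eta> \<noteq> 0" using d by (simp add: ord_at.v_power ord_at.v_inverse ord_at_var del: power_inverse)
    show "to_fract (monom 1 (a i)) = var_rf ^ a n * ?\<eta> ^ (c n - c i)" if "i \<le> n" for i
    proof -
      have "a n = a i + d * (c n - c i)"
        using ac[OF that] ac[of n] cle[OF that] by (simp add: diff_mult_distrib2)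
      then show ?thesis by (simp add: var_a power_add power_inverse flip: power_mult)
    qed
    have "vec (n + 1) (\<lambda>i. t ^ c i * s ^ (c n - c i)) =
        vec (n + 1) (\<lambda>i. s ^ (c n - c i) * t ^ (c n - c 0 - (c n - c i)))" for s t :: 'k
      using cle by (intro eq_vecI) (simp_all add: c0)
    then show "monomial_points n a = {proj_point (vec (n + 1)
        (\<lambda>i. t ^ (c n - c i) * s ^ (c n - c 0 - (c n - c i)))) | s t :: 'k. (s, t) \<noteq> (0, 0)}"
      unfolding pts by auto
  qed (use cn[of 0] c_pos assms(1) c0 gcd' in auto)
  have far: "zero.far_point = inf.affine_point 0" "inf.far_point = zero.affine_point 0"
    unfolding zero.far_point_def inf.far_point_def zero.affine_point_def inf.affine_point_def
    using cn cn[of 0] c0 c_pos by (auto intro!: arg_cong[of _ _ proj_point] eq_vecI simp: zero_power)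
  \<comment> \<open>Gaps in both semigroups would make both origins singular, and these are
    different points of the curve.\<close>
  have "zero.S = UNIV \<or> inf.S = UNIV"
  proof (rule ccontr)
    assume "\<not> (zero.S = UNIV \<or> inf.S = UNIV)"
    then have "singular C (zero.affine_point 0)" "singular C zero.far_point"
      using zero.singular_origin inf.singular_origin unfolding far assms(3) by auto
    moreover have "zero.affine_point 0 \<in> points C" "zero.far_point \<in> points C"
      by (simp_all add: assms(3) zero.points_eq)
    ultimately show False using assms(4) zero.far_point_neq by metis
  qed
  then show ?thesis
  proof
    assume S: "zero.S = UNIV"
    \<comment> \<open>Here only the point at infinity can be singular, so t^-d takes the role of
      \<open>T\<close>.\<close>
    have "inverse ?\<eta> = ?\<theta>" by (simp add: power_inverse)
    with S far zero.monomial_chart_axioms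
    interpret complementary_charts ?\<eta> n a "\<lambda>i. c n - c i" n 0 "var_rf ^ a n" c 0 n 1
      by (intro complementary_charts.intro complementary_charts_axioms.intro inf.monomial_chart_axioms) simp_all
    show ?thesis
      using scroll_gonality[of d \<omega> f b C'] d assms(5,6,7) unfolding assms(3) by simp
  next
    assume S: "inf.S = UNIV"
    have "inverse ?\<theta> = ?\<eta>" by (simp add: power_inverse)
    with S far inf.monomial_chart_axioms
    interpret complementary_charts ?\<theta> n a c 0 n 1 "\<lambda>i. c n - c i" n 0 "var_rf ^ a n"
      by (intro complementary_charts.intro complementary_charts_axioms.intro zero.monomial_chart_axioms) simp_all
    show ?thesis
      using scroll_gonality[of d \<omega> f b C'] d assms(5,6,7) unfolding assms(3) by simp
  qed
qed

end
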